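(* Let $s\in(0,1)$, let $N>2s$ be an integer dimension, let $\Omega\subset\mathbb{R}^N$ be a smooth bounded domain, let $p,q>1$ and let $a,b,c\in\mathbb{R}$. Let $\mu_1\le\mu_2$ be the eigenvalues of the matrix $A=\begin{pmatrix}a&b\\ b&c\end{pmatrix}$. Assume that $b\ge 0$, $\mu_2<\lambda_{1,s}$ and $$p+q<2^*_s:=\frac{2N}{N-2s}.$$ Then the system $$\begin{cases}(-\Delta)^s u=au+bv+\frac{2p}{p+q}u^{p-1}v^q & \text{in }\Omega,\\ (-\Delta)^s v=bu+cv+\frac{2q}{p+q}u^pv^{q-1} & \text{in }\Omega,\\ u>0,\ v>0 & \text{in }\Omega,\\ u=v=0 & \text{in }\mathbb{R}^N\setminus\Omega\end{cases}$$ admits a (weak) solution.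
   Context: For measurable $u:\mathbb{R}^N\to\mathbb{R}$ let $[u]_s^2:=\frac{C(N,s)}{2}\int_{\mathbb{R}^{2N}}\frac{|u(x)-u(y)|^2}{|x-y|^{N+2s}}\,dx\,dy$, where $C(N,s)>0$ is the normalization constant for which $(-\Delta)^s$ has Fourier symbol $|\xi|^{2s}$ (so $[u]_s^2=\int_{\mathbb{R}^N}|(-\Delta)^{s/2}u|^2dx$ when finite). Set $H^s(\mathbb{R}^N)=\{u\in L^2(\mathbb{R}^N):[u]_s<\infty\}$ and $X(\Omega)=\{u\in H^s(\mathbb{R}^N): u=0\text{ a.e. in }\mathbb{R}^N\setminus\Omega\}$, a Hilbert space with inner product $\langle u,v\rangle_X=\frac{C(N,s)}{2}\int_{\mathbb{R}^{2N}}\frac{(u(x)-u(y))(v(x)-v(y))}{|x-y|^{N+2s}}dx\,dy$. Let $Y(\Omega)=X(\Omega)\times X(\Omega)$ with $\langle(u,v),(\varphi,\psi)\rangle_Y=\langle u,\varphi\rangle_X+\langle v,\psi\rangle_X$. The number $\lambda_{1,s}$ is the first eigenvalue of $(-\Delta)^s$ in $\Omega$ with $u=0$ in $\mathbb{R}^N\setminus\Omega$: $\lambda_{1,s}=\inf_{u\in X(\Omega)\setminus\{0\}}[u]_s^2/\|u\|_{L^2}^2>0$. A (weak) solution of a system $(-\Delta)^su=f(u,v)$, $(-\Delta)^sv=g(u,v)$ in $\Omega$, $u=v=0$ in $\mathbb{R}^N\setminus\Omega$, is a pair $(u,v)\in Y(\Omega)$ such that $\langle(u,v),(\varphi,\psi)\rangle_Y=\int_\Omega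 f(u,v)\varphi\,dx+\int_\Omega g(u,v)\psi\,dx$ for all $(\varphi,\psi)\in Y(\Omega)$; for the system with positivity conditions one also requires $u>0$ and $v>0$ in $\Omega$. *)

theory Defs
  imports "HOL-Analysis.Analysis" "Jordan_Normal_Form.Char_Poly"
begin

(* Inner products are written "inner x y" because Jordan_Normal_Form reuses the infix dot. *)

section \<open>Smooth bounded domains\<close>

primrec Ck :: "nat \<Rightarrow> ('a::euclidean_space \<Rightarrow> real) \<Rightarrow> bool" where
  "Ck 0 f \<longleftrightarrow> continuous_on UNIV f"
| "Ck (Suc k) f \<longleftrightarrow>
     (\<forall>x. f differentiable (at x)) \<and> (\<forall>v. Ck k (\<lambda>x. frechet_derivative f (at x) v))"

definition smooth :: "('a::euclidean_space \<Rightarrow> real) \<Rightarrow> bool" where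
  "smooth f \<longleftrightarrow> (\<forall>k. Ck k f)"

(* Near each boundary point, the set is the strict epigraph, in some unit direction e, of a
   smooth function of the component orthogonal to e.  Taking an arbitrary e accounts for
   "after rotating the coordinates"; a smooth function on the orthogonal complement of e
   is the restriction of a smooth function on the whole space. *)
definition smooth_boundary :: "'a::euclidean_space set \<Rightarrow> bool" where
  "smooth_boundary \<Omega> \<longleftrightarrow>
     (\<forall>x0\<in>frontier \<Omega>. \<exists>r>0. \<exists>e \<gamma>. norm e = 1 \<and> smooth \<gamma> \<and>
        \<Omega> \<inter> ball x0 r = {x \<in> ball x0 r. inner x e > \<gamma> (x - inner x e *\<^sub>R e)})"

definition smooth_bounded_domain :: "'a::euclidean_space set \<Rightarrow> bool" where
  "smooth_bounded_domain \<Omega> \<longleftrightarrow>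
     open \<Omega> \<and> connected \<Omega> \<and> \<Omega> \<noteq> {} \<and> bounded \<Omega> \<and> smooth_boundary \<Omega>"


section \<open>The normalization constant of the fractional Laplacian\<close>

(* The singular integral P.V. \<integral> (u(x) - u(y)) / |x - y|^(N+2s) dy, symmetrized in z = y - x;
   for bounded C^2 functions the symmetrized integral converges absolutely. *)
definition unnormalized_frac_laplacian ::
  "real \<Rightarrow> ('a::euclidean_space \<Rightarrow> complex) \<Rightarrow> 'a \<Rightarrow> complex" where
  "unnormalized_frac_laplacian s u x =
     (LINT z|lborel. (2 * u x - u (x + z) - u (x - z)) /\<^sub>R
        (norm z powr (real DIM('a) + 2 * s))) / 2"

(* The C(N,s) > 0 for which the normalized operator has Fourier symbol |xi|^(2s),
   i.e. multiplies every plane wave exp(i xi.x) by |xi|^(2s). *)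
definition frac_const :: "'a::euclidean_space itself \<Rightarrow> real \<Rightarrow> real" where
  "frac_const _ s = (THE C. C > 0 \<and>
     (\<forall>(\<xi>::'a) x. C *\<^sub>R unnormalized_frac_laplacian s (\<lambda>y. cis (inner \<xi> y)) x =
                   (norm \<xi> powr (2 * s)) *\<^sub>R cis (inner \<xi> x)))"


section \<open>Function spaces\<close>

(* Elements are Borel functions, not equivalence classes; equality of classes is
   equality almost everywhere. *)

definition gagliardo_sq :: "real \<Rightarrow> ('a::euclidean_space \<Rightarrow> real) \<Rightarrow> ennreal" where
  "gagliardo_sq s u = ennreal (frac_const TYPE('a) s / 2) *
     (\<integral>\<^sup>+ z. (case z of (x, y) \<Rightarrow>
        ennreal (\<bar>u x - u y\<bar>\<^sup>2 / norm (x - y) powr (real DIM('a) + 2 * s)))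
      \<partial>(lborel \<Otimes>\<^sub>M lborel))"

definition Hs :: "real \<Rightarrow> ('a::euclidean_space \<Rightarrow> real) set" where
  "Hs s = {u \<in> borel_measurable lborel.
             integrable lborel (\<lambda>x. (u x)\<^sup>2) \<and> gagliardo_sq s u < \<infinity>}"

definition X_space :: "real \<Rightarrow> 'a::euclidean_space set \<Rightarrow> ('a \<Rightarrow> real) set" where
  "X_space s \<Omega> = {u \<in> Hs s. AE x in lborel. x \<notin> \<Omega> \<longrightarrow> u x = 0}"

definition X_inner :: "real \<Rightarrow> ('a::euclidean_space \<Rightarrow> real) \<Rightarrow> ('a \<Rightarrow> real) \<Rightarrow> real" where
  "X_inner s u v = frac_const TYPE('a) s / 2 *
     (LINT z|(lborel \<Otimes>\<^sub>M lborel). (case z of (x, y) \<Rightarrow>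
        (u x - u y) * (v x - v y) / norm (x - y) powr (real DIM('a) + 2 * s)))"

definition Y_space ::
  "real \<Rightarrow> 'a::euclidean_space set \<Rightarrow> (('a \<Rightarrow> real) \<times> ('a \<Rightarrow> real)) set" where
  "Y_space s \<Omega> = X_space s \<Omega> \<times> X_space s \<Omega>"

definition Y_inner :: "real \<Rightarrow> ('a::euclidean_space \<Rightarrow> real) \<times> ('a \<Rightarrow> real) \<Rightarrow>
    ('a \<Rightarrow> real) \<times> ('a \<Rightarrow> real) \<Rightarrow> real" where
  "Y_inner s U \<Phi> = X_inner s (fst U) (fst \<Phi>) + X_inner s (snd U) (snd \<Phi>)"

definition first_eigenvalue :: "real \<Rightarrow> 'a::euclidean_space set \<Rightarrow> real" where
  "first_eigenvalue s \<Omega> =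
     (INF u \<in> {u \<in> X_space s \<Omega>. \<not> (AE x in lborel. u x = 0)}.
        enn2real (gagliardo_sq s u) / (LINT x|lborel. (u x)\<^sup>2))"


section \<open>Weak solutions\<close>

(* The set_integrable conjuncts say that the right-hand integrals exist; without them
   Lebesgue integrals of non-integrable functions would silently count as 0. *)
definition weak_solution :: "real \<Rightarrow> 'a::euclidean_space set \<Rightarrow> (real \<Rightarrow> real \<Rightarrow> real) \<Rightarrow>
    (real \<Rightarrow> real \<Rightarrow> real) \<Rightarrow> ('a \<Rightarrow> real) \<times> ('a \<Rightarrow> real) \<Rightarrow> bool" where
  "weak_solution s \<Omega> f g = (\<lambda>(u, v). (u, v) \<in> Y_space s \<Omega> \<and>
     (\<forall>(\<phi>, \<psi>) \<in> Y_space s \<Omega>.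
        set_integrable lborel \<Omega> (\<lambda>x. f (u x) (v x) * \<phi> x) \<and>
        set_integrable lborel \<Omega> (\<lambda>x. g (u x) (v x) * \<psi> x) \<and>
        Y_inner s (u, v) (\<phi>, \<psi>) =
          (LINT x:\<Omega>|lborel. f (u x) (v x) * \<phi> x) +
          (LINT x:\<Omega>|lborel. g (u x) (v x) * \<psi> x)))"

definition positive_weak_solution :: "real \<Rightarrow> 'a::euclidean_space set \<Rightarrow>
    (real \<Rightarrow> real \<Rightarrow> real) \<Rightarrow> (real \<Rightarrow> real \<Rightarrow> real) \<Rightarrow>
    ('a \<Rightarrow> real) \<times> ('a \<Rightarrow> real) \<Rightarrow> bool" where
  "positive_weak_solution s \<Omega> f g = (\<lambda>(u, v).
     weak_solution s \<Omega> f g (u, v) \<and> (\<forall>x\<in>\<Omega>. u x > 0 \<and> v x > 0))"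

end

theory Submission
  imports Defs "HOL-Complex_Analysis.Great_Picard"
begin

text \<open>
  Write \<open>Q\<close> for the quadratic form of the linear part of the system and \<open>G\<close> for the integral of
  \<open>\<bar>u\<bar> powr p * \<bar>v\<bar> powr q\<close>. Since \<open>\<mu>\<^sub>2 < \<lambda>\<^sub>1\<close>, \<open>Q\<close> is coercive, and it attains its minimum \<open>m > 0\<close>
  on \<open>{G = 1}\<close>: bounded sequences in \<open>X(\<Omega>)\<close> have almost everywhere convergent subsequences, the form
  is lower semicontinuous by Fatou's lemma, and the Sobolev inequality at the critical exponent gives
  uniform integrability of the subcritical terms. As \<open>b \<ge> 0\<close>, passing to absolute values does not
  increase \<open>Q\<close>, so the minimizer may be taken nonnegative. Its Euler-Lagrange equation is the system
  up to a multiplier, which is removed by scaling because \<open>p + q \<noteq> 2\<close>. Each component is a weak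
  supersolution, so the nonlocal strong maximum principle makes it positive almost everywhere in
  \<open>\<Omega>\<close>, and a change on a null set makes it positive everywhere.
\<close>

section \<open>Lebesgue measure and the kernel\<close>

text \<open>\<open>frac_const\<close> is a definite description, so even its positivity, on which
  membership in \<open>Hs\<close> and every energy estimate depend, has to be derived from existence
  and uniqueness. This requires the symbol of the kernel to be radial and homogeneous, and hence
  Lebesgue measure to be invariant under orthogonal maps. The embeddings come from the double
  integral itself, without Fourier transform or weak topologies. Comparing \<open>w x\<close> with
  the values of \<open>w\<close> on a ball whose radius depends on \<open>\<bar>w x\<bar>\<close>
  gives the Sobolev inequality; comparing it with the mean over a small ball gives compactness,
  because countably many means converge along one subsequence. Almost everywhere convergence alone
  would allow mass of \<open>G\<close> to concentrate; the gap between \<open>p + q\<close> and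
  \<open>crit\<close> excludes this. \<open>Q\<close> has degree 2 and \<open>G\<close> degree
  \<open>p + q\<close>, so comparing \<open>Q\<close> with a power of \<open>G\<close> removes the
  constraint and replaces a multiplier rule. The absolute values in \<open>G\<close> make it
  meaningful for variations of either sign.\<close>

lemma nn_integral_lborel_affine:
  fixes f :: "'a::euclidean_space \<Rightarrow> ennreal"
  assumes [measurable]: "f \<in> borel_measurable borel" and "c \<noteq> 0"
  shows "(\<integral>\<^sup>+x. f x \<partial>lborel) = ennreal (\<bar>c\<bar> ^ DIM('a)) * (\<integral>\<^sup>+x. f (t + c *\<^sub>R x) \<partial>lborel)"
  by (subst lborel_affine[OF \<open>c \<noteq> 0\<close>, of t])
     (simp add: nn_integral_density nn_integral_distr nn_integral_cmult)

lemma nn_integral_lborel_translate: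
  fixes f :: "'a::euclidean_space \<Rightarrow> ennreal"
  assumes "f \<in> borel_measurable borel"
  shows "(\<integral>\<^sup>+x. f (t + x) \<partial>lborel) = (\<integral>\<^sup>+x. f x \<partial>lborel)"
  using nn_integral_lborel_affine[OF assms, of 1 t] by simp

lemma nn_integral_lborel_reflect:
  fixes f :: "'a::euclidean_space \<Rightarrow> ennreal"
  assumes "f \<in> borel_measurable borel"
  shows "(\<integral>\<^sup>+x. f (t - x) \<partial>lborel) = (\<integral>\<^sup>+x. f x \<partial>lborel)"
  using nn_integral_lborel_affine[OF assms, of "-1" t] by simp

text \<open>The image measure is translation invariant, hence a multiple of Lebesgue measure by
  Fubini's theorem; the unit ball shows that the factor is one.\<close>
lemma emeasure_orthogonal_vimage:
  fixes T :: "'a::euclidean_space \<Rightarrow> 'a"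
  assumes T: "orthogonal_transformation T" and A[measurable]: "A \<in> sets borel"
  shows "(\<integral>\<^sup>+x. indicator A (T x) \<partial>lborel) = emeasure lborel A"
proof -
  define B :: "'a set" where "B = ball 0 1"
  have lin: "linear T" using T by (rule orthogonal_transformation_linear)
  have [measurable]: "T \<in> borel_measurable borel"
    using linear_continuous_on[of T UNIV] lin
    by (auto intro!: borel_measurable_continuous_onI simp: linear_linear)
  have [measurable]: "B \<in> sets borel" by (simp add: B_def)
  obtain S where S: "\<And>y. T (S y) = y"
    using orthogonal_transformation_surj[OF T] by (metis surj_f_inv_f)
  have [simp]: "T (x - y) = T x - T y" "T (x + y) = T x + T y" for x y
    using lin by (auto simp: linear_diff linear_add)
  have TB: "indicator B (T x) = (indicator B x :: ennreal)" for x
    using orthogonal_transformation_norm[OF T, of x] by (simp add: B_def indicator_def)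
  have "(\<integral>\<^sup>+x. indicator A (T x) \<partial>lborel) * emeasure lborel B
      = (\<integral>\<^sup>+x. (\<integral>\<^sup>+y. indicator A (T x) * indicator B y \<partial>lborel) \<partial>lborel)"
    by (simp add: nn_integral_cmult nn_integral_multc)
  also have "\<dots> = (\<integral>\<^sup>+x. (\<integral>\<^sup>+y. indicator A (T x) * indicator B (T x + y) \<partial>lborel) \<partial>lborel)"
  proof (rule nn_integral_cong)
    fix x :: 'a
    show "(\<integral>\<^sup>+y. indicator A (T x) * indicator B y \<partial>lborel)
        = (\<integral>\<^sup>+y. indicator A (T x) * indicator B (T x + y) \<partial>lborel :: ennreal)"
      using nn_integral_lborel_translate[of "\<lambda>y. indicator A (T x) * indicator B y" "T x"] by simp
  qed
  also have "\<dots> = (\<integral>\<^sup>+y. (\<integral>\<^sup>+x. indicator A (T x) * indicator B (T x + y) \<partial>lborel) \<partial>lborel)"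
    by (rule lborel_pair.Fubini') measurable
  \<comment> \<open>Translating \<open>x\<close> by a preimage \<open>S y\<close> of
    \<open>y\<close> moves the shift from the ball to \<open>A\<close>. After the next exchange the
    inner integral is a reflection and yields the measure of \<open>A\<close>.\<close>
  also have "\<dots> = (\<integral>\<^sup>+y. (\<integral>\<^sup>+x. indicator A (T x - y) * indicator B (T x) \<partial>lborel) \<partial>lborel)"
  proof (rule nn_integral_cong)
    fix y :: 'a
    show "(\<integral>\<^sup>+x. indicator A (T x) * indicator B (T x + y) \<partial>lborel)
        = (\<integral>\<^sup>+x. indicator A (T x - y) * indicator B (T x) \<partial>lborel :: ennreal)"
      using nn_integral_lborel_translate[of "\<lambda>x. indicator A (T x - y) * indicator B (T x)" "S y"]
      by (simp add: S add.commute)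
  qed
  also have "\<dots> = (\<integral>\<^sup>+x. (\<integral>\<^sup>+y. indicator A (T x - y) * indicator B (T x) \<partial>lborel) \<partial>lborel)"
    by (rule lborel_pair.Fubini'[symmetric]) measurable
  also have "\<dots> = (\<integral>\<^sup>+x. emeasure lborel A * indicator B (T x) \<partial>lborel)"
    by (subst nn_integral_multc) (auto simp: nn_integral_lborel_reflect[of "indicator A"])
  also have "\<dots> = emeasure lborel A * emeasure lborel B"
    by (simp add: TB nn_integral_cmult)
  finally have eq: "(\<integral>\<^sup>+x. indicator A (T x) \<partial>lborel) * emeasure lborel B
      = emeasure lborel A * emeasure lborel B" .
  have "emeasure lborel B \<noteq> \<infinity>"
    unfolding B_def using emeasure_lborel_ball_finite[of 0 1] by (auto simp: less_top)
  moreover have "emeasure lborel B \<noteq> 0"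
  proof -
    have "unit_ball_vol (real DIM('a)) > 0" by simp
    then have "unit_ball_vol (real DIM('a)) \<noteq> 0" by linarith
    then show ?thesis by (simp add: B_def emeasure_ball)
  qed
  ultimately show ?thesis
    using eq by (metis ennreal_mult_divide_eq infinity_ennreal_def)
qed

lemma nn_integral_orthogonal:
  fixes T :: "'a::euclidean_space \<Rightarrow> 'a"
  assumes T: "orthogonal_transformation T" and f[measurable]: "f \<in> borel_measurable borel"
  shows "(\<integral>\<^sup>+x. f (T x) \<partial>lborel) = (\<integral>\<^sup>+x. f x \<partial>lborel)"
proof -
  have lin: "linear T" using T by (rule orthogonal_transformation_linear)
  have [measurable]: "T \<in> borel_measurable borel"
    using linear_continuous_on[of T UNIV] lin
    by (auto intro!: borel_measurable_continuous_onI simp: linear_linear)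
  have "distr lborel borel T = lborel"
  proof (rule measure_eqI)
    fix A assume "A \<in> sets (distr lborel borel T)"
    then have [measurable]: "A \<in> sets borel" by simp
    have "emeasure (distr lborel borel T) A = (\<integral>\<^sup>+x. indicator A (T x) \<partial>lborel)"
      by (subst nn_integral_indicator[symmetric]) (auto simp: nn_integral_distr simp del: nn_integral_indicator)
    then show "emeasure (distr lborel borel T) A = emeasure lborel A"
      using emeasure_orthogonal_vimage[OF T] by simp
  qed simp
  then have "(\<integral>\<^sup>+x. f x \<partial>lborel) = (\<integral>\<^sup>+x. f x \<partial>distr lborel borel T)" by simp
  then show ?thesis by (simp add: nn_integral_distr)
qed

text \<open>The Householder reflection in the hyperplane orthogonal to \<open>f - e\<close>
  exchanges the two unit vectors. For \<open>f = e\<close> the division by zero makes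
  \<open>T\<close> the identity.\<close>

lemma orthogonal_transformation_exists_unit:
  fixes e f :: "'a::euclidean_space"
  assumes "norm e = 1" "norm f = 1"
  obtains T where "orthogonal_transformation T" "T f = e"
proof -
  define w where "w = f - e"
  define T where "T = (\<lambda>z. z - (2 * inner w z / inner w w) *\<^sub>R w)"
  have ee: "inner e e = 1" "inner f f = 1"
    using assms by (auto simp: norm_eq_1)
  have lin: "linear T"
    by (rule linearI) (auto simp: T_def inner_add_right algebra_simps add_divide_distrib)
  have "inner (T x) (T y) = inner x y" for x y
    by (cases "w = 0")
       (auto simp: T_def inner_diff_left inner_diff_right inner_commute field_simps)
  then have ort: "orthogonal_transformation T"
    using lin by (simp add: orthogonal_transformation_def)
  have ww: "inner w w = 2 * inner w f"
    using ee by (simp add: w_def inner_diff_left inner_diff_right inner_commute)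
  have "T f = e"
  proof (cases "w = 0")
    case False
    then have "inner w w \<noteq> 0" by simp
    then have "2 * inner w f / inner w w = 1" using ww by simp
    then have "T f = f - w" by (simp only: T_def scaleR_one)
    then show ?thesis by (simp add: w_def)
  qed (simp add: T_def w_def)
  then show ?thesis using that ort by blast
qed

section \<open>Integrability of the kernel with its singularity weakened by two powers\<close>

lemma dyadic_bracket:
  fixes x :: real
  assumes "1 \<le> x"
  obtains n :: nat where "2 ^ n \<le> x" "x < 2 * 2 ^ n"
proof -
  have "\<exists>m. x < 2 ^ m" using real_arch_pow[of 2 x] by auto
  define m where "m = (LEAST m. x < 2 ^ m)"
  have m: "x < 2 ^ m" unfolding m_def by (rule LeastI_ex) fact
  then have "m \<noteq> 0" using assms by (cases m) auto
  then obtain n where n: "m = Suc n" by (cases m) auto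
  have "\<not> x < 2 ^ n"
    using not_less_Least[of n "\<lambda>m. x < 2 ^ m"] n by (simp add: m_def)
  then show ?thesis using that[of n] m n by auto
qed

lemma suminf_ennreal_geometric_finite:
  assumes "0 \<le> C" "0 \<le> r" "r < (1::real)"
  shows "(\<Sum>n. ennreal (C * r ^ n)) < \<infinity>"
proof -
  have "summable (\<lambda>n. C * r ^ n)"
    using assms by (intro summable_mult summable_geometric) auto
  then show ?thesis
    using assms by (subst suminf_ennreal2) auto
qed

lemma ennreal_le_suminf:
  fixes f :: "nat \<Rightarrow> ennreal"
  shows "f n \<le> (\<Sum>n. f n)"
  using sum_le_suminf[of f "{n}"] by simp

text \<open>The series integrates to the unit ball volume times the sum of
  \<open>a n * \<rho> n ^ DIM('a)\<close>, so a geometric bound on these products makes it an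
  integrable majorant.\<close>

lemma nn_integral_suminf_ball_finite:
  fixes a :: "nat \<Rightarrow> real" and \<rho> :: "nat \<Rightarrow> real"
  assumes a: "\<And>n. 0 \<le> a n" "\<And>n. 0 \<le> \<rho> n"
    and C: "0 \<le> C" "0 \<le> r" "r < 1" "\<And>n. a n * \<rho> n ^ DIM('a) \<le> C * r ^ n"
  shows "(\<integral>\<^sup>+z. (\<Sum>n. ennreal (a n) * indicator (ball (0::'a::euclidean_space) (\<rho> n)) z) \<partial>lborel) < \<infinity>"
proof -
  define \<omega> where "\<omega> = unit_ball_vol (real DIM('a))"
  have \<omega>: "0 \<le> \<omega>" by (simp add: \<omega>_def)
  have "(\<integral>\<^sup>+z. (\<Sum>n. ennreal (a n) * indicator (ball (0::'a) (\<rho> n)) z) \<partial>lborel)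
     = (\<Sum>n. ennreal (a n) * emeasure lborel (ball (0::'a) (\<rho> n)))"
  proof (subst nn_integral_suminf)
    show "(\<lambda>z. ennreal (a i) * indicator (ball (0::'a) (\<rho> i)) z) \<in> borel_measurable lborel" for i
      by (intro borel_measurable_times_ennreal borel_measurable_indicator) auto
    show "(\<Sum>i. \<integral>\<^sup>+z. ennreal (a i) * indicator (ball (0::'a) (\<rho> i)) z \<partial>lborel)
        = (\<Sum>n. ennreal (a n) * emeasure lborel (ball (0::'a) (\<rho> n)))"
      by (intro suminf_cong nn_integral_cmult_indicator) simp
  qed
  also have "\<dots> \<le> (\<Sum>n. ennreal (\<omega> * C * r ^ n))"
  proof (rule suminf_le)
    fix n
    have "ennreal (a n) * emeasure lborel (ball (0::'a) (\<rho> n)) = ennreal (\<omega> * (a n * \<rho> n ^ DIM('a)))"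
      using a \<omega> by (simp add: emeasure_ball \<omega>_def ennreal_mult'[symmetric] mult_ac)
    also have "\<dots> \<le> ennreal (\<omega> * C * r ^ n)"
      using mult_left_mono[OF C(4)[of n] \<omega>] by (intro ennreal_leI) (simp add: mult_ac)
    finally show "ennreal (a n) * emeasure lborel (ball (0::'a) (\<rho> n)) \<le> ennreal (\<omega> * C * r ^ n)" .
  qed auto
  also have "\<dots> < \<infinity>"
    using C \<omega> by (intro suminf_ennreal_geometric_finite) auto
  finally show ?thesis .
qed

text \<open>Cover space by dyadic balls: outside the unit ball the kernel contributes
  a geometric series of ratio \<open>2 powr (-2s)\<close>, inside one of ratio \<open>2 powr (2s-2)\<close>.\<close>
lemma nn_integral_truncated_kernel_finite:
  fixes s :: real
  assumes "0 < s" "s < 1"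
  shows "(\<integral>\<^sup>+z. ennreal (min 1 ((norm z)\<^sup>2) / norm z powr (real DIM('a) + 2 * s)) \<partial>(lborel :: 'a::euclidean_space measure)) < \<infinity>"
proof -
  define N where "N = real DIM('a)"
  have N: "0 < N" by (simp add: N_def)
  define \<alpha> where "\<alpha> = N + 2 * s"
  have \<alpha>: "0 < \<alpha>" using N assms by (simp add: \<alpha>_def)
  \<comment> \<open>\<open>a n\<close> bounds the kernel on the shell
    \<open>2 ^ n \<le> norm z < 2 * 2 ^ n\<close>. Inside the unit ball the shells are indexed by
    the inverse radius, and there \<open>b n\<close> bounds \<open>(norm z)\<^sup>2\<close> times
    the kernel.\<close>
  define a where "a = (\<lambda>n::nat. (2 ^ n) powr (- \<alpha>) :: real)"
  define b where "b = (\<lambda>n::nat. ((1/2) ^ n)\<^sup>2 * (2 * 2 ^ n) powr \<alpha> :: real)"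
  have pw: "(2 ^ n :: real) = 2 powr (real n)" for n by (simp add: powr_realpow)
  have pw': "((1/2) ^ n :: real) = 2 powr (- real n)" for n
    by (simp add: powr_minus powr_realpow power_one_over inverse_eq_divide)
  define \<Phi> where "\<Phi> = (\<lambda>z::'a. (\<Sum>n. ennreal (a n) * indicator (ball 0 (2 * 2 ^ n)) z))"
  \<comment> \<open>The factor 2 in the radius is slack: the inner shells only give
    \<open>norm z \<le> (1/2) ^ n\<close>, and the balls are open.\<close>
  define \<Psi> where "\<Psi> = (\<lambda>z::'a. (\<Sum>n. ennreal (b n) * indicator (ball 0 (2 * (1/2) ^ n)) z))"
  have fin1: "(\<integral>\<^sup>+z. \<Phi> z \<partial>lborel) < \<infinity>"
    unfolding \<Phi>_def
  proof (rule nn_integral_suminf_ball_finite[where C = "2 powr N" and r = "2 powr (- 2 * s)"])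
    fix n
    have "2 * 2 ^ n = (2 powr (1 + real n) :: real)" by (simp add: pw powr_add)
    then have "a n * (2 * 2 ^ n) ^ DIM('a) = a n * (2 powr (1 + real n)) powr N"
      by (simp only: N_def powr_realpow powr_gt_zero)
    also have "\<dots> = 2 powr N * (2 powr (- 2 * s)) ^ n"
      by (simp add: a_def pw powr_powr powr_realpow[symmetric] powr_add[symmetric] \<alpha>_def algebra_simps)
    finally show "a n * (2 * 2 ^ n) ^ DIM('a) \<le> 2 powr N * (2 powr (- 2 * s)) ^ n" by simp
  next
    show "2 powr (- 2 * s) < 1" using assms powr_less_mono[of "- 2 * s" 0 2] by simp
  qed (auto simp: a_def)
  have fin2: "(\<integral>\<^sup>+z. \<Psi> z \<partial>lborel) < \<infinity>"
    unfolding \<Psi>_def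
  proof (rule nn_integral_suminf_ball_finite[where C = "2 powr (N + \<alpha>)" and r = "2 powr (2 * s - 2)"])
    fix n
    have "2 * (1/2) ^ n = (2 powr (1 - real n) :: real)"
      by (simp add: pw' powr_diff powr_minus_divide)
    then have "b n * (2 * (1/2) ^ n) ^ DIM('a) = b n * (2 powr (1 - real n)) powr N"
      by (simp only: N_def powr_realpow powr_gt_zero)
    also have "b n * (2 powr (1 - real n)) powr N
        = 2 powr (- 2 * real n) * (2 powr (1 + real n)) powr \<alpha> * (2 powr (1 - real n)) powr N"
    proof -
      have "2 * 2 ^ n = (2 powr (1 + real n) :: real)" by (simp add: pw powr_add)
      then show ?thesis
        by (simp only: b_def pw' power2_eq_square powr_add[symmetric]) simp
    qed
    also have "\<dots> = 2 powr (N + \<alpha>) * (2 powr (2 * s - 2)) ^ n"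
      by (simp add: powr_powr powr_realpow[symmetric] powr_add[symmetric] \<alpha>_def algebra_simps)
    finally show "b n * (2 * (1/2) ^ n) ^ DIM('a) \<le> 2 powr (N + \<alpha>) * (2 powr (2 * s - 2)) ^ n" by (rule eq_refl)
  next
    show "2 powr (2 * s - 2) < 1" using assms powr_less_mono[of "2 * s - 2" 0 2] by simp
  qed (auto simp: b_def)
  have bound: "ennreal (min 1 ((norm z)\<^sup>2) / norm z powr \<alpha>) \<le> \<Phi> z + \<Psi> z" for z :: 'a
  proof (cases "norm z \<ge> 1")
    case True
    then obtain n where n: "2 ^ n \<le> norm z" "norm z < 2 * 2 ^ n" by (rule dyadic_bracket)
    have "min 1 ((norm z)\<^sup>2) / norm z powr \<alpha> \<le> 1 / norm z powr \<alpha>"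
      by (intro divide_right_mono) auto
    also have "\<dots> = norm z powr (- \<alpha>)" by (simp add: powr_minus_divide)
    also have "\<dots> \<le> a n" unfolding a_def using n \<alpha> by (intro powr_mono2') auto
    finally have "ennreal (min 1 ((norm z)\<^sup>2) / norm z powr \<alpha>) \<le> ennreal (a n) * indicator (ball 0 (2 * 2 ^ n)) z"
      using n by (auto simp: ennreal_leI)
    also have "\<dots> \<le> \<Phi> z"
      unfolding \<Phi>_def by (rule ennreal_le_suminf)
    finally show ?thesis by (simp add: add_increasing2)
  next
    case False
    show ?thesis
    proof (cases "z = 0")
      case nz: False
      then have "1 \<le> 1 / norm z" using False by (simp add: field_simps)
      then obtain n where n: "2 ^ n \<le> 1 / norm z" "1 / norm z < 2 * 2 ^ n" by (rule dyadic_bracket)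
      have n1: "norm z \<le> (1/2) ^ n" using n(1) nz by (simp add: field_simps power_one_over)
      have "min 1 ((norm z)\<^sup>2) / norm z powr \<alpha> \<le> ((1/2) ^ n)\<^sup>2 / norm z powr \<alpha>"
        using n1 by (intro divide_right_mono) (auto intro: min.coboundedI2)
      also have "\<dots> = ((1/2) ^ n)\<^sup>2 * (1 / norm z) powr \<alpha>"
        using nz by (simp add: powr_divide)
      also have "\<dots> \<le> b n" unfolding b_def
        using n \<alpha> by (intro mult_left_mono powr_mono2) auto
      finally have le_b: "min 1 ((norm z)\<^sup>2) / norm z powr \<alpha> \<le> b n" .
      have "ennreal (min 1 ((norm z)\<^sup>2) / norm z powr \<alpha>)
          \<le> ennreal (b n) * indicator (ball 0 (2 * (1/2) ^ n)) z"
      proof -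
        have "norm z < 2 * (1/2) ^ n" using n1 by (rule le_less_trans) simp
        then show ?thesis using le_b by (simp add: ennreal_leI)
      qed
      also have "\<dots> \<le> \<Psi> z"
        unfolding \<Psi>_def by (rule ennreal_le_suminf)
      finally show ?thesis by (simp add: add_increasing)
    qed simp
  qed
  have "(\<integral>\<^sup>+z. ennreal (min 1 ((norm z)\<^sup>2) / norm z powr \<alpha>) \<partial>(lborel :: 'a measure)) \<le> (\<integral>\<^sup>+z. \<Phi> z + \<Psi> z \<partial>lborel)"
    by (intro nn_integral_mono bound)
  also have "\<dots> = (\<integral>\<^sup>+z. \<Phi> z \<partial>lborel) + (\<integral>\<^sup>+z. \<Psi> z \<partial>lborel)"
    unfolding \<Phi>_def \<Psi>_def
    by (rule nn_integral_add)
       (auto intro!: borel_measurable_suminf_order borel_measurable_times_ennreal borel_measurable_indicator)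
  also have "\<dots> < \<infinity>" using fin1 fin2 by simp
  finally show ?thesis by (simp add: \<alpha>_def N_def)
qed

section \<open>The normalization constant is positive\<close>

text \<open>The factor by which the unnormalized operator multiplies the plane wave of frequency
  \<open>\<xi>\<close>. Values in \<open>ennreal\<close> allow rotating and scaling the integral
  before it is known to be finite.\<close>

definition frac_symbol :: "real \<Rightarrow> 'a::euclidean_space \<Rightarrow> ennreal" where
  "frac_symbol s \<xi> = (\<integral>\<^sup>+z. ennreal ((1 - cos (inner \<xi> z)) / norm z powr (real DIM('a) + 2 * s)) \<partial>lborel)"

text \<open>Writing \<open>1 - cos t\<close> as \<open>2 * (sin (t / 2))\<^sup>2\<close> bounds it
  by 2 and by \<open>t\<^sup>2 / 2\<close>, so the numerator supplies the two powers that tame the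
  kernel at the origin.\<close>

lemma frac_symbol_finite:
  fixes \<xi> :: "'a::euclidean_space"
  assumes s: "0 < s" "s < 1" and \<xi>: "norm \<xi> = 1"
  shows "frac_symbol s \<xi> < \<infinity>"
proof -
  define k where "k z = norm z powr (real DIM('a) + 2 * s)" for z :: 'a
  have le: "1 - cos (inner \<xi> z) \<le> 2 * min 1 ((norm z)\<^sup>2)" for z
  proof -
    have "\<bar>inner \<xi> z\<bar> \<le> norm z" using Cauchy_Schwarz_ineq2[of \<xi> z] \<xi> by simp
    then have "(inner \<xi> z)\<^sup>2 \<le> (norm z)\<^sup>2" using abs_le_square_iff[of "inner \<xi> z" "norm z"] by simp
    moreover have "1 - cos (inner \<xi> z) = 2 * (sin (inner \<xi> z / 2))\<^sup>2"
      using cos_double_sin[of "inner \<xi> z / 2"] by simp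
    moreover have "4 * (sin (inner \<xi> z / 2))\<^sup>2 \<le> (inner \<xi> z)\<^sup>2"
      using abs_sin_x_le_abs_x[of "inner \<xi> z / 2"] abs_le_square_iff[of "sin (inner \<xi> z / 2)" "inner \<xi> z / 2"]
      by (simp add: power_divide)
    moreover have "1 - cos (inner \<xi> z) \<le> 2" using cos_ge_minus_one[of "inner \<xi> z"] by simp
    moreover have "0 \<le> (sin (inner \<xi> z / 2))\<^sup>2" by simp
    ultimately have "1 - cos (inner \<xi> z) \<le> 2 * (norm z)\<^sup>2" "1 - cos (inner \<xi> z) \<le> 2"
      by linarith+
    then show ?thesis by (simp add: min_def)
  qed
  have "frac_symbol s \<xi> \<le> (\<integral>\<^sup>+z. ennreal 2 * ennreal (min 1 ((norm z)\<^sup>2) / k z) \<partial>lborel)"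
    unfolding frac_symbol_def k_def[symmetric]
  proof (rule nn_integral_mono)
    fix z :: 'a
    have "(1 - cos (inner \<xi> z)) / k z \<le> 2 * (min 1 ((norm z)\<^sup>2) / k z)"
      using divide_right_mono[OF le[of z], of "k z"] by (simp add: k_def)
    then show "ennreal ((1 - cos (inner \<xi> z)) / k z) \<le> ennreal 2 * ennreal (min 1 ((norm z)\<^sup>2) / k z)"
      by (subst ennreal_mult'[symmetric]) (auto intro!: ennreal_leI)
  qed
  also have "\<dots> = ennreal 2 * (\<integral>\<^sup>+z. ennreal (min 1 ((norm z)\<^sup>2) / k z) \<partial>lborel)"
    by (rule nn_integral_cmult) (simp add: k_def[abs_def])
  also have "\<dots> < \<infinity>"
    using nn_integral_truncated_kernel_finite[OF s, where 'a = 'a]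
    by (simp add: k_def ennreal_mult_less_top)
  finally show ?thesis .
qed

text \<open>On the unit ball around \<open>\<xi>\<close> the argument \<open>inner \<xi> z\<close>
  stays between 0 and 2, hence below \<open>pi\<close>, and the integrand is strictly positive on a
  set of positive measure.\<close>

lemma frac_symbol_pos:
  fixes \<xi> :: "'a::euclidean_space"
  assumes \<xi>: "norm \<xi> = 1"
  shows "frac_symbol s \<xi> > 0"
proof (rule ccontr)
  define f where "f = (\<lambda>z::'a. (1 - cos (inner \<xi> z)) / norm z powr (real DIM('a) + 2 * s))"
  have [measurable]: "f \<in> borel_measurable borel" unfolding f_def by measurable
  assume "\<not> frac_symbol s \<xi> > 0"
  then have "(\<integral>\<^sup>+z. ennreal (f z) \<partial>lborel) = 0" by (simp add: frac_symbol_def f_def)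
  then have "AE z in lborel. ennreal (f z) = 0"
    by (subst (asm) nn_integral_0_iff_AE) auto
  then have "AE z in lborel. z \<notin> ball \<xi> 1"
  proof eventually_elim
    case (elim z)
    show ?case
    proof
      assume "z \<in> ball \<xi> 1"
      then have "norm (\<xi> - z) < 1" by (simp add: dist_norm)
      then have "\<bar>inner \<xi> (\<xi> - z)\<bar> < 1"
        using Cauchy_Schwarz_ineq2[of \<xi> "\<xi> - z"] \<xi> by simp
      then have "\<bar>1 - inner \<xi> z\<bar> < 1" using \<xi> by (simp add: inner_diff_right norm_eq_1)
      then have t: "0 < inner \<xi> z" "inner \<xi> z < 2" by auto
      then have "cos (inner \<xi> z) < cos 0"
        using pi_gt3 by (intro cos_monotone_0_pi) auto
      moreover have "z \<noteq> 0" using t by auto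
      ultimately have "f z > 0" by (simp add: f_def)
      then show False using elim by simp
    qed
  qed
  then have "emeasure lborel (ball \<xi> 1) = 0"
    by (subst (asm) AE_iff_measurable[where N = "ball \<xi> 1"]) auto
  then show False
    using unit_ball_vol_pos[OF of_nat_0_le_iff, of "DIM('a)"] by (simp add: emeasure_ball)
qed

text \<open>With \<open>t = norm \<xi>\<close>, rotating \<open>\<xi> /\<^sub>R t\<close> to
  \<open>e\<close> turns \<open>inner \<xi> z\<close> into \<open>inner e (t *\<^sub>R T z)\<close>.
  Scaling then draws \<open>t powr (N + 2 * s)\<close> from the kernel and returns
  \<open>t ^ N\<close> to Lebesgue measure.\<close>

lemma frac_symbol_homogeneous:
  fixes \<xi> e :: "'a::euclidean_space"
  assumes \<xi>: "\<xi> \<noteq> 0" and e: "norm e = 1"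
  shows "frac_symbol s \<xi> = ennreal (norm \<xi> powr (2 * s)) * frac_symbol s e"
proof -
  define \<alpha> where "\<alpha> = real DIM('a) + 2 * s"
  define t where "t = norm \<xi>"
  have t: "t > 0" using \<xi> by (simp add: t_def)
  have "norm (\<xi> /\<^sub>R t) = 1" using \<xi> by (simp add: t_def)
  from orthogonal_transformation_exists_unit[OF e this]
  obtain T where T: "orthogonal_transformation T" "T (\<xi> /\<^sub>R t) = e" by blast
  have \<xi>z: "inner \<xi> z = inner e (t *\<^sub>R T z)" for z
  proof -
    have "inner e (T z) = inner (\<xi> /\<^sub>R t) z"
      using T by (metis orthogonal_transformation_def)
    then show ?thesis using t by simp
  qed
  define g where "g = (\<lambda>z::'a. ennreal ((1 - cos (inner e z)) / norm z powr \<alpha>))"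
  have [measurable]: "g \<in> borel_measurable borel" unfolding g_def by measurable
  have "frac_symbol s \<xi> = (\<integral>\<^sup>+z. ennreal (t powr \<alpha>) * g (t *\<^sub>R T z) \<partial>lborel)"
    unfolding frac_symbol_def
  proof (rule nn_integral_cong)
    fix z :: 'a
    have "norm (t *\<^sub>R T z) powr \<alpha> = t powr \<alpha> * norm z powr \<alpha>"
      using t T(1) by (simp add: orthogonal_transformation_norm powr_mult)
    then show "ennreal ((1 - cos (inner \<xi> z)) / norm z powr (real DIM('a) + 2 * s))
        = ennreal (t powr \<alpha>) * g (t *\<^sub>R T z)"
      using t by (simp add: g_def \<xi>z \<alpha>_def[symmetric] ennreal_mult'[symmetric])
  qed
  also have "\<dots> = ennreal (t powr \<alpha>) * (\<integral>\<^sup>+z. g (t *\<^sub>R T z) \<partial>lborel)"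
    using nn_integral_orthogonal[OF T(1), of "\<lambda>z. ennreal (t powr \<alpha>) * g (t *\<^sub>R z)"]
      nn_integral_orthogonal[OF T(1), of "\<lambda>z. g (t *\<^sub>R z)"]
    by (simp add: nn_integral_cmult)
  also have "(\<integral>\<^sup>+z. g (t *\<^sub>R T z) \<partial>lborel) = (\<integral>\<^sup>+z. g (t *\<^sub>R z) \<partial>lborel)"
    using nn_integral_orthogonal[OF T(1), of "\<lambda>z. g (t *\<^sub>R z)"] by simp
  also have "ennreal (t powr \<alpha>) * \<dots> = ennreal (t powr (2 * s)) * (ennreal (t ^ DIM('a)) * (\<integral>\<^sup>+z. g (t *\<^sub>R z) \<partial>lborel))"
  proof -
    have "t powr \<alpha> = t powr (2 * s) * t ^ DIM('a)"
      using t by (simp add: \<alpha>_def powr_add powr_realpow)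
    then show ?thesis by (simp add: ennreal_mult' mult.assoc t less_imp_le)
  qed
  also have "ennreal (t ^ DIM('a)) * (\<integral>\<^sup>+z. g (t *\<^sub>R z) \<partial>lborel) = (\<integral>\<^sup>+z. g z \<partial>lborel)"
    using nn_integral_lborel_affine[of g t 0] t by simp
  finally show ?thesis by (simp add: frac_symbol_def g_def \<alpha>_def t_def)
qed

text \<open>The addition theorems reduce the symmetrized difference to a real multiple of the wave
  itself. Integrability is not assumed: for an infinite symbol the Bochner integral and
  \<open>enn2real\<close> are both 0.\<close>

lemma unnormalized_frac_laplacian_cis:
  fixes \<xi> x :: "'a::euclidean_space"
  shows "unnormalized_frac_laplacian s (\<lambda>y. cis (inner \<xi> y)) x
    = enn2real (frac_symbol s \<xi>) *\<^sub>R cis (inner \<xi> x)"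
proof -
  define g where "g = (\<lambda>z::'a. (1 - cos (inner \<xi> z)) / norm z powr (real DIM('a) + 2 * s))"
  have [measurable]: "g \<in> borel_measurable borel" unfolding g_def by measurable
  have g0: "0 \<le> g z" for z by (simp add: g_def)
  have "(2 * cis (inner \<xi> x) - cis (inner \<xi> (x + z)) - cis (inner \<xi> (x - z))) /\<^sub>R
      norm z powr (real DIM('a) + 2 * s) = (2 * g z) *\<^sub>R cis (inner \<xi> x)" for z
  proof -
    have "2 * cis (inner \<xi> x) - cis (inner \<xi> (x + z)) - cis (inner \<xi> (x - z))
        = (2 * (1 - cos (inner \<xi> z))) *\<^sub>R cis (inner \<xi> x)"
      by (simp add: complex_eq_iff inner_add_right inner_diff_right cos_add cos_diff sin_add sin_diff algebra_simps)
    then show ?thesis by (simp add: g_def divide_inverse mult_ac)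
  qed
  then have "unnormalized_frac_laplacian s (\<lambda>y. cis (inner \<xi> y)) x
      = (LINT z|lborel. (2 * g z) *\<^sub>R cis (inner \<xi> x)) / 2"
    by (simp add: unnormalized_frac_laplacian_def)
  also have "(LINT z|lborel. (2 * g z) *\<^sub>R cis (inner \<xi> x)) = (LINT z|lborel. 2 * g z) *\<^sub>R cis (inner \<xi> x)"
  proof (cases "integrable lborel g")
    case False
    have "g z = norm ((2 * g z) *\<^sub>R cis (inner \<xi> x)) / 2" for z
      using g0[of z] by simp
    then have "integrable lborel g" if "integrable lborel (\<lambda>z. (2 * g z) *\<^sub>R cis (inner \<xi> x))"
      using integrable_divide[OF integrable_norm[OF that], of 2] by presburger
    with False have "\<not> integrable lborel (\<lambda>z. (2 * g z) *\<^sub>R cis (inner \<xi> x))" by blast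
    moreover have "\<not> integrable lborel (\<lambda>z. 2 * g z)" using False by simp
    ultimately show ?thesis by (simp add: not_integrable_integral_eq)
  qed simp
  also have "(LINT z|lborel. 2 * g z) = 2 * (LINT z|lborel. g z)" by simp
  also have "(LINT z|lborel. g z) = enn2real (frac_symbol s \<xi>)"
    using g0 by (simp add: integral_eq_nn_integral frac_symbol_def) (simp add: g_def)
  finally show ?thesis by (simp add: g0 scaleR_conv_of_real)
qed

text \<open>Resolves the definite description: by homogeneity of the symbol \<open>1 / J\<close>
  works for all frequencies, and the single unit frequency \<open>e\<close> at the origin already
  forces this value.\<close>

lemma frac_const_pos:
  assumes s: "0 < s" "s < 1"
  shows "frac_const TYPE('a::euclidean_space) s > 0"
proof -
  obtain e :: 'a where e: "e \<in> Basis" using nonempty_Basis by blast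
  then have ne: "norm e = 1" by simp
  define J where "J = enn2real (frac_symbol s e)"
  have J: "J > 0"
    using frac_symbol_pos[OF ne, of s] frac_symbol_finite[OF s ne] by (simp add: J_def enn2real_positive_iff)
  have sym: "enn2real (frac_symbol s \<xi>) = norm \<xi> powr (2 * s) * J" for \<xi> :: 'a
  proof (cases "\<xi> = 0")
    case False
    then show ?thesis
      by (simp add: frac_symbol_homogeneous[OF False ne] J_def enn2real_mult)
  qed (simp add: frac_symbol_def)
  define P where "P = (\<lambda>C. C > 0 \<and> (\<forall>(\<xi>::'a) x. C *\<^sub>R unnormalized_frac_laplacian s (\<lambda>y. cis (inner \<xi> y)) x =
                   (norm \<xi> powr (2 * s)) *\<^sub>R cis (inner \<xi> x)))"
  have "P (1 / J)"
    using J by (simp add: P_def unnormalized_frac_laplacian_cis sym)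
  moreover have "C = 1 / J" if "P C" for C
  proof -
    have "C *\<^sub>R unnormalized_frac_laplacian s (\<lambda>y. cis (inner e y)) 0 = (norm e powr (2 * s)) *\<^sub>R cis (inner e 0)"
      using that unfolding P_def by blast
    then have "complex_of_real (C * J) = 1"
      by (simp add: unnormalized_frac_laplacian_cis sym ne scaleR_conv_of_real)
    then have "C * J = 1" by (simp only: of_real_eq_1_iff)
    then show ?thesis using J by (simp add: field_simps)
  qed
  ultimately have "frac_const TYPE('a) s = 1 / J"
    unfolding frac_const_def P_def[symmetric] by (rule the_equality)
  then show ?thesis using J by simp
qed

section \<open>The fractional Sobolev space\<close>

locale frac_domain =
  fixes s :: real and \<Omega> :: "'a::euclidean_space set"
  assumes s_pos: "0 < s" and s_less_1: "s < 1" and dim_gt: "2 * s < real DIM('a)"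
    and open_\<Omega>: "open \<Omega>" and bounded_\<Omega>: "bounded \<Omega>"
begin

abbreviation \<E> :: "('a \<Rightarrow> real) \<Rightarrow> ('a \<Rightarrow> real) \<Rightarrow> real" where
  "\<E> \<equiv> X_inner s"

abbreviation \<H> :: "('a \<Rightarrow> real) set" where
  "\<H> \<equiv> Hs s"

abbreviation \<X> :: "('a \<Rightarrow> real) set" where
  "\<X> \<equiv> X_space s \<Omega>"

definition \<kappa> :: real where
  "\<kappa> = frac_const TYPE('a) s / 2"

definition df :: "('a \<Rightarrow> real) \<Rightarrow> ('a \<Rightarrow> real) \<Rightarrow> 'a \<times> 'a \<Rightarrow> real" where
  "df u v z = (u (fst z) - u (snd z)) * (v (fst z) - v (snd z))
     / norm (fst z - snd z) powr (real DIM('a) + 2 * s)"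

lemma \<kappa>_pos: "0 < \<kappa>"
  using frac_const_pos[OF s_pos s_less_1] by (simp add: \<kappa>_def)

lemma X_inner_eq: "\<E> u v = \<kappa> * (LINT z|(lborel \<Otimes>\<^sub>M lborel). df u v z)"
  by (simp add: X_inner_def df_def[abs_def] case_prod_beta' \<kappa>_def)

lemma df_measurable [measurable]:
  assumes [measurable]: "u \<in> borel_measurable borel" "v \<in> borel_measurable borel"
  shows "df u v \<in> borel_measurable (lborel \<Otimes>\<^sub>M lborel)"
  unfolding df_def by measurable

lemma df_self: "df u u z = (u (fst z) - u (snd z))\<^sup>2 / norm (fst z - snd z) powr (real DIM('a) + 2 * s)"
  by (simp add: df_def power2_eq_square)

lemma df_self_nonneg [simp]: "0 \<le> df u u z"
  by (simp add: df_self)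

lemma X_inner_self_nonneg [simp]: "0 \<le> \<E> u u"
  using \<kappa>_pos by (simp add: X_inner_eq)

lemma gagliardo_sq_eq: "gagliardo_sq s u = ennreal \<kappa> * (\<integral>\<^sup>+z. ennreal (df u u z) \<partial>(lborel \<Otimes>\<^sub>M lborel))"
  by (simp add: gagliardo_sq_def df_self case_prod_beta' \<kappa>_def)

text \<open>Here positivity of the normalization constant matters: since
  \<open>0 * \<infinity> = 0\<close> in \<open>ennreal\<close>, a zero constant would make
  \<open>gagliardo_sq\<close> finite for every function.\<close>

lemma Hs_iff:
  "u \<in> \<H> \<longleftrightarrow> u \<in> borel_measurable borel \<and> integrable lborel (\<lambda>x. (u x)\<^sup>2)
     \<and> integrable (lborel \<Otimes>\<^sub>M lborel) (df u u)"
proof -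
  have "gagliardo_sq s u < \<infinity> \<longleftrightarrow> integrable (lborel \<Otimes>\<^sub>M lborel) (df u u)"
    if [measurable]: "u \<in> borel_measurable borel"
    using \<kappa>_pos by (auto simp: integrable_iff_bounded gagliardo_sq_eq ennreal_mult_less_top)
  then show ?thesis by (auto simp: Hs_def)
qed

lemma Hs_measurable: "u \<in> \<H> \<Longrightarrow> u \<in> borel_measurable borel"
  by (simp add: Hs_iff)

lemma gagliardo_sq_Hs:
  assumes "u \<in> \<H>"
  shows "gagliardo_sq s u = ennreal (\<E> u u)"
  using assms \<kappa>_pos by (simp add: gagliardo_sq_eq X_inner_eq Hs_iff nn_integral_eq_integral ennreal_mult')

lemma df_integrable:
  assumes u: "u \<in> \<H>" and v: "v \<in> \<H>"
  shows "integrable (lborel \<Otimes>\<^sub>M lborel) (df u v)"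
proof (rule Bochner_Integration.integrable_bound)
  show "integrable (lborel \<Otimes>\<^sub>M lborel) (\<lambda>z. df u u z + df v v z)"
    using u v by (simp add: Hs_iff)
  show "df u v \<in> borel_measurable (lborel \<Otimes>\<^sub>M lborel)"
    using u v by (intro df_measurable) (simp_all add: Hs_iff)
  have "norm (df u v z) \<le> norm (df u u z + df v v z)" for z
  proof -
    have *: "\<bar>a * b\<bar> \<le> a\<^sup>2 + b\<^sup>2" for a b :: real
    proof -
      have "2 * \<bar>a * b\<bar> \<le> a\<^sup>2 + b\<^sup>2"
        using sum_squares_bound[of "\<bar>a\<bar>" "\<bar>b\<bar>"] by (simp add: abs_mult mult.assoc)
      then show ?thesis by simp
    qed
    show ?thesis
      using divide_right_mono[OF *[of "u (fst z) - u (snd z)" "v (fst z) - v (snd z)"],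
          of "norm (fst z - snd z) powr (real DIM('a) + 2 * s)"]
      by (simp add: df_def[of u v] df_self abs_mult add_divide_distrib[symmetric])
  qed
  then show "AE z in lborel \<Otimes>\<^sub>M lborel. norm (df u v z) \<le> norm (df u u z + df v v z)" by simp
qed

lemma df_add_scaled:
  "df (\<lambda>x. u x + t * f x) (\<lambda>x. v x + r * g x) z = df u v z + r * df u g z + t * df f v z + t * r * df f g z"
  unfolding df_def times_divide_eq_right add_divide_distrib[symmetric]
  by (rule arg_cong[where f = "\<lambda>a. a / _"]) (simp add: algebra_simps)

lemma X_inner_add_scaled:
  assumes "u \<in> \<H>" "\<phi> \<in> \<H>"
  shows "\<E> (\<lambda>x. u x + t * \<phi> x) (\<lambda>x. u x + t * \<phi> x)
    = \<E> u u + 2 * t * \<E> u \<phi> + t\<^sup>2 * \<E> \<phi> \<phi>"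
proof -
  have "df \<phi> u = df u \<phi>" by (simp add: df_def fun_eq_iff mult.commute)
  then have "df (\<lambda>x. u x + t * \<phi> x) (\<lambda>x. u x + t * \<phi> x)
      = (\<lambda>z. df u u z + 2 * t * df u \<phi> z + t\<^sup>2 * df \<phi> \<phi> z)"
    unfolding df_add_scaled[abs_def] by (simp add: power2_eq_square fun_eq_iff)
  then show ?thesis
    using df_integrable[OF assms] df_integrable[OF assms(1,1)] df_integrable[OF assms(2,2)]
    by (simp add: X_inner_eq distrib_left)
qed

lemma X_inner_scale_left: "\<E> (\<lambda>x. t * u x) v = t * \<E> u v"
proof -
  have "df (\<lambda>x. t * u x) v = (\<lambda>z. t * df u v z)"
    by (simp add: df_def fun_eq_iff right_diff_distrib[symmetric] mult.assoc)
  then show ?thesis by (simp add: X_inner_eq)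
qed

lemma X_inner_zero_right [simp]: "\<E> u (\<lambda>x. 0) = 0"
  by (simp add: X_inner_eq df_def[abs_def])

lemma AE_pair_fst:
  assumes "AE x in (lborel :: 'a measure). P x"
  shows "AE z in (lborel :: 'a measure) \<Otimes>\<^sub>M (lborel :: 'a measure). P (fst z)"
    and "AE z in (lborel :: 'a measure) \<Otimes>\<^sub>M (lborel :: 'a measure). P (snd z)"
proof -
  obtain N where N: "N \<in> null_sets lborel" "{x. \<not> P x} \<subseteq> N"
    using assms unfolding eventually_ae_filter by auto
  then have [measurable]: "N \<in> sets lborel" by auto
  have "AE z in (lborel :: 'a measure) \<Otimes>\<^sub>M (lborel :: 'a measure). fst z \<notin> N"
    using N(1) by (intro AE_I'[where N = "N \<times> UNIV"] lborel_pair.times_in_null_sets1) auto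
  then show "AE z in (lborel :: 'a measure) \<Otimes>\<^sub>M (lborel :: 'a measure). P (fst z)"
    by eventually_elim (use N in auto)
  have "AE z in (lborel :: 'a measure) \<Otimes>\<^sub>M (lborel :: 'a measure). snd z \<notin> N"
    using N(1) by (intro AE_I'[where N = "UNIV \<times> N"] lborel_pair.times_in_null_sets2) auto
  then show "AE z in (lborel :: 'a measure) \<Otimes>\<^sub>M (lborel :: 'a measure). P (snd z)"
    by eventually_elim (use N in auto)
qed

lemma X_inner_cong_AE:
  assumes [measurable]: "u \<in> borel_measurable borel" "u' \<in> borel_measurable borel" "v \<in> borel_measurable borel"
    and ae: "AE x in lborel. u x = u' x"
  shows "\<E> u v = \<E> u' v"
proof -
  have "AE z in lborel \<Otimes>\<^sub>M lborel. df u v z = df u' v z"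
    using AE_pair_fst[OF ae] by eventually_elim (simp add: df_def)
  then have "(LINT z|(lborel \<Otimes>\<^sub>M lborel). df u v z) = (LINT z|(lborel \<Otimes>\<^sub>M lborel). df u' v z)"
    by (intro integral_cong_AE) auto
  then show ?thesis by (simp add: X_inner_eq)
qed

text \<open>A single criterion for absolute values, multiples, sums, truncations and the products
  with a cutoff in the maximum principle: all of them satisfy both pointwise bounds.\<close>

lemma Hs_dominated:
  assumes u: "u \<in> \<H>" and v: "v \<in> \<H>" and w: "w \<in> borel_measurable borel"
    and le: "\<And>x. \<bar>w x\<bar> \<le> C * (\<bar>u x\<bar> + \<bar>v x\<bar>)"
    and diff: "\<And>x y. \<bar>w x - w y\<bar> \<le> C * (\<bar>u x - u y\<bar> + \<bar>v x - v y\<bar>)"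
  shows "w \<in> \<H>"
proof -
  have sq: "c\<^sup>2 \<le> 2 * C\<^sup>2 * (a\<^sup>2 + b\<^sup>2)" if "\<bar>c\<bar> \<le> C * (\<bar>a\<bar> + \<bar>b\<bar>)" for a b c :: real
  proof -
    have "\<bar>c\<bar>\<^sup>2 \<le> (C * (\<bar>a\<bar> + \<bar>b\<bar>))\<^sup>2" using that by (intro power_mono) auto
    also have "\<dots> = C\<^sup>2 * (\<bar>a\<bar> + \<bar>b\<bar>)\<^sup>2" by (simp add: power_mult_distrib)
    also have "\<dots> \<le> C\<^sup>2 * (2 * (a\<^sup>2 + b\<^sup>2))"
      using sum_squares_bound[of "\<bar>a\<bar>" "\<bar>b\<bar>"] by (intro mult_left_mono) (auto simp: power2_sum)
    finally show ?thesis by (simp add: algebra_simps)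
  qed
  have "integrable lborel (\<lambda>x. (w x)\<^sup>2)"
  proof (rule Bochner_Integration.integrable_bound)
    show "integrable lborel (\<lambda>x. 2 * C\<^sup>2 * ((u x)\<^sup>2 + (v x)\<^sup>2))" using u v by (simp add: Hs_iff)
    show "AE x in lborel. norm ((w x)\<^sup>2) \<le> norm (2 * C\<^sup>2 * ((u x)\<^sup>2 + (v x)\<^sup>2))"
      using sq[OF le] by simp
  qed (use w in simp)
  moreover have "integrable (lborel \<Otimes>\<^sub>M lborel) (df w w)"
  proof (rule Bochner_Integration.integrable_bound)
    show "integrable (lborel \<Otimes>\<^sub>M lborel) (\<lambda>z. 2 * C\<^sup>2 * (df u u z + df v v z))" using u v by (simp add: Hs_iff)
    have "norm (df w w z) \<le> norm (2 * C\<^sup>2 * (df u u z + df v v z))" for z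
      using divide_right_mono[OF sq[OF diff[of "fst z" "snd z"]],
          of "norm (fst z - snd z) powr (real DIM('a) + 2 * s)"]
      by (simp add: df_self add_divide_distrib[symmetric])
    then show "AE z in lborel \<Otimes>\<^sub>M lborel. norm (df w w z) \<le> norm (2 * C\<^sup>2 * (df u u z + df v v z))" by simp
  qed (use w in simp)
  ultimately show ?thesis using w by (simp add: Hs_iff)
qed

text \<open>The Markov property of the form: normal contractions do not increase the energy. It is
  applied to absolute values and to truncations.\<close>

lemma X_inner_self_mono:
  assumes u: "u \<in> \<H>" and w: "w \<in> \<H>" and diff: "\<And>x y. \<bar>w x - w y\<bar> \<le> \<bar>u x - u y\<bar>"
  shows "\<E> w w \<le> \<E> u u"
proof -
  have "df w w z \<le> df u u z" for z
    unfolding df_self using diff[of "fst z" "snd z"]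
    by (intro divide_right_mono) (auto simp: abs_le_square_iff)
  then show ?thesis
    using u w \<kappa>_pos by (auto simp: X_inner_eq Hs_iff intro!: integral_mono mult_left_mono)
qed

section \<open>Closure properties of the space of functions vanishing outside the domain\<close>

lemma X_Hs: "u \<in> \<X> \<Longrightarrow> u \<in> \<H>"
  by (simp add: X_space_def)

lemma X_measurable: "u \<in> \<X> \<Longrightarrow> u \<in> borel_measurable borel"
  by (simp add: X_space_def Hs_iff)

lemma X_zero_AE: "u \<in> \<X> \<Longrightarrow> AE x in lborel. x \<notin> \<Omega> \<longrightarrow> u x = 0"
  by (simp add: X_space_def)

lemma X_square_integrable: "u \<in> \<X> \<Longrightarrow> integrable lborel (\<lambda>x. (u x)\<^sup>2)"
  by (simp add: X_space_def Hs_iff)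

lemma X_dominated:
  assumes u: "u \<in> \<X>" and v: "v \<in> \<X>" and w: "w \<in> borel_measurable borel"
    and le: "\<And>x. \<bar>w x\<bar> \<le> C * (\<bar>u x\<bar> + \<bar>v x\<bar>)"
    and diff: "\<And>x y. \<bar>w x - w y\<bar> \<le> C * (\<bar>u x - u y\<bar> + \<bar>v x - v y\<bar>)"
  shows "w \<in> \<X>"
proof -
  have "AE x in lborel. x \<notin> \<Omega> \<longrightarrow> w x = 0"
    using X_zero_AE[OF u] X_zero_AE[OF v]
  proof eventually_elim
    case (elim x)
    then show ?case using le[of x] by auto
  qed
  then show ?thesis using Hs_dominated[OF X_Hs[OF u] X_Hs[OF v] w le diff] by (simp add: X_space_def)
qed

lemma X_abs: "u \<in> \<X> \<Longrightarrow> (\<lambda>x. \<bar>u x\<bar>) \<in> \<X>"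
proof (rule X_dominated[where u = u and v = u and C = 1])
  show "\<bar>\<bar>u x\<bar> - \<bar>u y\<bar>\<bar> \<le> 1 * (\<bar>u x - u y\<bar> + \<bar>u x - u y\<bar>)" for x y
    by (rule order_trans[OF abs_triangle_ineq3]) simp
qed (auto dest: X_measurable)

lemma X_scale: "u \<in> \<X> \<Longrightarrow> (\<lambda>x. t * u x) \<in> \<X>"
proof (rule X_dominated[where u = u and v = u and C = "\<bar>t\<bar>"])
  show "\<bar>t * u x - t * u y\<bar> \<le> \<bar>t\<bar> * (\<bar>u x - u y\<bar> + \<bar>u x - u y\<bar>)" for x y
    unfolding right_diff_distrib[symmetric] abs_mult by (rule mult_left_mono) simp_all
  show "\<bar>t * u x\<bar> \<le> \<bar>t\<bar> * (\<bar>u x\<bar> + \<bar>u x\<bar>)" for x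
    unfolding abs_mult by (rule mult_left_mono) simp_all
qed (auto dest: X_measurable)

lemma X_add:
  assumes "u \<in> \<X>" "v \<in> \<X>"
  shows "(\<lambda>x. u x + v x) \<in> \<X>"
proof (rule X_dominated[OF assms, where C = 1])
  show "(\<lambda>x. u x + v x) \<in> borel_measurable borel"
    using assms[THEN X_measurable] by measurable
  show "\<bar>u x + v x\<bar> \<le> 1 * (\<bar>u x\<bar> + \<bar>v x\<bar>)" for x
    using abs_triangle_ineq[of "u x" "v x"] by simp
  show "\<bar>u x + v x - (u y + v y)\<bar> \<le> 1 * (\<bar>u x - u y\<bar> + \<bar>v x - v y\<bar>)" for x y
    using abs_triangle_ineq[of "u x - u y" "v x - v y"] by (simp add: algebra_simps)
qed

lemma X_add_scaled: "u \<in> \<X> \<Longrightarrow> v \<in> \<X> \<Longrightarrow> (\<lambda>x. u x + t * v x) \<in> \<X>"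
  by (intro X_add X_scale)

lemma X_cong_AE:
  assumes u: "u \<in> \<X>" and [measurable]: "u' \<in> borel_measurable borel" and ae: "AE x in lborel. u x = u' x"
  shows "u' \<in> \<X>"
proof -
  have [measurable]: "u \<in> borel_measurable borel" using u by (rule X_measurable)
  have "AE z in lborel \<Otimes>\<^sub>M lborel. df u u z = df u' u' z"
    using AE_pair_fst[OF ae] by eventually_elim (simp add: df_def)
  then have "integrable (lborel \<Otimes>\<^sub>M lborel) (df u' u')"
    using u by (subst integrable_cong_AE[of _ _ "df u u"]) (auto simp: X_space_def Hs_iff)
  moreover have "integrable lborel (\<lambda>x. (u' x)\<^sup>2)"
    by (rule integrable_cong_AE_imp[OF X_square_integrable[OF u]]) (use ae in auto)
  moreover have "AE x in lborel. x \<notin> \<Omega> \<longrightarrow> u' x = 0"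
    using ae X_zero_AE[OF u] by eventually_elim simp
  ultimately show ?thesis by (simp add: X_space_def Hs_iff)
qed

lemma X_const_zero: "(\<lambda>x. 0) \<in> \<X>"
  by (simp add: X_space_def Hs_iff df_def[abs_def])

section \<open>A function of finite energy that is positive exactly in the domain\<close>

lemma \<Omega>_measurable [measurable]: "\<Omega> \<in> sets borel"
  using open_\<Omega> by simp

lemma emeasure_\<Omega>_finite: "emeasure lborel \<Omega> < \<infinity>"
  using bounded_\<Omega> by (rule emeasure_bounded_finite)

text \<open>Squared differences are at most \<open>min 1 ((norm (x - y))\<^sup>2)\<close>, where the
  bound 1/2 on \<open>\<eta>\<close> keeps differences within 1, and they vanish unless one of the
  two points lies in \<Omega>. Each of the two possibilities contributes at most the measure of
  \<Omega> times the integral of the truncated kernel.\<close>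

lemma X_lipschitz_cutoff:
  assumes [measurable]: "\<eta> \<in> borel_measurable borel"
    and bd: "\<And>x. \<bar>\<eta> x\<bar> \<le> 1 / 2" and lip: "\<And>x y. \<bar>\<eta> x - \<eta> y\<bar> \<le> norm (x - y)"
    and supp: "\<And>x. x \<notin> \<Omega> \<Longrightarrow> \<eta> x = 0"
  shows "\<eta> \<in> \<X>"
proof -
  define m where "m z = ennreal (min 1 ((norm z)\<^sup>2) / norm z powr (real DIM('a) + 2 * s))" for z :: 'a
  have [measurable]: "m \<in> borel_measurable borel" unfolding m_def[abs_def] by measurable
  have "integrable lborel (\<lambda>x. (\<eta> x)\<^sup>2)"
  proof (rule Bochner_Integration.integrable_bound)
    show "integrable lborel (indicator \<Omega> :: 'a \<Rightarrow> real)"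
      using emeasure_\<Omega>_finite by (simp add: less_top)
    have "(\<eta> x)\<^sup>2 \<le> indicator \<Omega> x" for x
    proof (cases "x \<in> \<Omega>")
      case True
      have "\<bar>\<eta> x\<bar>\<^sup>2 \<le> 1" using bd[of x] by (intro power_le_one) auto
      then show ?thesis using True by simp
    qed (simp add: supp)
    then show "AE x in lborel. norm ((\<eta> x)\<^sup>2) \<le> norm (indicator \<Omega> x :: real)" by simp
  qed simp
  moreover have "integrable (lborel \<Otimes>\<^sub>M lborel) (df \<eta> \<eta>)"
  proof (rule integrableI_bounded)
    have le: "ennreal (df \<eta> \<eta> z) \<le> indicator \<Omega> (fst z) * m (fst z - snd z) + indicator \<Omega> (snd z) * m (fst z - snd z)" for z
    proof -
      have "\<bar>\<eta> (fst z) - \<eta> (snd z)\<bar> \<le> 1" using bd[of "fst z"] bd[of "snd z"] by linarith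
      then have "(\<eta> (fst z) - \<eta> (snd z))\<^sup>2 \<le> 1" using abs_le_square_iff[of _ "1::real"] by simp
      moreover have "(\<eta> (fst z) - \<eta> (snd z))\<^sup>2 \<le> (norm (fst z - snd z))\<^sup>2"
        using lip[of "fst z" "snd z"] by (simp add: abs_le_square_iff[symmetric])
      ultimately have "ennreal (df \<eta> \<eta> z) \<le> m (fst z - snd z)"
        unfolding m_def df_self by (intro ennreal_leI divide_right_mono) auto
      moreover have "df \<eta> \<eta> z = 0" if "fst z \<notin> \<Omega>" "snd z \<notin> \<Omega>"
        using that by (simp add: df_def supp)
      ultimately show ?thesis by (auto simp: indicator_def intro: order_trans)
    qed
    have m_fin: "(\<integral>\<^sup>+z. m z \<partial>lborel) < \<infinity>"
      unfolding m_def by (rule nn_integral_truncated_kernel_finite[OF s_pos s_less_1])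
    have 1: "(\<integral>\<^sup>+z. indicator \<Omega> (fst z) * m (fst z - snd z) \<partial>(lborel \<Otimes>\<^sub>M lborel)) = emeasure lborel \<Omega> * (\<integral>\<^sup>+z. m z \<partial>lborel)"
      by (subst lborel.nn_integral_fst[symmetric])
         (auto simp: nn_integral_cmult nn_integral_lborel_reflect nn_integral_multc)
    have m_sym: "m (x - y) = m (y - x)" for x y by (simp add: m_def norm_minus_commute)
    have 2: "(\<integral>\<^sup>+z. indicator \<Omega> (snd z) * m (fst z - snd z) \<partial>(lborel \<Otimes>\<^sub>M lborel)) = emeasure lborel \<Omega> * (\<integral>\<^sup>+z. m z \<partial>lborel)"
      by (subst lborel_pair.nn_integral_snd[symmetric], measurable,
          subst m_sym, auto simp: nn_integral_cmult nn_integral_lborel_reflect nn_integral_multc)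
    have "(\<integral>\<^sup>+z. ennreal (norm (df \<eta> \<eta> z)) \<partial>(lborel \<Otimes>\<^sub>M lborel))
        \<le> (\<integral>\<^sup>+z. indicator \<Omega> (fst z) * m (fst z - snd z) + indicator \<Omega> (snd z) * m (fst z - snd z) \<partial>(lborel \<Otimes>\<^sub>M lborel))"
      using le by (intro nn_integral_mono) simp
    also have "\<dots> = emeasure lborel \<Omega> * (\<integral>\<^sup>+z. m z \<partial>lborel) + emeasure lborel \<Omega> * (\<integral>\<^sup>+z. m z \<partial>lborel)"
      by (subst nn_integral_add) (auto simp: 1 2)
    also have "\<dots> < \<infinity>"
      using emeasure_\<Omega>_finite m_fin by (simp add: ennreal_mult_less_top)
    finally show "(\<integral>\<^sup>+z. ennreal (norm (df \<eta> \<eta> z)) \<partial>(lborel \<Otimes>\<^sub>M lborel)) < \<infinity>" .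
  qed simp
  ultimately show ?thesis by (simp add: X_space_def Hs_iff supp)
qed

text \<open>The cap 1/2 is the bound required by \<open>X_lipschitz_cutoff\<close>. This function
  provides a pair with positive coupling and localizes the test functions of the maximum
  principle.\<close>

definition cutoff :: "'a \<Rightarrow> real" where
  "cutoff x = min (1/2) (infdist x (- \<Omega>))"

text \<open>\<open>infdist\<close> to the empty set is 0 by convention, so positivity of
  \<open>cutoff\<close> depends on this.\<close>

lemma compl_\<Omega>_nonempty: "- \<Omega> \<noteq> {}"
  using bounded_\<Omega> not_bounded_UNIV[where 'a = 'a] by (metis Compl_empty_eq double_compl)

lemma cutoff_nonneg: "0 \<le> cutoff x"
  by (simp add: cutoff_def infdist_nonneg)

lemma cutoff_le: "cutoff x \<le> 1 / 2"
  by (simp add: cutoff_def)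

lemma cutoff_pos: "x \<in> \<Omega> \<Longrightarrow> 0 < cutoff x"
  using open_\<Omega> compl_\<Omega>_nonempty infdist_pos_not_in_closed[of "- \<Omega>" x]
  by (simp add: cutoff_def closed_Compl)

lemma cutoff_zero: "x \<notin> \<Omega> \<Longrightarrow> cutoff x = 0"
  by (simp add: cutoff_def)

lemma cutoff_measurable [measurable]: "cutoff \<in> borel_measurable borel"
  unfolding cutoff_def[abs_def]
  by (intro borel_measurable_continuous_onI continuous_intros continuous_on_id)

lemma cutoff_in_X: "cutoff \<in> \<X>"
proof (rule X_lipschitz_cutoff)
  show "\<bar>cutoff x - cutoff y\<bar> \<le> norm (x - y)" for x y
    using infdist_triangle_abs[of x "- \<Omega>" y] by (simp add: cutoff_def dist_norm)
qed (use cutoff_nonneg cutoff_le cutoff_zero in auto)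

end

section \<open>Integration lemmas\<close>

text \<open>Fatou's lemma for real-valued integrals. The bounds may vary with \<open>n\<close>, as
  energies along a sequence do, and integrability of the limit is part of the conclusion.\<close>

lemma integral_le_of_AE_tendsto:
  fixes f :: "nat \<Rightarrow> 'b \<Rightarrow> real"
  assumes g: "g \<in> borel_measurable M" and f: "\<And>n. integrable M (f n)"
    and nonneg: "\<And>n x. 0 \<le> f n x"
    and lim: "AE x in M. (\<lambda>n. f n x) \<longlonglongrightarrow> g x"
    and le: "\<And>n. integral\<^sup>L M (f n) \<le> B n" and B: "B \<longlonglongrightarrow> L"
  shows "integrable M g \<and> integral\<^sup>L M g \<le> L"
proof -
  have L0: "0 \<le> L"
  proof (rule LIMSEQ_le_const[OF B], intro exI allI impI)
    show "0 \<le> B n" for n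
      using order_trans[OF integral_nonneg_AE le[of n]] nonneg by simp
  qed
  have g0: "AE x in M. 0 \<le> g x"
    using lim by eventually_elim (rule LIMSEQ_le_const, auto simp: nonneg)
  have "(\<integral>\<^sup>+x. ennreal (g x) \<partial>M) = (\<integral>\<^sup>+x. liminf (\<lambda>n. ennreal (f n x)) \<partial>M)"
  proof (rule nn_integral_cong_AE)
    show "AE x in M. ennreal (g x) = liminf (\<lambda>n. ennreal (f n x))"
      using lim
    proof eventually_elim
      case (elim x)
      then have "(\<lambda>n. ennreal (f n x)) \<longlonglongrightarrow> ennreal (g x)" by (rule tendsto_ennrealI)
      then show ?case by (simp add: lim_imp_Liminf)
    qed
  qed
  also have "\<dots> \<le> liminf (\<lambda>n. \<integral>\<^sup>+x. ennreal (f n x) \<partial>M)"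
    using f by (intro nn_integral_liminf) auto
  also have "\<dots> \<le> liminf (\<lambda>n. ennreal (B n))"
  proof (rule Liminf_mono, rule always_eventually, rule allI)
    show "(\<integral>\<^sup>+x. ennreal (f n x) \<partial>M) \<le> ennreal (B n)" for n
      using f[of n] le[of n] nonneg by (subst nn_integral_eq_integral) (auto intro: ennreal_leI)
  qed
  also have "\<dots> = ennreal L"
    using tendsto_ennrealI[OF B] by (simp add: lim_imp_Liminf)
  finally have *: "(\<integral>\<^sup>+x. ennreal (g x) \<partial>M) \<le> ennreal L" .
  then have int: "integrable M g"
    using g g0 by (intro integrableI_nonneg) (auto intro: le_less_trans)
  have "integral\<^sup>L M g \<le> L"
    using * nn_integral_eq_integral[OF int g0] L0 by simp
  with int show ?thesis ..
qed

text \<open>Truncating at height \<open>K\<close> costs at most \<open>\<delta> * C\<close> uniformly in \<open>n\<close>, and the truncated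
  sequence is dominated because \<open>A\<close> has finite measure.\<close>
lemma tendsto_integral_of_uniform_tail:
  fixes f H :: "nat \<Rightarrow> 'b \<Rightarrow> real"
  assumes f: "\<And>n. f n \<in> borel_measurable M" and g: "g \<in> borel_measurable M"
    and nonneg: "\<And>n x. 0 \<le> f n x"
    and lim: "AE x in M. (\<lambda>n. f n x) \<longlonglongrightarrow> g x"
    and A: "A \<in> sets M" "emeasure M A < \<infinity>" and supp: "\<And>n. AE x in M. x \<notin> A \<longrightarrow> f n x = 0"
    and H: "\<And>n. integrable M (H n)" "\<And>n x. 0 \<le> H n x" "\<And>n. integral\<^sup>L M (H n) \<le> C"
    and tail: "\<And>\<delta>. \<delta> > 0 \<Longrightarrow> \<exists>K. \<forall>n x. f n x \<le> \<delta> * H n x + K"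
  shows "\<And>n. integrable M (f n)" and "integrable M g"
    and "(\<lambda>n. integral\<^sup>L M (f n)) \<longlonglongrightarrow> integral\<^sup>L M g"
proof -
  have intA: "integrable M (\<lambda>x. K * indicator A x :: real)" for K
    using A by (simp add: less_top)
  show fint: "integrable M (f n)" for n
  proof -
    obtain K where K: "\<And>n x. f n x \<le> 1 * H n x + K" using tail[of 1] by auto
    show ?thesis
    proof (rule Bochner_Integration.integrable_bound)
      show "integrable M (\<lambda>x. H n x + \<bar>K\<bar> * indicator A x)"
        using H(1) intA by (intro Bochner_Integration.integrable_add)
      show "AE x in M. norm (f n x) \<le> norm (H n x + \<bar>K\<bar> * indicator A x)"
        using supp[of n]
      proof eventually_elim
        case (elim x)
        then show ?case
          using K[of n x] nonneg[of n x] H(2)[of n x] by (cases "x \<in> A") auto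
      qed
    qed (use f in auto)
  qed
  have f_bd: "integral\<^sup>L M (f n) \<le> B" if K: "\<And>n x. f n x \<le> 1 * H n x + K"
    and B: "B = C + \<bar>K\<bar> * measure M A" for n K B
  proof -
    have "integral\<^sup>L M (f n) \<le> integral\<^sup>L M (\<lambda>x. H n x + \<bar>K\<bar> * indicator A x)"
    proof (rule integral_mono_AE[OF fint])
      show "integrable M (\<lambda>x. H n x + \<bar>K\<bar> * indicator A x)"
        using H(1) intA by (intro Bochner_Integration.integrable_add)
      show "AE x in M. f n x \<le> H n x + \<bar>K\<bar> * indicator A x"
        using supp[of n]
      proof eventually_elim
        case (elim x)
        then show ?case
          using K[of n x] nonneg[of n x] H(2)[of n x] by (cases "x \<in> A") auto
      qed
    qed
    also have "\<dots> = integral\<^sup>L M (H n) + \<bar>K\<bar> * measure M A"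
      using A intA[of "\<bar>K\<bar>"] H(1)[of n] sets.sets_into_space[OF A(1)]
      by (subst Bochner_Integration.integral_add) (auto simp: less_top Int_absorb2)
    also have "\<dots> \<le> B" using H(3)[of n] B by simp
    finally show ?thesis .
  qed
  show gint: "integrable M g"
  proof -
    obtain K where K: "\<And>n x. f n x \<le> 1 * H n x + K" using tail[of 1] by auto
    show ?thesis
      using integral_le_of_AE_tendsto[OF g fint nonneg lim f_bd[OF K refl] tendsto_const] by blast
  qed
  have g0: "AE x in M. 0 \<le> g x"
    using lim by eventually_elim (rule LIMSEQ_le_const, auto simp: nonneg)
  have C0: "0 \<le> C" using order_trans[OF integral_nonneg_AE H(3)[of 0]] H(2) by simp
  show "(\<lambda>n. integral\<^sup>L M (f n)) \<longlonglongrightarrow> integral\<^sup>L M g"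
  proof (rule LIMSEQ_I)
    fix e :: real assume e: "0 < e"
    \<comment> \<open>Three errors receive \<open>e / 3\<close> each: the part of \<open>f n\<close>
      above the truncation height, that of \<open>g\<close>, and the difference of the truncated
      integrals. Using \<open>C + 1\<close> avoids dividing by zero when
      \<open>C = 0\<close>.\<close>
    define \<delta> where "\<delta> = e / (4 * (C + 1))"
    have \<delta>: "0 < \<delta>" "\<delta> * C < e / 3"
      using e C0 by (auto simp: \<delta>_def field_simps intro!: add_nonneg_pos)
    obtain K' where K': "\<And>n x. f n x \<le> \<delta> * H n x + K'" using tail[OF \<delta>(1)] by auto
    define K where "K = \<bar>K'\<bar>"
    have K: "f n x \<le> \<delta> * H n x + K" "0 \<le> K" for n x
      using K'[of n x] by (auto simp: K_def)
    have mint: "integrable M (\<lambda>x. min (f n x) K)" for n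
      by (rule Bochner_Integration.integrable_bound[OF fint[of n]]) (use f nonneg K in auto)
    have mgint: "integrable M (\<lambda>x. min (g x) K)"
      by (rule Bochner_Integration.integrable_bound[OF gint])
         (use g g0 K in \<open>auto elim!: eventually_mono\<close>)
    have conv: "(\<lambda>n. integral\<^sup>L M (\<lambda>x. min (f n x) K)) \<longlonglongrightarrow> integral\<^sup>L M (\<lambda>x. min (g x) K)"
    proof (rule integral_dominated_convergence)
      show "integrable M (\<lambda>x. K * indicator A x)" by (rule intA)
      show "AE x in M. (\<lambda>n. min (f n x) K) \<longlonglongrightarrow> min (g x) K"
        using lim by eventually_elim (intro tendsto_min tendsto_const)
      show "AE x in M. norm (min (f n x) K) \<le> K * indicator A x" for n
        using supp[of n] by eventually_elim (use nonneg K in \<open>auto simp: indicator_def\<close>)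
    qed (use f g in auto)
    have d_int: "integrable M (\<lambda>x. f n x - min (f n x) K)" for n
      using fint mint by (intro Bochner_Integration.integrable_diff)
    have d_le: "integral\<^sup>L M (\<lambda>x. f n x - min (f n x) K) \<le> \<delta> * C" for n
    proof -
      have "integral\<^sup>L M (\<lambda>x. f n x - min (f n x) K) \<le> integral\<^sup>L M (\<lambda>x. \<delta> * H n x)"
        using K H(1,2) \<delta> by (intro integral_mono d_int) (auto simp: min_def algebra_simps)
      also have "\<dots> \<le> \<delta> * C" using H(3)[of n] \<delta> by simp
      finally show ?thesis .
    qed
    have d_nonneg: "0 \<le> f n x - min (f n x) K" for n x by simp
    have d_lim: "AE x in M. (\<lambda>n. f n x - min (f n x) K) \<longlonglongrightarrow> g x - min (g x) K"
      using lim by eventually_elim (intro tendsto_min tendsto_const tendsto_diff)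
    \<comment> \<open>The limit inherits the tail bound by Fatou, so no majorant for
      \<open>g\<close> itself has to be supplied.\<close>
    have "integral\<^sup>L M (\<lambda>x. g x - min (g x) K) \<le> \<delta> * C"
      using integral_le_of_AE_tendsto[OF _ d_int d_nonneg d_lim d_le tendsto_const] g by auto
    then have 1: "integral\<^sup>L M g - integral\<^sup>L M (\<lambda>x. min (g x) K) \<le> \<delta> * C"
      using gint mgint by simp
    have 2: "integral\<^sup>L M (\<lambda>x. min (g x) K) \<le> integral\<^sup>L M g"
      using gint mgint by (intro integral_mono) auto
    obtain N where N: "\<And>n. n \<ge> N \<Longrightarrow> norm (integral\<^sup>L M (\<lambda>x. min (f n x) K) - integral\<^sup>L M (\<lambda>x. min (g x) K)) < e / 3"
      using LIMSEQ_D[OF conv, of "e / 3"] e by auto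
    show "\<exists>no. \<forall>n\<ge>no. norm (integral\<^sup>L M (f n) - integral\<^sup>L M g) < e"
    proof (intro exI allI impI)
      fix n assume "N \<le> n"
      have 3: "integral\<^sup>L M (f n) - integral\<^sup>L M (\<lambda>x. min (f n x) K) \<le> \<delta> * C"
        using d_le[of n] fint mint by simp
      have 4: "integral\<^sup>L M (\<lambda>x. min (f n x) K) \<le> integral\<^sup>L M (f n)"
        using fint mint by (intro integral_mono) auto
      show "norm (integral\<^sup>L M (f n) - integral\<^sup>L M g) < e"
        using 1 2 3 4 N[OF \<open>N \<le> n\<close>] \<delta>(2) unfolding real_norm_def by linarith
    qed
  qed
qed

section \<open>The largest eigenvalue\<close>

text \<open>It suffices to know that the larger root \<open>m\<close> of the characteristic
  polynomial is an eigenvalue: then \<open>m \<le> \<mu>\<^sub>2\<close>, and the form of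
  \<open>m\<close> times the identity minus the matrix is nonnegative, since its determinant
  vanishes and its diagonal entries are nonnegative.\<close>

lemma quadratic_form_le_max_eigenvalue:
  fixes a b c :: real
  assumes ev: "{\<mu>. eigenvalue (mat_of_rows_list 2 [[a, b], [b, c]]) \<mu>} = {\<mu>\<^sub>1, \<mu>\<^sub>2}"
    and le: "\<mu>\<^sub>1 \<le> \<mu>\<^sub>2"
  shows "a * x\<^sup>2 + 2 * b * x * y + c * y\<^sup>2 \<le> \<mu>\<^sub>2 * (x\<^sup>2 + y\<^sup>2)"
proof -
  define A where "A = mat_of_rows_list 2 [[a, b], [b, c]]"
  define D where "D = sqrt ((a - c)\<^sup>2 + 4 * b\<^sup>2)"
  define m where "m = ((a + c) + D) / 2"
  have DD: "D\<^sup>2 = (a - c)\<^sup>2 + 4 * b\<^sup>2" by (simp add: D_def)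
  have D_ge: "\<bar>a - c\<bar> \<le> D" unfolding D_def by (rule real_le_rsqrt) simp
  have m_ge: "a \<le> m" "c \<le> m" using D_ge by (auto simp: m_def)
  have prod: "(m - a) * (m - c) = b\<^sup>2"
    using DD by (simp add: m_def power2_eq_square field_simps)
  have ev_I: "eigenvalue A m" if "a * \<xi> + b * \<eta> = m * \<xi>" "b * \<xi> + c * \<eta> = m * \<eta>" "\<xi> \<noteq> 0 \<or> \<eta> \<noteq> 0" for \<xi> \<eta>
    unfolding eigenvalue_def eigenvector_def
  proof (intro exI conjI)
    show "Matrix.vec 2 (\<lambda>i. if i = 0 then \<xi> else \<eta>) \<in> carrier_vec (dim_row A)"
      by (simp add: A_def mat_of_rows_list_def)
    show "Matrix.vec 2 (\<lambda>i. if i = 0 then \<xi> else \<eta>) \<noteq> 0\<^sub>v (dim_row A)"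
    proof
      assume eq: "Matrix.vec 2 (\<lambda>i. if i = 0 then \<xi> else \<eta>) = 0\<^sub>v (dim_row A)"
      have "dim_row A = 2" by (simp add: A_def mat_of_rows_list_def)
      then show False
        using that(3) arg_cong[OF eq, of "\<lambda>v. vec_index v 0"] arg_cong[OF eq, of "\<lambda>v. vec_index v 1"] by simp
    qed
    show "A *\<^sub>v Matrix.vec 2 (\<lambda>i. if i = 0 then \<xi> else \<eta>) = m \<cdot>\<^sub>v Matrix.vec 2 (\<lambda>i. if i = 0 then \<xi> else \<eta>)"
      using that(1,2)
      by (intro eq_vecI) (auto simp: A_def mat_of_rows_list_def scalar_prod_def less_2_cases_iff numeral_2_eq_2)
  qed
  have "eigenvalue A m"
  proof (cases "b = 0")
    case False
    \<comment> \<open>The vector \<open>(b, m - a)\<close> solves the first row identically; the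
      second row is the characteristic equation \<open>prod\<close>.\<close>
    show ?thesis
    proof (rule ev_I[of b "m - a"])
      show "b * b + c * (m - a) = m * (m - a)"
        using prod by (simp add: power2_eq_square algebra_simps)
    qed (use False in \<open>auto simp: algebra_simps\<close>)
  next
    case True
    then have "m = a \<or> m = c" using prod by auto
    then show ?thesis
    proof
      assume "m = a"
      then show ?thesis using True by (intro ev_I[of 1 0]) auto
    next
      assume "m = c"
      then show ?thesis using True by (intro ev_I[of 0 1]) auto
    qed
  qed
  then have "m \<in> {\<mu>\<^sub>1, \<mu>\<^sub>2}" using ev by (auto simp: A_def)
  then have m_le: "m \<le> \<mu>\<^sub>2" using le by auto
  have "0 \<le> (m - a) * x\<^sup>2 - 2 * b * x * y + (m - c) * y\<^sup>2"
  proof (cases "m = a")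
    case True
    then have "b = 0" using prod by simp
    then show ?thesis using True m_ge by simp
  next
    case False
    then have pos: "0 < m - a" using m_ge by simp
    \<comment> \<open>Multiplying by \<open>m - a\<close> turns the form into a perfect square,
      because \<open>prod\<close> replaces the coefficient of \<open>y\<^sup>2\<close> by
      \<open>b\<^sup>2\<close>.\<close>
    have "(m - a) * ((m - a) * x\<^sup>2 - 2 * b * x * y + (m - c) * y\<^sup>2)
        = ((m - a) * x)\<^sup>2 - 2 * b * x * y * (m - a) + ((m - a) * (m - c)) * y\<^sup>2"
      by (simp add: power2_eq_square algebra_simps)
    also have "\<dots> = ((m - a) * x - b * y)\<^sup>2"
      unfolding prod by (simp add: power2_eq_square algebra_simps)
    finally have "0 \<le> (m - a) * ((m - a) * x\<^sup>2 - 2 * b * x * y + (m - c) * y\<^sup>2)" by simp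
    then show ?thesis using pos zero_le_mult_iff[of "m - a"] by simp
  qed
  then have "a * x\<^sup>2 + 2 * b * x * y + c * y\<^sup>2 \<le> m * (x\<^sup>2 + y\<^sup>2)"
    by (simp add: algebra_simps)
  also have "\<dots> \<le> \<mu>\<^sub>2 * (x\<^sup>2 + y\<^sup>2)" using m_le by (intro mult_right_mono) auto
  finally show ?thesis .
qed

section \<open>The Sobolev inequality\<close>

context frac_domain
begin

definition crit :: real where
  "crit = 2 * real DIM('a) / (real DIM('a) - 2 * s)"

text \<open>The first factor comes from comparing \<open>\<bar>w x\<bar>\<close> with half its
  value, the second from the radius of a ball of twice the Chebyshev measure bound; its exponent is
  \<open>(N + 2 * s) / N\<close> with \<open>N\<close> the dimension.\<close>

definition sobolev_K :: real where
  "sobolev_K = 2 powr crit * (2 / unit_ball_vol (real DIM('a))) powr (1 + 2 * s / real DIM('a))"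

lemma crit_gt_2: "2 < crit"
  using s_pos dim_gt by (simp add: crit_def field_simps)

lemma two_div_crit: "2 / crit = 1 - 2 * s / real DIM('a)"
  using s_pos dim_gt by (simp add: crit_def field_simps)

lemma sobolev_K_pos: "0 < sobolev_K"
proof -
  have "0 < unit_ball_vol (real DIM('a))" by simp
  then have "0 < 2 / unit_ball_vol (real DIM('a))" by (rule divide_pos_pos[rotated]) simp
  then show ?thesis unfolding sobolev_K_def by (intro mult_pos_pos) (metis powr_gt_zero less_irrefl zero_neq_numeral)+
qed

text \<open>By Chebyshev, a ball around \<open>x\<close> of twice the measure bound of the superlevel set
  \<open>{\<bar>w\<bar> \<ge> \<bar>w x\<bar> / 2}\<close> consists at least by half of points where \<open>w\<close> differs from \<open>w x\<close>
  by \<open>\<bar>w x\<bar> / 2\<close> or more.\<close>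
lemma sobolev_pointwise:
  assumes w[measurable]: "w \<in> borel_measurable borel"
    and int: "integrable lborel (\<lambda>x. \<bar>w x\<bar> powr crit)"
    and M: "M = (LINT x|lborel. \<bar>w x\<bar> powr crit)" "0 < M"
  shows "ennreal (\<bar>w x\<bar> powr crit)
    \<le> ennreal (sobolev_K * M powr (2 * s / real DIM('a))) * (\<integral>\<^sup>+y. ennreal (df w w (x, y)) \<partial>lborel)"
proof (cases "w x = 0")
  case False
  define N where "N = real DIM('a)"
  define \<beta> where "\<beta> = 1 + 2 * s / N"
  define \<omega> where "\<omega> = unit_ball_vol N"
  define t where "t = \<bar>w x\<bar> / 2"
  define \<tau> where "\<tau> = t powr crit"
  \<comment> \<open>Chosen so that the ball has measure \<open>2 * M / \<tau>\<close>, twice the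
    bound for the superlevel set \<open>A\<close>.\<close>
  define \<rho> where "\<rho> = (2 * M / (\<omega> * \<tau>)) powr (1 / N)"
  have N: "0 < N" by (simp add: N_def)
  have \<omega>: "0 < \<omega>" by (simp add: \<omega>_def N_def)
  have t: "0 < t" using False by (simp add: t_def)
  have \<tau>: "0 < \<tau>" using t by (simp add: \<tau>_def)
  have \<rho>: "0 < \<rho>" using \<omega> \<tau> M by (simp add: \<rho>_def)
  define A where "A = {y. t \<le> \<bar>w y\<bar>}"
  have [measurable]: "A \<in> sets borel" unfolding A_def by measurable
  have "A = {y \<in> space lborel. \<tau> \<le> \<bar>w y\<bar> powr crit}"
    using t crit_gt_2 by (auto simp: A_def \<tau>_def powr_mono2 powr_le_cancel_iff dest: powr_mono2')
       (smt (verit) powr_less_mono2)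
  then have "emeasure lborel A \<le> ennreal ((1 / \<tau>) * M)"
    unfolding M(1) using integral_Markov_inequality[OF int _ \<tau>] by simp
  then have A_le: "emeasure lborel A \<le> ennreal (M / \<tau>)" by simp
  have "\<rho> ^ DIM('a) = 2 * M / (\<omega> * \<tau>)"
    using \<omega> \<tau> M N by (simp add: \<rho>_def powr_powr powr_realpow[symmetric] N_def)
  then have ball: "emeasure lborel (ball x \<rho>) = ennreal (M / \<tau>) + ennreal (M / \<tau>)"
    using \<rho> \<omega> \<tau> M by (simp add: emeasure_ball \<omega>_def[unfolded N_def, symmetric] N_def ennreal_plus[symmetric] del: ennreal_plus)
  have "emeasure lborel (ball x \<rho>) \<le> emeasure lborel (A \<union> (ball x \<rho> - A))"
    by (intro emeasure_mono) auto
  also have "\<dots> \<le> emeasure lborel A + emeasure lborel (ball x \<rho> - A)"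
    by (rule emeasure_subadditive) auto
  also have "\<dots> \<le> ennreal (M / \<tau>) + emeasure lborel (ball x \<rho> - A)"
    by (intro add_right_mono A_le)
  finally have half: "ennreal (M / \<tau>) \<le> emeasure lborel (ball x \<rho> - A)"
    unfolding ball by (simp add: ennreal_add_left_cancel_le)
  define d where "d = t\<^sup>2 / \<rho> powr (N + 2 * s)"
  have d: "0 < d" using t \<rho> by (simp add: d_def)
  have "ennreal (d * (M / \<tau>)) \<le> ennreal d * emeasure lborel (ball x \<rho> - A)"
    using d mult_left_mono[OF half, of "ennreal d"] by (subst ennreal_mult') auto
  also have "\<dots> = (\<integral>\<^sup>+y. ennreal d * indicator (ball x \<rho> - A) y \<partial>lborel)"
    by (rule nn_integral_cmult_indicator[symmetric]) simp
  also have "\<dots> \<le> (\<integral>\<^sup>+y. ennreal (df w w (x, y)) \<partial>lborel)"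
  proof (rule nn_integral_mono)
    fix y
    have "d \<le> df w w (x, y)" if "y \<in> ball x \<rho>" "y \<notin> A"
    proof -
      have "\<bar>w y\<bar> < t" using that by (simp add: A_def)
      then have "t \<le> \<bar>w x - w y\<bar>" unfolding t_def by linarith
      then have sq: "t\<^sup>2 \<le> (w x - w y)\<^sup>2" using t abs_le_square_iff[of t "w x - w y"] by simp
      have "x \<noteq> y" using \<open>t \<le> \<bar>w x - w y\<bar>\<close> t by auto
      then have "norm (x - y) powr (N + 2 * s) \<le> \<rho> powr (N + 2 * s)" "0 < norm (x - y) powr (N + 2 * s)"
        using that s_pos N by (auto intro!: powr_mono2 simp: dist_norm)
      then show ?thesis
        using sq unfolding d_def df_self N_def by (auto intro!: frac_le)
    qed
    then show "ennreal d * indicator (ball x \<rho> - A) y \<le> ennreal (df w w (x, y))"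
      by (auto simp: indicator_def ennreal_leI)
  qed
  finally have main: "ennreal (d * (M / \<tau>)) \<le> (\<integral>\<^sup>+y. ennreal (df w w (x, y)) \<partial>lborel)" .
  have b: "(N + 2 * s) = N * \<beta>" using N by (simp add: \<beta>_def field_simps)
  have "\<rho> powr (N + 2 * s) = (2 * M / (\<omega> * \<tau>)) powr \<beta>"
    unfolding b \<rho>_def powr_powr using N by simp
  also have "\<dots> = (2 / \<omega>) powr \<beta> * M powr \<beta> / \<tau> powr \<beta>"
    using M \<omega> \<tau> by (simp add: powr_divide powr_mult)
  finally have \<rho>\<beta>: "\<rho> powr (N + 2 * s) = (2 / \<omega>) powr \<beta> * M powr \<beta> / \<tau> powr \<beta>" .
  \<comment> \<open>Criticality enters here: \<open>2 / crit = 2 - \<beta>\<close> makes the factors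
    \<open>\<tau> powr \<beta>\<close> in \<open>t\<^sup>2\<close> and in the kernel bound cancel,
    so the lower bound \<open>d * (M / \<tau>)\<close> is linear in \<open>\<tau>\<close>, like the
    left-hand side.\<close>
  have "t\<^sup>2 = t powr (crit * (2 / crit))" using t crit_gt_2 by simp
  also have "\<dots> = \<tau> powr (2 / crit)" by (simp only: \<tau>_def powr_powr)
  also have "2 / crit = 2 - \<beta>" by (simp add: two_div_crit \<beta>_def N_def)
  also have "\<tau> powr (2 - \<beta>) = \<tau>\<^sup>2 / \<tau> powr \<beta>" using \<tau> by (simp add: powr_diff)
  finally have t2: "t\<^sup>2 = \<tau>\<^sup>2 / \<tau> powr \<beta>" .
  have M\<beta>: "M powr (2 * s / N) = M powr \<beta> / M" using M by (simp add: \<beta>_def powr_add)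
  have "\<bar>w x\<bar> powr crit = 2 powr crit * \<tau>"
    using t by (simp add: \<tau>_def t_def powr_divide)
  also have "\<dots> = sobolev_K * M powr (2 * s / N) * (d * (M / \<tau>))"
  proof -
    have "(2 / \<omega>) powr \<beta> > 0" "M powr \<beta> > 0" "\<tau> powr \<beta> > 0" using \<omega> M \<tau> by auto
    then have "(2 / \<omega>) powr \<beta> * (M powr \<beta> / M) * (d * (M / \<tau>)) = \<tau>"
      unfolding d_def \<rho>\<beta> t2 using M \<tau> by (simp add: power2_eq_square)
    then show ?thesis
      unfolding M\<beta> sobolev_K_def \<omega>_def[symmetric] N_def[symmetric] \<beta>_def[symmetric]
      by (simp only: mult.assoc)
  qed
  finally have "ennreal (\<bar>w x\<bar> powr crit) = ennreal (sobolev_K * M powr (2 * s / N)) * ennreal (d * (M / \<tau>))"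
    using d M(2) \<tau> sobolev_K_pos by (simp only: ennreal_mult'[symmetric] mult_nonneg_nonneg powr_ge_zero less_imp_le)
  also have "\<dots> \<le> ennreal (sobolev_K * M powr (2 * s / N)) * (\<integral>\<^sup>+y. ennreal (df w w (x, y)) \<partial>lborel)"
    using main by (rule mult_left_mono) simp
  finally show ?thesis by (simp add: N_def)
qed simp

text \<open>Integrating the pointwise bound leaves \<open>M powr \<theta>\<close> on the right with
  \<open>\<theta> = 1 - 2 / crit < 1\<close>. It can be absorbed into the left side only if
  \<open>M\<close> is finite, whence the integrability assumption.\<close>

lemma sobolev_a_priori:
  assumes w: "w \<in> \<H>" and int: "integrable lborel (\<lambda>x. \<bar>w x\<bar> powr crit)"
  shows "(LINT x|lborel. \<bar>w x\<bar> powr crit) \<le> (sobolev_K / \<kappa> * \<E> w w) powr (crit / 2)"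
proof -
  define M where "M = (LINT x|lborel. \<bar>w x\<bar> powr crit)"
  have [measurable]: "w \<in> borel_measurable borel" using w by (rule Hs_measurable)
  have M0: "0 \<le> M" by (simp add: M_def)
  show ?thesis
  proof (cases "M = 0")
    case False
    then have M: "0 < M" using M0 by simp
    define \<theta> where "\<theta> = 2 * s / real DIM('a)"
    have "ennreal M = (\<integral>\<^sup>+x. ennreal (\<bar>w x\<bar> powr crit) \<partial>lborel)"
      using nn_integral_eq_integral[OF int] by (simp add: M_def)
    also have "\<dots> \<le> (\<integral>\<^sup>+x. ennreal (sobolev_K * M powr \<theta>) * (\<integral>\<^sup>+y. ennreal (df w w (x, y)) \<partial>lborel) \<partial>lborel)"
      unfolding \<theta>_def by (intro nn_integral_mono sobolev_pointwise int M_def M) simp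
    also have "\<dots> = ennreal (sobolev_K * M powr \<theta>) * (\<integral>\<^sup>+z. ennreal (df w w z) \<partial>(lborel \<Otimes>\<^sub>M lborel))"
      using lborel.nn_integral_fst[of "\<lambda>z. ennreal (df w w z)" lborel]
      by (simp add: nn_integral_cmult)
    also have "(\<integral>\<^sup>+z. ennreal (df w w z) \<partial>(lborel \<Otimes>\<^sub>M lborel)) = ennreal (\<E> w w / \<kappa>)"
      using w \<kappa>_pos by (simp add: nn_integral_eq_integral Hs_iff X_inner_eq)
    also have "ennreal (sobolev_K * M powr \<theta>) * ennreal (\<E> w w / \<kappa>) = ennreal (sobolev_K * M powr \<theta> * (\<E> w w / \<kappa>))"
      using sobolev_K_pos by (intro ennreal_mult'[symmetric]) simp
    finally have "M \<le> sobolev_K * M powr \<theta> * (\<E> w w / \<kappa>)"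
      using sobolev_K_pos \<kappa>_pos by (subst (asm) ennreal_le_iff) auto
    then have "M / M powr \<theta> \<le> sobolev_K / \<kappa> * \<E> w w"
      using M by (simp add: field_simps)
    also have "M / M powr \<theta> = M powr (2 / crit)"
      using M by (simp add: two_div_crit \<theta>_def powr_diff)
    finally have "(M powr (2 / crit)) powr (crit / 2) \<le> (sobolev_K / \<kappa> * \<E> w w) powr (crit / 2)"
      using crit_gt_2 by (intro powr_mono2) auto
    then show ?thesis using crit_gt_2 M by (simp add: powr_powr M_def[symmetric])
  qed (simp add: M_def)
qed

text \<open>Truncation at height \<open>n\<close> makes the critical power integrable, being at most
  \<open>real n powr (crit - 2)\<close> times the square, without raising the energy. Fatou's lemma
  then removes the truncation.\<close>

lemma sobolev:
  assumes u: "u \<in> \<H>"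
  shows "integrable lborel (\<lambda>x. \<bar>u x\<bar> powr crit)"
    and "(LINT x|lborel. \<bar>u x\<bar> powr crit) \<le> (sobolev_K / \<kappa> * \<E> u u) powr (crit / 2)"
proof -
  define w where "w n x = max (- real n) (min (real n) (u x))" for n x
  have um [measurable]: "u \<in> borel_measurable borel" using u by (rule Hs_measurable)
  have wm [measurable]: "w n \<in> borel_measurable borel" for n unfolding w_def[abs_def] by measurable
  have w_diff: "\<bar>w n x - w n y\<bar> \<le> \<bar>u x - u y\<bar>" for n x y by (simp add: w_def max_def min_def)
  have w_le: "\<bar>w n x\<bar> \<le> \<bar>u x\<bar>" "\<bar>w n x\<bar> \<le> real n" for n x by (auto simp: w_def max_def min_def)
  have w_H: "w n \<in> \<H>" for n
  proof (rule Hs_dominated[OF u u wm, where C = 1])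
    show "\<bar>w n x - w n y\<bar> \<le> 1 * (\<bar>u x - u y\<bar> + \<bar>u x - u y\<bar>)" for x y
      by (rule order_trans[OF w_diff]) simp
    show "\<bar>w n x\<bar> \<le> 1 * (\<bar>u x\<bar> + \<bar>u x\<bar>)" for x by (rule order_trans[OF w_le(1)]) simp
  qed
  have w_int: "integrable lborel (\<lambda>x. \<bar>w n x\<bar> powr crit)" for n
  proof (rule Bochner_Integration.integrable_bound)
    show "integrable lborel (\<lambda>x. real n powr (crit - 2) * (w n x)\<^sup>2)"
      using w_H[of n] by (simp add: Hs_iff)
    have "\<bar>w n x\<bar> powr crit \<le> real n powr (crit - 2) * (w n x)\<^sup>2" for x
    proof (cases "w n x = 0")
      case False
      have "\<bar>w n x\<bar> powr crit = \<bar>w n x\<bar> powr (crit - 2) * \<bar>w n x\<bar>\<^sup>2"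
        using False by (simp add: powr_diff)
      also have "\<dots> \<le> real n powr (crit - 2) * \<bar>w n x\<bar>\<^sup>2"
        using w_le(2)[of n x] crit_gt_2 by (intro mult_right_mono powr_mono2) auto
      finally show ?thesis by simp
    qed simp
    then show "AE x in lborel. norm (\<bar>w n x\<bar> powr crit) \<le> norm (real n powr (crit - 2) * (w n x)\<^sup>2)" by simp
  qed simp
  have w_bd: "(LINT x|lborel. \<bar>w n x\<bar> powr crit) \<le> (sobolev_K / \<kappa> * \<E> u u) powr (crit / 2)" for n
  proof -
    have "\<E> (w n) (w n) \<le> \<E> u u" by (rule X_inner_self_mono[OF u w_H w_diff])
    then show ?thesis
      using sobolev_a_priori[OF w_H w_int] sobolev_K_pos \<kappa>_pos crit_gt_2
      by (rule_tac order_trans[OF sobolev_a_priori[OF w_H w_int]])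
         (auto intro!: powr_mono2 mult_left_mono divide_right_mono)
  qed
  have lim: "(\<lambda>n. \<bar>w n x\<bar> powr crit) \<longlonglongrightarrow> \<bar>u x\<bar> powr crit" for x
  proof (rule tendsto_eventually)
    obtain k :: nat where k: "\<bar>u x\<bar> \<le> real k" using real_arch_simple by blast
    show "\<forall>\<^sub>F n in sequentially. \<bar>w n x\<bar> powr crit = \<bar>u x\<bar> powr crit"
      using eventually_ge_at_top[of k]
    proof eventually_elim
      case (elim n)
      then have "\<bar>u x\<bar> \<le> real n" using k by simp
      then have "w n x = u x" unfolding w_def max_def min_def by auto
      then show ?case by simp
    qed
  qed
  have "integrable lborel (\<lambda>x. \<bar>u x\<bar> powr crit) \<and>
      (LINT x|lborel. \<bar>u x\<bar> powr crit) \<le> (sobolev_K / \<kappa> * \<E> u u) powr (crit / 2)"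
    by (rule integral_le_of_AE_tendsto[OF _ w_int _ _ w_bd tendsto_const]) (auto intro: lim)
  then show "integrable lborel (\<lambda>x. \<bar>u x\<bar> powr crit)"
    and "(LINT x|lborel. \<bar>u x\<bar> powr crit) \<le> (sobolev_K / \<kappa> * \<E> u u) powr (crit / 2)" by auto
qed

end

section \<open>Compactness\<close>

context frac_domain
begin

text \<open>Both \<open>t\<close> and \<open>t\<^sup>2\<close> are at most
  \<open>1 + t powr crit\<close>, and the constant 1 is integrable over the bounded domain. Thus the
  energy alone controls the first and second moments.\<close>

lemma X_integrable:
  assumes u: "u \<in> \<X>"
  shows "integrable lborel u"
    and "(LINT x|lborel. \<bar>u x\<bar>) \<le> measure lborel \<Omega> + (sobolev_K / \<kappa> * \<E> u u) powr (crit / 2)"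
    and "(LINT x|lborel. (u x)\<^sup>2) \<le> measure lborel \<Omega> + (sobolev_K / \<kappa> * \<E> u u) powr (crit / 2)"
proof -
  have um[measurable]: "u \<in> borel_measurable borel" using u by (rule X_measurable)
  define g where "g x = indicator \<Omega> x + \<bar>u x\<bar> powr crit" for x
  have ind: "integrable lborel (indicator \<Omega> :: 'a \<Rightarrow> real)"
    using emeasure_\<Omega>_finite by (simp add: less_top)
  have pint: "integrable lborel (\<lambda>x. \<bar>u x\<bar> powr crit)" by (rule sobolev(1)[OF X_Hs[OF u]])
  have gint: "integrable lborel g" unfolding g_def using ind pint by (rule Bochner_Integration.integrable_add)
  have g_int: "integral\<^sup>L lborel g \<le> measure lborel \<Omega> + (sobolev_K / \<kappa> * \<E> u u) powr (crit / 2)"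
    using ind pint sobolev(2)[OF X_Hs[OF u]] by (simp add: g_def[abs_def])
  have pw: "t powr \<alpha> \<le> 1 + t powr crit" if "0 \<le> t" "0 < \<alpha>" "\<alpha> \<le> crit" for t \<alpha> :: real
  proof (cases "t \<le> 1")
    case True
    have "t powr \<alpha> \<le> 1 powr \<alpha>" using that True by (intro powr_mono2) auto
    then show ?thesis using powr_ge_zero[of t crit] by (simp add: add_increasing2)
  next
    case False
    then have "t powr \<alpha> \<le> t powr crit" using that by (intro powr_mono) auto
    then show ?thesis by simp
  qed
  have ae: "AE x in lborel. \<bar>u x\<bar> \<le> g x \<and> (u x)\<^sup>2 \<le> g x"
    using X_zero_AE[OF u]
  proof eventually_elim
    case (elim x)
    show ?case
    proof (cases "x \<in> \<Omega>")
      case True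
      then show ?thesis
        using pw[of "\<bar>u x\<bar>" 1] pw[of "\<bar>u x\<bar>" 2] crit_gt_2 by (simp add: g_def)
    qed (use elim in \<open>simp add: g_def\<close>)
  qed
  show int: "integrable lborel u"
    by (rule Bochner_Integration.integrable_bound[OF gint]) (use ae in \<open>auto elim!: eventually_mono\<close>)
  show "(LINT x|lborel. \<bar>u x\<bar>) \<le> measure lborel \<Omega> + (sobolev_K / \<kappa> * \<E> u u) powr (crit / 2)"
    by (rule order_trans[OF _ g_int], rule integral_mono_AE)
       (use int gint ae in \<open>auto elim!: eventually_mono\<close>)
  show "(LINT x|lborel. (u x)\<^sup>2) \<le> measure lborel \<Omega> + (sobolev_K / \<kappa> * \<E> u u) powr (crit / 2)"
    by (rule order_trans[OF _ g_int], rule integral_mono_AE)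
       (use X_square_integrable[OF u] gint ae in \<open>auto elim!: eventually_mono\<close>)
qed

definition ball_int :: "'a \<Rightarrow> real \<Rightarrow> ('a \<Rightarrow> real) \<Rightarrow> real" where
  "ball_int z h w = (LINT y|lborel. indicator (ball z h) y * w y)"

text \<open>The kernel bound \<open>(2 * h) powr (N + 2 * s)\<close> divided by the ball volume and
  by \<open>2 * h powr s\<close>, the denominator of the quadratic term in the elementary
  inequality, equals \<open>avg_K * h powr s\<close>.\<close>

definition avg_K :: real where
  "avg_K = 2 powr (real DIM('a) + 2 * s) / (2 * unit_ball_vol (real DIM('a)))"

lemma avg_K_pos: "0 < avg_K"
proof -
  have "0 < unit_ball_vol (real DIM('a))" by simp
  then show ?thesis unfolding avg_K_def by (intro divide_pos_pos) auto
qed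

text \<open>Uses \<open>2 * \<bar>t\<bar> \<le> e + t\<^sup>2 / e\<close> with \<open>e = h powr s\<close> in place of the Cauchy-Schwarz inequality.\<close>
lemma average_approximation:
  assumes w: "w \<in> \<H>" and wi: "integrable lborel w"
  shows "AE x in lborel. \<forall>z h. 0 < h \<longrightarrow> dist z x < h \<longrightarrow>
    \<bar>w x - ball_int z h w / measure lborel (ball z h)\<bar>
      \<le> h powr s / 2 + avg_K * h powr s * (LINT y|lborel. df w w (x, y))"
proof -
  have [measurable]: "w \<in> borel_measurable borel" using w by (rule Hs_measurable)
  have "integrable (lborel \<Otimes>\<^sub>M lborel) (df w w)" using w by (simp add: Hs_iff)
  \<comment> \<open>The exceptional set depends on \<open>w\<close> only: it is where the section of
    the double integrand is not integrable. Hence one null set serves all centres and radii.\<close>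
  from lborel_pair.AE_integrable_fst'[OF this] show ?thesis
  proof eventually_elim
    case (elim x)
    show ?case
    proof (intro allI impI)
      fix z :: 'a and h :: real
      assume h: "0 < h" and zx: "dist z x < h"
      define N where "N = real DIM('a)"
      define \<omega> where "\<omega> = unit_ball_vol N"
      have \<omega>: "0 < \<omega>" by (simp add: \<omega>_def N_def)
      define m where "m = measure lborel (ball z h)"
      have m: "m = \<omega> * h powr N"
        using h by (simp add: m_def content_ball \<omega>_def N_def powr_realpow)
      have m0: "0 < m" using \<omega> h by (simp add: m)
      define e where "e = h powr s"
      have e: "0 < e" using h by (simp add: e_def)
      define k where "k = (2 * h) powr (N + 2 * s)"
      have ball_int: "integrable lborel (\<lambda>y. indicator (ball z h) y :: real)"
        using emeasure_lborel_ball_finite[of z h] by (simp add: less_top)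
      have wint: "integrable lborel (\<lambda>y. indicator (ball z h) y * w y)"
        by (rule integrable_mult_indicator[where 'b = real, simplified]) (use wi in auto)
      have pt: "indicator (ball z h) y * \<bar>w x - w y\<bar>
          \<le> indicator (ball z h) y * (e / 2) + k / (2 * e) * df w w (x, y)" for y
      proof (cases "y \<in> ball z h")
        case True
        have "norm (x - y) \<le> 2 * h"
          using True zx dist_triangle[of x y z] by (simp add: dist_norm[symmetric] dist_commute)
        then have nk: "norm (x - y) powr (N + 2 * s) \<le> k"
          unfolding k_def using s_pos by (intro powr_mono2) (auto simp: N_def)
        have "(w x - w y)\<^sup>2 \<le> k * df w w (x, y)"
        proof (cases "x = y")
          case False
          then have "(w x - w y)\<^sup>2 = norm (x - y) powr (N + 2 * s) * df w w (x, y)"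
            by (simp add: df_self N_def)
          also have "\<dots> \<le> k * df w w (x, y)" using nk by (rule mult_right_mono) simp
          finally show ?thesis .
        qed (simp add: k_def)
        then have a: "(w x - w y)\<^sup>2 / (2 * e) \<le> k / (2 * e) * df w w (x, y)"
          using e by (simp add: divide_right_mono)
        have "0 \<le> (\<bar>w x - w y\<bar> - e)\<^sup>2" by simp
        then have "2 * \<bar>w x - w y\<bar> * e \<le> (w x - w y)\<^sup>2 + e\<^sup>2"
          unfolding power2_diff power2_abs by linarith
        then have "\<bar>w x - w y\<bar> \<le> e / 2 + (w x - w y)\<^sup>2 / (2 * e)"
          using e by (simp add: field_simps power2_eq_square)
        then show ?thesis using True a by simp
      qed (use e in \<open>simp add: k_def\<close>)
      have eq: "w x * m - ball_int z h w = (LINT y|lborel. indicator (ball z h) y * (w x - w y))"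
      proof -
        have "(LINT y|lborel. indicator (ball z h) y * (w x - w y))
            = (LINT y|lborel. w x * indicator (ball z h) y - indicator (ball z h) y * w y)"
          by (intro Bochner_Integration.integral_cong) (auto simp: algebra_simps)
        also have "\<dots> = w x * m - ball_int z h w"
          using ball_int wint by (subst Bochner_Integration.integral_diff) (auto simp: ball_int_def m_def)
        finally show ?thesis by simp
      qed
      have dint: "integrable lborel (\<lambda>y. indicator (ball z h) y * (w x - w y))"
        using wint ball_int by (simp add: right_diff_distrib)
      have "\<bar>w x * m - ball_int z h w\<bar> \<le> (LINT y|lborel. indicator (ball z h) y * \<bar>w x - w y\<bar>)"
        unfolding eq using integral_norm_bound[of lborel "\<lambda>y. indicator (ball z h) y * (w x - w y)"]
        by (simp add: abs_mult)
      also have "\<dots> \<le> (LINT y|lborel. indicator (ball z h) y * (e / 2) + k / (2 * e) * df w w (x, y))"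
        using integrable_norm[OF dint] ball_int elim
        by (intro integral_mono pt) (auto simp: abs_mult)
      also have "\<dots> = m * (e / 2) + k / (2 * e) * (LINT y|lborel. df w w (x, y))"
        using ball_int elim by (subst Bochner_Integration.integral_add) (auto simp: m_def)
      finally have "\<bar>w x * m - ball_int z h w\<bar> / m \<le> (m * (e / 2) + k / (2 * e) * (LINT y|lborel. df w w (x, y))) / m"
        using m0 by (intro divide_right_mono) auto
      moreover have "\<bar>w x * m - ball_int z h w\<bar> / m = \<bar>w x - ball_int z h w / m\<bar>"
      proof -
        have "w x - ball_int z h w / m = (w x * m - ball_int z h w) / m" using m0 by (simp add: field_simps)
        then show ?thesis using m0 by (simp add: abs_divide)
      qed
      moreover have "k / (2 * e) / m = avg_K * e"
      proof -
        have "k = 2 powr (N + 2 * s) * (h powr N * (e * e))"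
          using h by (simp add: k_def e_def powr_mult powr_add[symmetric])
        then have "k / (2 * e) / m = 2 powr (N + 2 * s) * (h powr N * (e * e)) / (2 * e * (\<omega> * h powr N))"
          by (simp add: m)
        also have "\<dots> = 2 powr (N + 2 * s) / (2 * \<omega>) * e"
          using e h \<omega> by simp
        finally show ?thesis by (simp add: avg_K_def \<omega>_def N_def)
      qed
      ultimately show "\<bar>w x - ball_int z h w / measure lborel (ball z h)\<bar>
          \<le> h powr s / 2 + avg_K * h powr s * (LINT y|lborel. df w w (x, y))"
        unfolding m_def[symmetric] e_def[symmetric] using m0
        by (simp add: add_divide_distrib) (metis divide_divide_eq_left mult.commute times_divide_eq_left)
    qed
  qed
qed

text \<open>At a point of \<Omega> both functions are compared with their means over a covering ball
  containing it. The sum over all of \<open>T\<close> bounds the difference of the two means without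
  selecting a ball measurably. The first term is small with \<open>h\<close>, uniformly on bounded
  energies; the second involves finitely many means.\<close>

lemma L1_distance_bound:
  assumes w: "w \<in> \<X>" and v: "v \<in> \<X>" and h: "0 < h" and T: "finite T" "\<Omega> \<subseteq> (\<Union>z\<in>T. ball z h)"
  shows "(LINT x|lborel. \<bar>w x - v x\<bar>) \<le> h powr s * (measure lborel \<Omega> + avg_K / \<kappa> * (\<E> w w + \<E> v v))
    + measure lborel \<Omega> * (\<Sum>z\<in>T. \<bar>ball_int z h w / measure lborel (ball z h) - ball_int z h v / measure lborel (ball z h)\<bar>)"
proof -
  define S where "S = (\<Sum>z\<in>T. \<bar>ball_int z h w / measure lborel (ball z h) - ball_int z h v / measure lborel (ball z h)\<bar>)"
  define D where "D f x = (LINT y|lborel. df f f (x, y))" for f and x :: 'a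
  have D: "integrable lborel (D f)" "integral\<^sup>L lborel (D f) = \<E> f f / \<kappa>" "0 \<le> D f x" if "f \<in> \<X>" for f x
  proof -
    have "integrable (lborel \<Otimes>\<^sub>M lborel) (df f f)" using X_Hs[OF that] by (simp add: Hs_iff)
    from lborel_pair.integrable_fst'[OF this] lborel_pair.integral_fst'[OF this]
    show "integrable lborel (D f)" "integral\<^sup>L lborel (D f) = \<E> f f / \<kappa>"
      using \<kappa>_pos by (auto simp: D_def[abs_def] X_inner_eq)
    show "0 \<le> D f x" by (simp add: D_def)
  qed
  define G where "G x = indicator \<Omega> x * (h powr s + S) + avg_K * h powr s * (D w x + D v x)" for x
  have ind: "integrable lborel (indicator \<Omega> :: 'a \<Rightarrow> real)"
    using emeasure_\<Omega>_finite by (simp add: less_top)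
  have Gint: "integrable lborel G"
    unfolding G_def using ind D(1)[OF w] D(1)[OF v] by simp
  have "(LINT x|lborel. \<bar>w x - v x\<bar>) \<le> integral\<^sup>L lborel G"
  proof (rule integral_mono_AE)
    show "integrable lborel (\<lambda>x. \<bar>w x - v x\<bar>)"
      using X_integrable(1)[OF w] X_integrable(1)[OF v] by simp
    show "AE x in lborel. \<bar>w x - v x\<bar> \<le> G x"
      using average_approximation[OF X_Hs[OF w] X_integrable(1)[OF w]]
        average_approximation[OF X_Hs[OF v] X_integrable(1)[OF v]] X_zero_AE[OF w] X_zero_AE[OF v]
    proof eventually_elim
      case (elim x)
      show ?case
      proof (cases "x \<in> \<Omega>")
        case True
        then obtain z where z: "z \<in> T" "dist z x < h" using T(2) by auto
        define a where "a = ball_int z h w / measure lborel (ball z h)"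
        define b where "b = ball_int z h v / measure lborel (ball z h)"
        have "\<bar>a - b\<bar> \<le> S"
          unfolding a_def b_def S_def by (rule member_le_sum[OF z(1)]) (use T in auto)
        moreover have "\<bar>w x - a\<bar> \<le> h powr s / 2 + avg_K * h powr s * D w x"
          using elim(1) h z(2) by (simp add: a_def D_def)
        moreover have "\<bar>v x - b\<bar> \<le> h powr s / 2 + avg_K * h powr s * D v x"
          using elim(2) h z(2) by (simp add: b_def D_def)
        ultimately have "\<bar>w x - v x\<bar> \<le> h powr s + S + (avg_K * h powr s * D w x + avg_K * h powr s * D v x)"
          by linarith
        then show ?thesis using True by (simp add: G_def distrib_left)
      next
        case False
        then show ?thesis
          using elim(3,4) D(3)[OF w, of x] D(3)[OF v, of x] avg_K_pos by (simp add: G_def)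
      qed
    qed
  qed (rule Gint)
  also have "integral\<^sup>L lborel G = measure lborel \<Omega> * (h powr s + S) + avg_K * h powr s * (\<E> w w / \<kappa> + \<E> v v / \<kappa>)"
    unfolding G_def using ind D[OF w] D[OF v] by simp
  finally show ?thesis unfolding S_def[symmetric]
    by (simp add: algebra_simps add_divide_distrib)
qed

text \<open>A diagonal argument makes the means converge over all balls with centres in a countable
  dense set and radii \<open>1 / (k + 1)\<close>. By \<open>L1_distance_bound\<close> the
  subsequence is then Cauchy in the mean, a further one converges almost everywhere, and a last one
  makes the energies converge. Their limit \<open>L\<close> is exported since lower semicontinuity
  compares \<open>\<E> v v\<close> with it.\<close>

lemma compactness:
  assumes u: "\<And>n. u n \<in> \<X>" and E: "\<And>n. \<E> (u n) (u n) \<le> C"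
  obtains \<sigma> v L where "strict_mono (\<sigma> :: nat \<Rightarrow> nat)" "v \<in> \<X>"
    "AE x in lborel. (\<lambda>n. u (\<sigma> n) x) \<longlonglongrightarrow> v x"
    "(\<lambda>n. \<E> (u (\<sigma> n)) (u (\<sigma> n))) \<longlonglongrightarrow> L" "\<E> v v \<le> L"
proof -
  define B where "B = measure lborel \<Omega> + (sobolev_K / \<kappa> * C) powr (crit / 2)"
  have E_B: "measure lborel \<Omega> + (sobolev_K / \<kappa> * \<E> (u n) (u n)) powr (crit / 2) \<le> B" for n
    unfolding B_def using E[of n] sobolev_K_pos \<kappa>_pos crit_gt_2
    by (intro add_left_mono powr_mono2 mult_left_mono) auto
  have um [measurable]: "u n \<in> borel_measurable borel" for n using u by (rule X_measurable)
  have u_int: "integrable lborel (u n)" for n by (rule X_integrable(1)[OF u])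
  have u_L1: "(LINT x|lborel. \<bar>u n x\<bar>) \<le> B" for n using X_integrable(2)[OF u] E_B by (rule order_trans)
  have u_L2: "(LINT x|lborel. (u n x)\<^sup>2) \<le> B" for n using X_integrable(3)[OF u] E_B by (rule order_trans)
  obtain D :: "'a set" where D: "countable D" "\<And>U. open U \<Longrightarrow> U \<noteq> {} \<Longrightarrow> \<exists>d\<in>D. d \<in> U"
    by (rule countable_dense_setE) blast
  define I where "I = D \<times> range (\<lambda>k::nat. 1 / (real k + 1))"
  have I: "countable I" unfolding I_def using D(1) by auto
  have bd: "norm (ball_int (fst i) (snd i) (u n)) \<le> B" for i n
  proof -
    have "norm (ball_int (fst i) (snd i) (u n)) \<le> (LINT y|lborel. norm (indicator (ball (fst i) (snd i)) y * u n y))"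
      unfolding ball_int_def by (rule integral_norm_bound)
    also have "\<dots> \<le> (LINT y|lborel. \<bar>u n y\<bar>)"
      using u_int[of n]
      by (intro integral_mono integrable_norm integrable_mult_indicator[where 'b = real, simplified])
         (auto simp: abs_mult indicator_def)
    finally show ?thesis using u_L1[of n] by simp
  qed
  obtain k where k: "strict_mono k" "\<And>i. i \<in> I \<Longrightarrow> \<exists>l. (\<lambda>n. ball_int (fst i) (snd i) (u (k n))) \<longlonglongrightarrow> l"
    by (rule function_convergent_subsequence[OF I, of "\<lambda>n i. ball_int (fst i) (snd i) (u n)" B]) (use bd in blast)+
  have cauchy: "\<exists>N. \<forall>i\<ge>N. \<forall>j\<ge>N. (LINT x|lborel. norm (u (k i) x - u (k j) x)) < e" if e: "0 < e" for e
  proof -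
    define m where "m = measure lborel \<Omega>"
    have m0: "0 \<le> m" by (simp add: m_def)
    define c where "c = m + avg_K / \<kappa> * (C + C)"
    have "(\<lambda>n. (1 / (real n + 1)) powr s * c) \<longlonglongrightarrow> 0"
    proof -
      have "(\<lambda>n. (1 / (real n + 1)) powr s * c) \<longlonglongrightarrow> 0 powr s * c"
        using LIMSEQ_inverse_real_of_nat s_pos
        by (intro tendsto_mult tendsto_powr' tendsto_const) (auto simp: inverse_eq_divide add.commute)
      then show ?thesis by simp
    qed
    \<comment> \<open>The radius is fixed by the energy bound alone; the finite cover, and the index
      from which its means agree, are chosen afterwards.\<close>
    from LIMSEQ_D[OF this, of "e / 2"] e obtain q :: nat where "\<bar>(1 / (real q + 1)) powr s * c\<bar> < e / 2" by auto
    moreover define h where "h = 1 / (real q + 1)"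
    ultimately have hc: "h powr s * c < e / 2" and h: "0 < h" by auto
    have "\<exists>T. T \<subseteq> D \<and> finite T \<and> closure \<Omega> \<subseteq> (\<Union>z\<in>T. ball z h)"
    proof (rule compactE_image[of "closure \<Omega>" D "\<lambda>z. ball z h"])
      show "compact (closure \<Omega>)" using bounded_\<Omega> by (simp add: compact_closure)
      show "closure \<Omega> \<subseteq> (\<Union>z\<in>D. ball z h)"
      proof
        fix x assume "x \<in> closure \<Omega>"
        have "ball x h \<noteq> {}" using h by simp
        then obtain d where "d \<in> D" "d \<in> ball x h" using D(2)[OF open_ball, of x h] by blast
        then show "x \<in> (\<Union>z\<in>D. ball z h)" by (auto simp: dist_commute)
      qed
    qed auto
    then obtain T where T: "T \<subseteq> D" "finite T" "closure \<Omega> \<subseteq> (\<Union>z\<in>T. ball z h)" by blast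
    have cov: "\<Omega> \<subseteq> (\<Union>z\<in>T. ball z h)" using T(3) closure_subset by blast
    define A where "A z n = ball_int z h (u (k n)) / measure lborel (ball z h)" for z n
    have "Cauchy (A z)" if "z \<in> T" for z
    proof -
      have "(z, h) \<in> I" using that T(1) by (auto simp: I_def h_def)
      then obtain l where "(\<lambda>n. ball_int z h (u (k n))) \<longlonglongrightarrow> l" using k(2) by fastforce
      then have "(\<lambda>n. A z n) \<longlonglongrightarrow> l / measure lborel (ball z h)"
        unfolding A_def using h by (intro tendsto_divide tendsto_const) auto
      then show ?thesis by (rule LIMSEQ_imp_Cauchy)
    qed
    \<comment> \<open>The added ones keep \<open>Q\<close> positive in degenerate cases; with
      \<open>\<epsilon> = e / (2 * Q)\<close> the means contribute at most
      \<open>e / 2\<close>.\<close>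
    define Q where "Q = (m + 1) * (real (card T) + 1)"
    have Q: "0 < Q" unfolding Q_def using m0 by (intro mult_pos_pos) auto
    define \<epsilon> where "\<epsilon> = e / (2 * Q)"
    have \<epsilon>: "0 < \<epsilon>" using e Q by (simp add: \<epsilon>_def)
    have "\<forall>z\<in>T. \<exists>N. \<forall>i\<ge>N. \<forall>j\<ge>N. \<bar>A z i - A z j\<bar> < \<epsilon>"
      using \<open>\<And>z. z \<in> T \<Longrightarrow> Cauchy (A z)\<close> \<epsilon> by (fastforce simp: Cauchy_def dist_real_def)
    then obtain N where N: "\<And>z i j. z \<in> T \<Longrightarrow> N z \<le> i \<Longrightarrow> N z \<le> j \<Longrightarrow> \<bar>A z i - A z j\<bar> < \<epsilon>"
      by metis
    define N0 where "N0 = (\<Sum>z\<in>T. N z)"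
    have N0: "N z \<le> N0" if "z \<in> T" for z
      unfolding N0_def by (rule member_le_sum[OF that]) (use T in auto)
    show ?thesis
    proof (intro exI allI impI)
      fix i j assume ij: "N0 \<le> i" "N0 \<le> j"
      have "(\<Sum>z\<in>T. \<bar>A z i - A z j\<bar>) \<le> (\<Sum>z\<in>T. \<epsilon>)"
        using N N0 ij by (intro sum_mono less_imp_le) (meson order_trans)
      then have sum: "(\<Sum>z\<in>T. \<bar>A z i - A z j\<bar>) \<le> real (card T) * \<epsilon>" by simp
      have "(LINT x|lborel. \<bar>u (k i) x - u (k j) x\<bar>)
          \<le> h powr s * (m + avg_K / \<kappa> * (\<E> (u (k i)) (u (k i)) + \<E> (u (k j)) (u (k j)))) + m * (\<Sum>z\<in>T. \<bar>A z i - A z j\<bar>)"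
        unfolding m_def A_def by (rule L1_distance_bound[OF u u h T(2) cov])
      also have "\<dots> \<le> h powr s * c + m * (real (card T) * \<epsilon>)"
        unfolding c_def using E sum m0 avg_K_pos \<kappa>_pos
        by (intro add_mono mult_left_mono add_left_mono) (auto intro!: add_mono)
      also have "m * (real (card T) * \<epsilon>) \<le> e / 2"
      proof -
        have "m * real (card T) \<le> Q" unfolding Q_def using m0 by (intro mult_mono) auto
        then have "m * real (card T) * \<epsilon> \<le> Q * \<epsilon>"
          using \<epsilon> by (intro mult_right_mono) auto
        also have "\<dots> = e / 2" using Q by (simp add: \<epsilon>_def)
        finally show ?thesis by (simp add: mult.assoc)
      qed
      finally show "(LINT x|lborel. norm (u (k i) x - u (k j) x)) < e" using hc by simp
    qed
  qed
  obtain r where r: "strict_mono r" "AE x in lborel. Cauchy (\<lambda>i. u (k (r i)) x)"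
    by (rule cauchy_L1_AE_cauchy_subseq[of lborel "\<lambda>n. u (k n)"]) (use u_int cauchy in auto)
  define \<tau> where "\<tau> n = k (r n)" for n
  have "bounded (range (\<lambda>n. \<E> (u (\<tau> n)) (u (\<tau> n))))"
    using E by (intro boundedI[where B = C]) auto
  then obtain L q where q: "strict_mono q" "(\<lambda>n. \<E> (u (\<tau> (q n))) (u (\<tau> (q n)))) \<longlonglongrightarrow> L"
    using bounded_imp_convergent_subsequence unfolding o_def by blast
  define \<sigma> where "\<sigma> n = \<tau> (q n)" for n
  have \<sigma>: "strict_mono \<sigma>"
    using k(1) r(1) q(1) by (simp add: strict_mono_def \<sigma>_def \<tau>_def)
  \<comment> \<open>\<open>lim\<close> is total, so \<open>v\<close> is Borel on the whole space;
    its values at points of divergence concern only a null set.\<close>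
  define v where "v x = lim (\<lambda>n. u (\<tau> n) x)" for x
  have vm [measurable]: "v \<in> borel_measurable borel" unfolding v_def[abs_def] by measurable
  have conv: "AE x in lborel. (\<lambda>n. u (\<sigma> n) x) \<longlonglongrightarrow> v x"
    using r(2)
  proof eventually_elim
    case (elim x)
    then have "(\<lambda>n. u (\<tau> n) x) \<longlonglongrightarrow> v x"
      by (simp add: v_def \<tau>_def Cauchy_convergent_iff convergent_LIMSEQ_iff)
    then show ?case unfolding \<sigma>_def using LIMSEQ_subseq_LIMSEQ[OF _ q(1)] by (auto simp: o_def)
  qed
  have L: "(\<lambda>n. \<E> (u (\<sigma> n)) (u (\<sigma> n))) \<longlonglongrightarrow> L" using q(2) by (simp add: \<sigma>_def)
  have v2: "integrable lborel (\<lambda>x. (v x)\<^sup>2)"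
  proof -
    have "integrable lborel (\<lambda>x. (v x)\<^sup>2) \<and> (LINT x|lborel. (v x)\<^sup>2) \<le> B"
    proof (rule integral_le_of_AE_tendsto)
      show "AE x in lborel. (\<lambda>n. (u (\<sigma> n) x)\<^sup>2) \<longlonglongrightarrow> (v x)\<^sup>2"
        using conv by eventually_elim (rule tendsto_power)
      show "(LINT x|lborel. (u (\<sigma> n) x)\<^sup>2) \<le> B" for n by (rule u_L2)
      show "integrable lborel (\<lambda>x. (u (\<sigma> n) x)\<^sup>2)" for n by (rule X_square_integrable[OF u])
    qed auto
    then show ?thesis ..
  qed
  have dfv: "integrable (lborel \<Otimes>\<^sub>M lborel) (df v v) \<and> (LINT z|(lborel \<Otimes>\<^sub>M lborel). df v v z) \<le> L / \<kappa>"
  proof (rule integral_le_of_AE_tendsto)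
    show "integrable (lborel \<Otimes>\<^sub>M lborel) (df (u (\<sigma> n)) (u (\<sigma> n)))" for n
      using X_Hs[OF u] by (simp add: Hs_iff)
    show "AE z in lborel \<Otimes>\<^sub>M lborel. (\<lambda>n. df (u (\<sigma> n)) (u (\<sigma> n)) z) \<longlonglongrightarrow> df v v z"
      using AE_pair_fst[OF conv] unfolding df_def divide_inverse
      by eventually_elim (intro tendsto_intros)
    show "(LINT z|(lborel \<Otimes>\<^sub>M lborel). df (u (\<sigma> n)) (u (\<sigma> n)) z) \<le> \<E> (u (\<sigma> n)) (u (\<sigma> n)) / \<kappa>" for n
      using \<kappa>_pos by (simp add: X_inner_eq)
    show "(\<lambda>n. \<E> (u (\<sigma> n)) (u (\<sigma> n)) / \<kappa>) \<longlonglongrightarrow> L / \<kappa>"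
      using L \<kappa>_pos by (intro tendsto_divide tendsto_const) auto
  qed auto
  have "AE x in lborel. \<forall>n. x \<notin> \<Omega> \<longrightarrow> u (\<sigma> n) x = 0"
    unfolding AE_all_countable using X_zero_AE[OF u] by blast
  with conv have "AE x in lborel. x \<notin> \<Omega> \<longrightarrow> v x = 0"
  proof eventually_elim
    case (elim x)
    show ?case
    proof
      assume "x \<notin> \<Omega>"
      then have "(\<lambda>n. u (\<sigma> n) x) = (\<lambda>n. 0)" using elim(2) by auto
      then show "v x = 0" using elim(1) by (simp add: LIMSEQ_const_iff)
    qed
  qed
  then have vX: "v \<in> \<X>" using v2 dfv by (simp add: X_space_def Hs_iff)
  have "\<E> v v \<le> L" using dfv \<kappa>_pos by (simp add: X_inner_eq field_simps)
  with \<sigma> vX conv L show ?thesis by (rule that)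
qed

end

section \<open>Strong maximum principle\<close>

context frac_domain
begin

text \<open>Test with \<open>cutoff * max 0 (1 - n * u)\<close>, which concentrates on the zero set \<open>Z\<close> of \<open>u\<close> as
  \<open>n\<close> grows: the zero-order term disappears while the form tends to minus the interaction
  between \<open>Z \<inter> \<Omega>\<close> and the complement of \<open>Z\<close>.\<close>
lemma strong_maximum_principle:
  assumes u: "u \<in> \<X>" and nonneg: "\<And>x. 0 \<le> u x" and nz: "\<not> (AE x in lborel. u x = 0)"
    and k: "0 \<le> k"
    and super: "\<And>\<phi>. \<phi> \<in> \<X> \<Longrightarrow> (\<And>x. 0 \<le> \<phi> x) \<Longrightarrow> - k * (LINT x|lborel. u x * \<phi> x) \<le> \<E> u \<phi>"
  shows "AE x in lborel. x \<in> \<Omega> \<longrightarrow> 0 < u x"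
proof -
  have [measurable]: "u \<in> borel_measurable borel" using u by (rule X_measurable)
  define \<eta> where "\<eta> = cutoff"
  have \<eta>: "\<eta> \<in> \<X>" "\<And>x. 0 \<le> \<eta> x" "\<And>x. \<eta> x \<le> 1"
    using cutoff_in_X cutoff_nonneg order_trans[OF cutoff_le] by (auto simp: \<eta>_def)
  have [measurable]: "\<eta> \<in> borel_measurable borel" using \<eta>(1) by (rule X_measurable)
  have \<eta>_int: "integrable lborel \<eta>" by (rule X_integrable(1)[OF \<eta>(1)])
  define h where "h n x = max 0 (1 - real (Suc n) * u x)" for n x
  define \<phi> where "\<phi> n x = \<eta> x * h n x" for n x
  have h01: "0 \<le> h n x" "h n x \<le> 1" for n x
    using nonneg[of x] by (auto simp: h_def)
  have [measurable]: "\<phi> n \<in> borel_measurable borel" for n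
    unfolding \<phi>_def[abs_def] h_def[abs_def] by measurable
  have h_lip: "\<bar>h n x - h n y\<bar> \<le> real (Suc n) * \<bar>u x - u y\<bar>" for n x y
  proof -
    have "\<bar>h n x - h n y\<bar> \<le> \<bar>real (Suc n) * u x - real (Suc n) * u y\<bar>"
      unfolding h_def max_def by auto
    then show ?thesis unfolding right_diff_distrib[symmetric] abs_mult by simp
  qed
  have \<phi>_nonneg: "0 \<le> \<phi> n x" for n x using \<eta>(2) h01 by (simp add: \<phi>_def)
  have \<phi>_le: "\<phi> n x \<le> \<eta> x" for n x
    using mult_left_mono[OF h01(2)[of n x] \<eta>(2)[of x]] by (simp add: \<phi>_def)
  have \<phi>_X: "\<phi> n \<in> \<X>" for n
  proof (rule X_dominated[OF \<eta>(1) u, where C = "real (Suc n)"])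
    show "\<bar>\<phi> n x\<bar> \<le> real (Suc n) * (\<bar>\<eta> x\<bar> + \<bar>u x\<bar>)" for x
    proof -
      have "\<bar>\<phi> n x\<bar> \<le> 1 * (\<bar>\<eta> x\<bar> + \<bar>u x\<bar>)" using \<phi>_nonneg[of n x] \<phi>_le[of n x] by simp
      also have "\<dots> \<le> real (Suc n) * (\<bar>\<eta> x\<bar> + \<bar>u x\<bar>)" by (rule mult_right_mono) auto
      finally show ?thesis .
    qed
    show "\<bar>\<phi> n x - \<phi> n y\<bar> \<le> real (Suc n) * (\<bar>\<eta> x - \<eta> y\<bar> + \<bar>u x - u y\<bar>)" for x y
    proof -
      have "\<phi> n x - \<phi> n y = (\<eta> x - \<eta> y) * h n x + \<eta> y * (h n x - h n y)"
        by (simp add: \<phi>_def algebra_simps)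
      then have "\<bar>\<phi> n x - \<phi> n y\<bar> \<le> \<bar>\<eta> x - \<eta> y\<bar> * \<bar>h n x\<bar> + \<bar>\<eta> y\<bar> * \<bar>h n x - h n y\<bar>"
        using abs_triangle_ineq[of "(\<eta> x - \<eta> y) * h n x" "\<eta> y * (h n x - h n y)"]
        by (simp only: abs_mult)
      also have "\<dots> \<le> \<bar>\<eta> x - \<eta> y\<bar> * real (Suc n) + 1 * (real (Suc n) * \<bar>u x - u y\<bar>)"
        using h01[of n x] \<eta>(2,3)[of y] h_lip[of n x y]
        by (intro add_mono mult_mono) auto
      finally show ?thesis by (simp only: distrib_left mult.commute mult_1)
    qed
  qed measurable
  define \<psi> where "\<psi> x = \<eta> x * (if u x = 0 then 1 else 0)" for x
  have [measurable]: "\<psi> \<in> borel_measurable borel" unfolding \<psi>_def[abs_def] by measurable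
  have \<phi>_lim: "(\<lambda>n. \<phi> n x) \<longlonglongrightarrow> \<psi> x" for x
  proof (cases "u x = 0")
    case False
    then have pos: "0 < u x" using nonneg[of x] by (simp add: order_less_le)
    obtain N :: nat where N: "1 / u x \<le> real N" using real_arch_simple by blast
    show ?thesis
    proof (rule tendsto_eventually, rule eventually_mono[OF eventually_ge_at_top[of N]])
      fix n assume "N \<le> n"
      then have "1 / u x \<le> real (Suc n)" using N by simp
      then have "1 \<le> real (Suc n) * u x" using pos by (simp only: pos_divide_le_eq)
      then show "\<phi> n x = \<psi> x" using False by (simp add: \<phi>_def \<psi>_def h_def)
    qed
  qed (simp add: \<phi>_def \<psi>_def h_def)
  \<comment> \<open>A fixed integrable majorant of all \<open>df u (\<phi> n)\<close>, so that
    Fatou's lemma applies to the nonnegative functions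
    \<open>G z - df u (\<phi> n) z\<close>.\<close>
  define G where "G z = \<bar>df u \<eta> z\<bar>" for z
  have G_int: "integrable (lborel \<Otimes>\<^sub>M lborel) G"
    unfolding G_def using df_integrable[OF X_Hs[OF u] X_Hs[OF \<eta>(1)]] by simp
  have F_int: "integrable (lborel \<Otimes>\<^sub>M lborel) (df u (\<phi> n))" for n
    by (rule df_integrable[OF X_Hs[OF u] X_Hs[OF \<phi>_X]])
  have F_le: "df u (\<phi> n) z \<le> G z" for n z
  proof -
    define x y where "x = fst z" and "y = snd z"
    have "(u x - u y) * (\<phi> n x - \<phi> n y) \<le> \<bar>u x - u y\<bar> * \<bar>\<eta> x - \<eta> y\<bar>"
    proof -
      \<comment> \<open>If \<open>u y \<le> u x\<close>, then \<open>h n x \<le> h n y\<close>, so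
        replacing \<open>h n y\<close> by \<open>h n x\<close> only enlarges the difference of the
        test function and leaves \<open>(\<eta> x - \<eta> y) * h n x\<close>. The other case
        follows by exchanging the points.\<close>
      have *: "(u x - u y) * (\<phi> n x - \<phi> n y) \<le> \<bar>u x - u y\<bar> * \<bar>\<eta> x - \<eta> y\<bar>" if "u y \<le> u x" for x y
      proof -
        have "real (Suc n) * u y \<le> real (Suc n) * u x" using that by (intro mult_left_mono) auto
        then have "h n x \<le> h n y" unfolding h_def by linarith
        then have "\<phi> n x - \<phi> n y \<le> \<eta> x * h n x - \<eta> y * h n x"
          using \<eta>(2)[of y] by (simp add: \<phi>_def mult_left_mono)
        also have "\<dots> = (\<eta> x - \<eta> y) * h n x" by (simp add: algebra_simps)
        also have "\<dots> \<le> \<bar>\<eta> x - \<eta> y\<bar> * 1"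
          using h01[of n x] by (intro mult_mono) auto
        finally show ?thesis using that by (simp add: mult_left_mono)
      qed
      show ?thesis
      proof (cases "u y \<le> u x")
        case False
        then have "(u y - u x) * (\<phi> n y - \<phi> n x) \<le> \<bar>u y - u x\<bar> * \<bar>\<eta> y - \<eta> x\<bar>" by (intro *) simp
        then show ?thesis by (simp add: abs_minus_commute algebra_simps)
      qed (rule *)
    qed
    then show ?thesis
      unfolding G_def df_def x_def y_def abs_divide abs_mult
      by (simp add: divide_right_mono)
  qed
  \<comment> \<open>Where \<open>h n x\<close> is nonzero, \<open>u x\<close> is below
    \<open>1 / real (Suc n)\<close>; this makes the zero-order term vanish in the limit.\<close>
  have u\<phi>_le: "u x * \<phi> n x \<le> \<eta> x / real (Suc n)" for n x
  proof -
    have "real (Suc n) * (u x * h n x) \<le> 1"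
    proof (cases "real (Suc n) * u x \<le> 1")
      case True
      then have "(real (Suc n) * u x) * h n x \<le> 1 * 1" using h01[of n x] nonneg[of x] by (intro mult_mono) auto
      then show ?thesis by (simp add: mult.assoc)
    qed (simp add: h_def)
    then have "u x * h n x \<le> 1 / real (Suc n)"
      by (subst pos_le_divide_eq) (simp_all add: mult.commute)
    from mult_left_mono[OF this \<eta>(2)[of x]] show ?thesis by (simp add: \<phi>_def mult_ac)
  qed
  define B where "B n = integral\<^sup>L (lborel \<Otimes>\<^sub>M lborel) G + k / \<kappa> * (integral\<^sup>L lborel \<eta> / real (Suc n))" for n
  have B_lim: "B \<longlonglongrightarrow> integral\<^sup>L (lborel \<Otimes>\<^sub>M lborel) G + k / \<kappa> * 0"
    unfolding B_def[abs_def]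
    by (intro tendsto_add tendsto_mult tendsto_const LIMSEQ_Suc[OF lim_const_over_n])
  have f_le: "(LINT z|(lborel \<Otimes>\<^sub>M lborel). G z - df u (\<phi> n) z) \<le> B n" for n
  proof -
    have "(LINT x|lborel. u x * \<phi> n x) \<le> (LINT x|lborel. \<eta> x / real (Suc n))"
    proof (rule integral_mono_AE')
      show "integrable lborel (\<lambda>x. \<eta> x / real (Suc n))" using \<eta>_int by simp
      show "AE x in lborel. u x * \<phi> n x \<le> \<eta> x / real (Suc n)" by (simp only: u\<phi>_le) simp
      show "AE x in lborel. 0 \<le> \<eta> x / real (Suc n)" using \<eta>(2) by simp
    qed
    then have "k * (LINT x|lborel. u x * \<phi> n x) \<le> k * (integral\<^sup>L lborel \<eta> / real (Suc n))"
      using k by (intro mult_left_mono) auto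
    moreover have "- k * (LINT x|lborel. u x * \<phi> n x) \<le> \<E> u (\<phi> n)"
      by (rule super[OF \<phi>_X \<phi>_nonneg])
    ultimately have "- \<E> u (\<phi> n) \<le> k * (integral\<^sup>L lborel \<eta> / real (Suc n))" by simp
    then have "- \<E> u (\<phi> n) / \<kappa> \<le> k * (integral\<^sup>L lborel \<eta> / real (Suc n)) / \<kappa>"
      using \<kappa>_pos by (intro divide_right_mono) auto
    moreover have "- \<E> u (\<phi> n) / \<kappa> = - (LINT z|(lborel \<Otimes>\<^sub>M lborel). df u (\<phi> n) z)"
      using \<kappa>_pos by (simp add: X_inner_eq)
    ultimately show ?thesis using G_int F_int by (simp add: B_def mult.commute)
  qed
  have lim_int: "integrable (lborel \<Otimes>\<^sub>M lborel) (\<lambda>z. G z - df u \<psi> z) \<and>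
      (LINT z|(lborel \<Otimes>\<^sub>M lborel). G z - df u \<psi> z) \<le> integral\<^sup>L (lborel \<Otimes>\<^sub>M lborel) G + k / \<kappa> * 0"
  proof (rule integral_le_of_AE_tendsto[OF _ _ _ _ f_le B_lim])
    show "(\<lambda>z. G z - df u \<psi> z) \<in> borel_measurable (lborel \<Otimes>\<^sub>M lborel)"
      using G_int by (intro borel_measurable_diff df_measurable) auto
    show "integrable (lborel \<Otimes>\<^sub>M lborel) (\<lambda>z. G z - df u (\<phi> n) z)" for n
      using G_int F_int by simp
    show "0 \<le> G z - df u (\<phi> n) z" for n z using F_le[of n z] by simp
    have "(\<lambda>n. G z - df u (\<phi> n) z) \<longlonglongrightarrow> G z - df u \<psi> z" for z
      unfolding df_def divide_inverse by (intro tendsto_intros \<phi>_lim)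
    then show "AE z in lborel \<Otimes>\<^sub>M lborel. (\<lambda>n. G z - df u (\<phi> n) z) \<longlonglongrightarrow> G z - df u \<psi> z" by simp
  qed
  \<comment> \<open>\<open>\<psi>\<close> may jump at the edge of the zero set and is not known to
    lie in \<open>\<X>\<close>, so integrability of this product is drawn from Fatou's
    lemma.\<close>
  have \<psi>_int: "integrable (lborel \<Otimes>\<^sub>M lborel) (df u \<psi>)"
    using Bochner_Integration.integrable_diff[OF G_int conjunct1[OF lim_int]] by simp
  have "(LINT z|(lborel \<Otimes>\<^sub>M lborel). - df u \<psi> z) \<le> 0"
    using lim_int \<psi>_int G_int by simp
  moreover have neg: "0 \<le> - df u \<psi> z" for z
  proof -
    have "(u x - u y) * (\<psi> x - \<psi> y) \<le> 0" for x y
      using nonneg[of x] nonneg[of y] \<eta>(2)[of x] \<eta>(2)[of y]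
      by (auto simp: \<psi>_def mult_nonneg_nonpos mult_nonpos_nonneg)
    then show ?thesis by (simp add: df_def divide_nonpos_nonneg)
  qed
  moreover have "0 \<le> (LINT z|(lborel \<Otimes>\<^sub>M lborel). - df u \<psi> z)"
    by (intro integral_nonneg_AE AE_I2 neg)
  ultimately have "(LINT z|(lborel \<Otimes>\<^sub>M lborel). - df u \<psi> z) = 0" by simp
  moreover have "integrable (lborel \<Otimes>\<^sub>M lborel) (\<lambda>z. - df u \<psi> z)" using \<psi>_int by simp
  ultimately have "AE z in lborel \<Otimes>\<^sub>M lborel. - df u \<psi> z = 0"
    using neg by (subst (asm) integral_nonneg_eq_0_iff_AE) auto
  then have "AE x in lborel. AE y in lborel. - df u \<psi> (x, y) = 0" by (rule lborel_pair.AE_pair)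
  then show ?thesis
  proof eventually_elim
    case (elim x)
    show ?case
    proof (intro impI)
      assume x: "x \<in> \<Omega>"
      \<comment> \<open>At a zero \<open>x\<close> in \<Omega> and any \<open>y\<close> with
        \<open>u y \<noteq> 0\<close> the integrand is a nonzero multiple of
        \<open>u y * \<eta> x\<close>. So a single such \<open>x\<close> would force
        \<open>u\<close> to vanish almost everywhere in space, against \<open>nz\<close>.\<close>
      have "u x \<noteq> 0"
      proof
        assume u0: "u x = 0"
        have "AE y in lborel. u y = 0"
          using elim
        proof eventually_elim
          case (elim y)
          show ?case
          proof (rule ccontr)
            assume uy: "u y \<noteq> 0"
            then have "x \<noteq> y" using u0 by auto
            then show False using elim u0 uy cutoff_pos[OF x] by (simp add: df_def \<psi>_def \<eta>_def)
          qed
        qed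
        then show False using nz by blast
      qed
      then show "0 < u x" using nonneg[of x] by simp
    qed
  qed
qed

end

section \<open>The derivative of the coupling term\<close>

text \<open>The point 0 is the delicate one: there the difference quotient has modulus
  \<open>\<bar>h\<bar> powr (p - 1)\<close>, which tends to 0 because \<open>p > 1\<close>.\<close>

lemma DERIV_abs_powr:
  fixes p x :: real
  assumes p: "1 < p"
  shows "((\<lambda>x. \<bar>x\<bar> powr p) has_real_derivative p * (sgn x * \<bar>x\<bar> powr (p - 1))) (at x)"
proof -
  consider "x > 0" | "x < 0" | "x = 0" by linarith
  then show ?thesis
  proof cases
    case 1
    have "((\<lambda>x. x powr p) has_real_derivative p * x powr (p - 1)) (at x)"
      using 1 by (rule has_real_derivative_powr)
    then have "((\<lambda>x. \<bar>x\<bar> powr p) has_real_derivative p * x powr (p - 1)) (at x)"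
      by (rule has_field_derivative_transform_within_open[of _ _ _ "{0<..}"]) (use 1 in auto)
    then show ?thesis using 1 by simp
  next
    case 2
    have "((\<lambda>x. (- x) powr p) has_real_derivative (p * (- x) powr (p - 1)) * (- 1)) (at x)"
      by (rule DERIV_chain2[OF has_real_derivative_powr]) (use 2 in \<open>auto intro!: derivative_eq_intros\<close>)
    then have "((\<lambda>x. \<bar>x\<bar> powr p) has_real_derivative (p * (- x) powr (p - 1)) * (- 1)) (at x)"
      by (rule has_field_derivative_transform_within_open[of _ _ _ "{..<0}"]) (use 2 in auto)
    then show ?thesis using 2 by simp
  next
    case 3
    have "((\<lambda>h. \<bar>h\<bar> powr (p - 1)) \<longlongrightarrow> \<bar>0\<bar> powr (p - 1)) (at (0::real))"
      using p by (intro tendsto_powr' tendsto_rabs tendsto_ident_at tendsto_const) auto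
    then have "((\<lambda>h. \<bar>h\<bar> powr (p - 1)) \<longlongrightarrow> 0) (at (0::real))" using p by simp
    then have "((\<lambda>h. \<bar>h\<bar> powr p / h) \<longlongrightarrow> 0) (at (0::real))"
    proof (rule tendsto_0_le[where K = 1], intro always_eventually allI)
      fix h :: real
      show "norm (\<bar>h\<bar> powr p / h) \<le> norm (\<bar>h\<bar> powr (p - 1)) * 1"
        by (cases "h = 0") (auto simp: powr_diff)
    qed
    then show ?thesis using 3 p by (simp add: has_field_derivative_iff)
  qed
qed

text \<open>The factors have total degree \<open>p + q\<close>. The bound serves both for the
  derivative of the coupling and for integrating the nonlinear terms against test functions.\<close>

lemma powr_product_bound:
  fixes p q S x y z :: real
  assumes "1 < p" "0 < q" "\<bar>x\<bar> \<le> S" "\<bar>y\<bar> \<le> S" "\<bar>z\<bar> \<le> S"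
  shows "\<bar>x\<bar> powr (p - 1) * \<bar>z\<bar> * \<bar>y\<bar> powr q \<le> S powr (p + q)"
proof -
  have S: "0 \<le> S" using assms by linarith
  have "\<bar>x\<bar> powr (p - 1) * \<bar>z\<bar> * \<bar>y\<bar> powr q \<le> S powr (p - 1) * S * S powr q"
    using assms S by (intro mult_mono powr_mono2) auto
  also have "\<dots> = S powr ((p - 1) + 1 + q)"
    using S by (simp only: powr_add powr_one)
  finally show ?thesis by simp
qed

text \<open>The second claim bounds the derivative independently of \<open>t\<close>, as needed to
  differentiate under the integral.\<close>

lemma coupling_pointwise_derivative:
  fixes p q u v f g t :: real
  assumes p: "1 < p" and q: "1 < q"
  defines "D \<equiv> \<lambda>t. p * (sgn (u + t * f) * \<bar>u + t * f\<bar> powr (p - 1) * f * \<bar>v + t * g\<bar> powr q)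
      + q * (sgn (v + t * g) * \<bar>v + t * g\<bar> powr (q - 1) * g * \<bar>u + t * f\<bar> powr p)"
  shows "((\<lambda>t. \<bar>u + t * f\<bar> powr p * \<bar>v + t * g\<bar> powr q) has_real_derivative D t) (at t)"
    and "\<bar>t\<bar> \<le> 1 \<Longrightarrow> \<bar>D t\<bar> \<le> (p + q) * (\<bar>u\<bar> + \<bar>v\<bar> + \<bar>f\<bar> + \<bar>g\<bar>) powr (p + q)"
proof -
  have 1: "((\<lambda>t. \<bar>u + t * f\<bar> powr p) has_real_derivative p * (sgn (u + t * f) * \<bar>u + t * f\<bar> powr (p - 1)) * f) (at t)"
    by (rule DERIV_chain2[OF DERIV_abs_powr[OF p]]) (auto intro!: derivative_eq_intros)
  have 2: "((\<lambda>t. \<bar>v + t * g\<bar> powr q) has_real_derivative q * (sgn (v + t * g) * \<bar>v + t * g\<bar> powr (q - 1)) * g) (at t)"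
    by (rule DERIV_chain2[OF DERIV_abs_powr[OF q]]) (auto intro!: derivative_eq_intros)
  from DERIV_mult[OF 1 2]
  show "((\<lambda>t. \<bar>u + t * f\<bar> powr p * \<bar>v + t * g\<bar> powr q) has_real_derivative D t) (at t)"
    by (simp add: D_def mult_ac)
  assume t: "\<bar>t\<bar> \<le> 1"
  define S where "S = \<bar>u\<bar> + \<bar>v\<bar> + \<bar>f\<bar> + \<bar>g\<bar>"
  have tf: "\<bar>t * f\<bar> \<le> \<bar>f\<bar>" "\<bar>t * g\<bar> \<le> \<bar>g\<bar>"
    using t by (auto simp: abs_mult mult_left_le_one_le)
  have le: "\<bar>u + t * f\<bar> \<le> S" "\<bar>v + t * g\<bar> \<le> S" "\<bar>f\<bar> \<le> S" "\<bar>g\<bar> \<le> S"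
    using tf unfolding S_def by linarith+
  have sgn: "\<bar>sgn a * b\<bar> \<le> \<bar>b\<bar>" for a b :: real by (simp add: sgn_if)
  have "\<bar>sgn (u + t * f) * \<bar>u + t * f\<bar> powr (p - 1) * f * \<bar>v + t * g\<bar> powr q\<bar> \<le> S powr (p + q)"
    using powr_product_bound[OF p _ le(1,2,3), of q] q sgn[of "u + t * f" "\<bar>u + t * f\<bar> powr (p - 1) * f * \<bar>v + t * g\<bar> powr q"]
    by (simp add: abs_mult mult.assoc)
  moreover have "\<bar>sgn (v + t * g) * \<bar>v + t * g\<bar> powr (q - 1) * g * \<bar>u + t * f\<bar> powr p\<bar> \<le> S powr (p + q)"
    using powr_product_bound[OF q _ le(2,1,4), of p] p sgn[of "v + t * g" "\<bar>v + t * g\<bar> powr (q - 1) * g * \<bar>u + t * f\<bar> powr p"]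
    by (simp add: abs_mult mult.assoc add.commute)
  ultimately have "\<bar>D t\<bar> \<le> p * S powr (p + q) + q * S powr (p + q)"
    unfolding D_def using p q
    by (intro order_trans[OF abs_triangle_ineq] add_mono) (simp_all add: abs_mult mult_left_mono)
  then show "\<bar>D t\<bar> \<le> (p + q) * (\<bar>u\<bar> + \<bar>v\<bar> + \<bar>f\<bar> + \<bar>g\<bar>) powr (p + q)"
    by (simp add: S_def distrib_right)
qed

text \<open>For \<open>\<bar>t\<bar> \<le> 1\<close> the mean value inequality bounds the difference
  quotients by \<open>p + q\<close> times the integrable function in \<open>int\<close>, so
  dominated convergence applies along every sequence tending to 0. The interval is dropped at the
  end because 0 is an interior point.\<close>

lemma coupling_integral_derivative:
  fixes p q :: real and u v f g :: "'b \<Rightarrow> real"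
  assumes p: "1 < p" and q: "1 < q"
    and [measurable]: "u \<in> borel_measurable M" "v \<in> borel_measurable M" "f \<in> borel_measurable M" "g \<in> borel_measurable M"
    and int: "integrable M (\<lambda>x. (\<bar>u x\<bar> + \<bar>v x\<bar> + \<bar>f x\<bar> + \<bar>g x\<bar>) powr (p + q))"
  defines "D \<equiv> \<lambda>x. p * (sgn (u x) * \<bar>u x\<bar> powr (p - 1) * f x * \<bar>v x\<bar> powr q)
      + q * (sgn (v x) * \<bar>v x\<bar> powr (q - 1) * g x * \<bar>u x\<bar> powr p)"
  shows "((\<lambda>t. LINT x|M. \<bar>u x + t * f x\<bar> powr p * \<bar>v x + t * g x\<bar> powr q) has_real_derivative (LINT x|M. D x)) (at 0)"
proof -
  define S where "S x = \<bar>u x\<bar> + \<bar>v x\<bar> + \<bar>f x\<bar> + \<bar>g x\<bar>" for x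
  define h where "h t x = \<bar>u x + t * f x\<bar> powr p * \<bar>v x + t * g x\<bar> powr q" for t x
  have [measurable]: "h t \<in> borel_measurable M" for t unfolding h_def[abs_def] by measurable
  have [measurable]: "D \<in> borel_measurable M" unfolding D_def by measurable
  have lip: "\<bar>h t x - h 0 x\<bar> \<le> (p + q) * S x powr (p + q) * \<bar>t\<bar>" if t: "\<bar>t\<bar> \<le> 1" for t x
  proof -
    have "norm (h t x - h 0 x) \<le> ((p + q) * S x powr (p + q)) * norm (t - 0)"
    proof (rule field_differentiable_bound[where S = "{-1..1}"])
      fix r :: real assume r: "r \<in> {-1..1}"
      show "((\<lambda>t. h t x) has_field_derivative p * (sgn (u x + r * f x) * \<bar>u x + r * f x\<bar> powr (p - 1) * f x * \<bar>v x + r * g x\<bar> powr q)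
          + q * (sgn (v x + r * g x) * \<bar>v x + r * g x\<bar> powr (q - 1) * g x * \<bar>u x + r * f x\<bar> powr p)) (at r within {-1..1})"
        unfolding h_def by (rule has_field_derivative_at_within[OF coupling_pointwise_derivative(1)[OF p q]])
      show "norm (p * (sgn (u x + r * f x) * \<bar>u x + r * f x\<bar> powr (p - 1) * f x * \<bar>v x + r * g x\<bar> powr q)
          + q * (sgn (v x + r * g x) * \<bar>v x + r * g x\<bar> powr (q - 1) * g x * \<bar>u x + r * f x\<bar> powr p))
          \<le> (p + q) * S x powr (p + q)"
        unfolding S_def real_norm_def by (rule coupling_pointwise_derivative(2)[OF p q]) (use r in auto)
    qed (use t in auto)
    then show ?thesis by simp
  qed
  have h0: "integrable M (h 0)"
  proof (rule Bochner_Integration.integrable_bound[OF int])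
    have "norm (h 0 x) \<le> norm ((\<bar>u x\<bar> + \<bar>v x\<bar> + \<bar>f x\<bar> + \<bar>g x\<bar>) powr (p + q))" for x
    proof -
      have "\<bar>u x\<bar> powr p * \<bar>v x\<bar> powr q \<le> S x powr p * S x powr q"
        using p q by (intro mult_mono powr_mono2) (auto simp: S_def)
      then show ?thesis by (simp add: h_def S_def powr_add)
    qed
    then show "AE x in M. norm (h 0 x) \<le> norm ((\<bar>u x\<bar> + \<bar>v x\<bar> + \<bar>f x\<bar> + \<bar>g x\<bar>) powr (p + q))" by simp
  qed simp
  have hint: "integrable M (h t)" if t: "\<bar>t\<bar> \<le> 1" for t
  proof (rule Bochner_Integration.integrable_bound)
    show "integrable M (\<lambda>x. \<bar>h 0 x\<bar> + (p + q) * S x powr (p + q))"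
      using h0 int by (simp add: S_def)
    have "norm (h t x) \<le> norm (\<bar>h 0 x\<bar> + (p + q) * S x powr (p + q))" for x
    proof -
      have "(p + q) * S x powr (p + q) * \<bar>t\<bar> \<le> (p + q) * S x powr (p + q) * 1"
        using t p q by (intro mult_left_mono) auto
      then have "\<bar>h t x - h 0 x\<bar> \<le> (p + q) * S x powr (p + q)" using lip[OF t, of x] by linarith
      then show ?thesis by simp
    qed
    then show "AE x in M. norm (h t x) \<le> norm (\<bar>h 0 x\<bar> + (p + q) * S x powr (p + q))" by simp
  qed simp
  have "((\<lambda>t. (integral\<^sup>L M (h t) - integral\<^sup>L M (h 0)) / (t - 0)) \<longlongrightarrow> (LINT x|M. D x)) (at 0 within {-1..1})"
    unfolding tendsto_at_iff_sequentially
  proof (intro allI impI)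
    fix X :: "nat \<Rightarrow> real"
    assume X: "\<forall>i. X i \<in> {-1..1} - {0}" and X0: "X \<longlonglongrightarrow> 0"
    have Xi: "\<bar>X i\<bar> \<le> 1" "X i \<noteq> 0" for i using X by (auto simp: abs_le_iff)
    have "(\<lambda>i. LINT x|M. (h (X i) x - h 0 x) / X i) \<longlonglongrightarrow> (LINT x|M. D x)"
    proof (rule integral_dominated_convergence)
      show "integrable M (\<lambda>x. (p + q) * S x powr (p + q))" using int by (simp add: S_def)
      have "(\<lambda>i. (h (X i) x - h 0 x) / X i) \<longlonglongrightarrow> D x" for x
      proof -
        have "((\<lambda>t. h t x) has_real_derivative D x) (at 0)"
          using coupling_pointwise_derivative(1)[OF p q, of "u x" "f x" "v x" "g x" 0]
          by (simp add: h_def D_def)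
        then have "((\<lambda>t. (h t x - h 0 x) / (t - 0)) \<longlongrightarrow> D x) (at 0)"
          by (simp only: has_field_derivative_iff)
        then have "((\<lambda>t. (h t x - h 0 x) / (t - 0)) \<circ> X) \<longlonglongrightarrow> D x"
          using X0 Xi(2) unfolding tendsto_at_iff_sequentially by auto
        then show ?thesis by (simp add: o_def)
      qed
      then show "AE x in M. (\<lambda>i. (h (X i) x - h 0 x) / X i) \<longlonglongrightarrow> D x" by simp
      show "AE x in M. norm ((h (X i) x - h 0 x) / X i) \<le> (p + q) * S x powr (p + q)" for i
        using lip[OF Xi(1)[of i]] Xi(2)[of i] by (simp add: abs_divide divide_le_eq)
    qed auto
    then show "((\<lambda>t. (integral\<^sup>L M (h t) - integral\<^sup>L M (h 0)) / (t - 0)) \<circ> X) \<longlonglongrightarrow> (LINT x|M. D x)"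
      using hint[OF Xi(1)] h0 by (simp add: o_def)
  qed
  then have "((\<lambda>t. integral\<^sup>L M (h t)) has_real_derivative (LINT x|M. D x)) (at 0 within {-1..1})"
    by (simp only: has_field_derivative_iff)
  moreover have "(0::real) \<in> interior {-1..1}" by simp
  ultimately show ?thesis unfolding h_def[abs_def] by (simp only: at_within_interior)
qed

lemma powr_tail_bound:
  fixes \<alpha> \<beta> \<delta> :: real
  assumes "0 < \<alpha>" "\<alpha> < \<beta>" "0 < \<delta>"
  obtains K where "0 \<le> K" "\<And>t. 0 \<le> t \<Longrightarrow> t powr \<alpha> \<le> \<delta> * t powr \<beta> + K"
proof
  \<comment> \<open>\<open>T\<close> solves
    \<open>\<delta> * T powr (\<beta> - \<alpha>) = 1\<close>; beyond it the higher power
    dominates.\<close>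
  define T where "T = (1 / \<delta>) powr (1 / (\<beta> - \<alpha>))"
  have T: "0 < T" using assms by (simp add: T_def)
  show "0 \<le> T powr \<alpha>" by simp
  fix t :: real assume t: "0 \<le> t"
  show "t powr \<alpha> \<le> \<delta> * t powr \<beta> + T powr \<alpha>"
  proof (cases "t \<le> T")
    case True
    then have "t powr \<alpha> \<le> T powr \<alpha>" using assms t by (intro powr_mono2) auto
    then show ?thesis using assms by (simp add: add_increasing)
  next
    case False
    have "1 / \<delta> = T powr (\<beta> - \<alpha>)" using assms by (simp add: T_def powr_powr)
    also have "\<dots> \<le> t powr (\<beta> - \<alpha>)" using False T assms by (intro powr_mono2) auto
    finally have "1 \<le> \<delta> * t powr (\<beta> - \<alpha>)" using assms by (simp add: divide_le_eq mult.commute)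
    from mult_right_mono[OF this, of "t powr \<alpha>"]
    have "t powr \<alpha> \<le> \<delta> * (t powr (\<beta> - \<alpha>) * t powr \<alpha>)" by (simp add: mult.assoc)
    then have "t powr \<alpha> \<le> \<delta> * t powr \<beta>" by (simp add: powr_add[symmetric])
    then show ?thesis using powr_ge_zero[of T \<alpha>] by linarith
  qed
qed

section \<open>The variational problem\<close>

context frac_domain
begin

section \<open>The Rayleigh bound and limits of subcritical integrals\<close>

lemma first_eigenvalue_le:
  assumes u: "u \<in> \<X>"
  shows "first_eigenvalue s \<Omega> * (LINT x|lborel. (u x)\<^sup>2) \<le> \<E> u u"
proof (cases "AE x in lborel. u x = 0")
  case True
  then have "(LINT x|lborel. (u x)\<^sup>2) = 0"
    by (intro integral_eq_zero_AE) (auto elim: eventually_mono)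
  then show ?thesis by simp
next
  case False
  define R where "R u = enn2real (gagliardo_sq s u) / (LINT x|lborel. (u x)\<^sup>2)" for u :: "'a \<Rightarrow> real"
  have "first_eigenvalue s \<Omega> \<le> R u"
    unfolding first_eigenvalue_def R_def[symmetric]
  proof (rule cINF_lower)
    show "bdd_below (R ` {u \<in> \<X>. \<not> (AE x in lborel. u x = 0)})"
      by (rule bdd_belowI[of _ 0]) (auto simp: R_def)
  qed (use u False in simp)
  also have "R u = \<E> u u / (LINT x|lborel. (u x)\<^sup>2)"
    by (simp add: R_def gagliardo_sq_Hs[OF X_Hs[OF u]])
  finally have le: "first_eigenvalue s \<Omega> \<le> \<E> u u / (LINT x|lborel. (u x)\<^sup>2)" .
  have "(LINT x|lborel. (u x)\<^sup>2) \<noteq> 0"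
    using False integral_nonneg_eq_0_iff_AE[OF X_square_integrable[OF u]] by simp
  then have "0 < (LINT x|lborel. (u x)\<^sup>2)" by (simp add: order_less_le)
  then show ?thesis using le by (simp add: pos_le_divide_eq)
qed

lemma X_product_integrable:
  assumes u: "u \<in> \<X>" and v: "v \<in> \<X>"
  shows "integrable lborel (\<lambda>x. u x * v x)"
proof (rule Bochner_Integration.integrable_bound)
  show "integrable lborel (\<lambda>x. (u x)\<^sup>2 + (v x)\<^sup>2)"
    using X_square_integrable[OF u] X_square_integrable[OF v] by simp
  have "norm (u x * v x) \<le> norm ((u x)\<^sup>2 + (v x)\<^sup>2)" for x
  proof -
    have "2 * \<bar>u x * v x\<bar> \<le> (u x)\<^sup>2 + (v x)\<^sup>2"
      using sum_squares_bound[of "\<bar>u x\<bar>" "\<bar>v x\<bar>"] by (simp add: abs_mult mult.assoc)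
    then show ?thesis by simp
  qed
  then show "AE x in lborel. norm (u x * v x) \<le> norm ((u x)\<^sup>2 + (v x)\<^sup>2)" by simp
qed (use X_measurable[OF u] X_measurable[OF v] in measurable)

lemma X_powr_integrable:
  assumes u: "u \<in> \<X>" and \<alpha>: "2 \<le> \<alpha>" "\<alpha> \<le> crit"
  shows "integrable lborel (\<lambda>x. \<bar>u x\<bar> powr \<alpha>)"
proof (rule Bochner_Integration.integrable_bound)
  show "integrable lborel (\<lambda>x. (u x)\<^sup>2 + \<bar>u x\<bar> powr crit)"
    using X_square_integrable[OF u] sobolev(1)[OF X_Hs[OF u]] by simp
  have "\<bar>u x\<bar> powr \<alpha> \<le> (u x)\<^sup>2 + \<bar>u x\<bar> powr crit" for x
  proof (cases "\<bar>u x\<bar> \<le> 1")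
    case True
    have "\<bar>u x\<bar> powr \<alpha> \<le> \<bar>u x\<bar> powr 2" using True \<alpha> by (intro powr_mono') auto
    then have "\<bar>u x\<bar> powr \<alpha> \<le> (u x)\<^sup>2" by simp
    then show ?thesis by (simp add: add_increasing2)
  next
    case False
    then have "\<bar>u x\<bar> powr \<alpha> \<le> \<bar>u x\<bar> powr crit" using \<alpha> by (intro powr_mono) auto
    then show ?thesis by (simp add: add_increasing)
  qed
  then show "AE x in lborel. norm (\<bar>u x\<bar> powr \<alpha>) \<le> norm ((u x)\<^sup>2 + \<bar>u x\<bar> powr crit)" by simp
qed (use X_measurable[OF u] in measurable)

text \<open>Plays the part of the compact embedding into Lebesgue spaces: since
  \<open>\<alpha> < crit\<close>, the growth bound is at most \<open>\<delta>\<close> times the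
  critical powers plus a constant, and the Sobolev inequality bounds the integrals of those powers
  by the energies.\<close>

lemma tendsto_integral_composition:
  fixes F :: "real \<Rightarrow> real \<Rightarrow> real"
  assumes u: "\<And>n. u n \<in> \<X>" "\<And>n. \<E> (u n) (u n) \<le> C" and v: "\<And>n. v n \<in> \<X>" "\<And>n. \<E> (v n) (v n) \<le> C"
    and lim: "AE x in lborel. (\<lambda>n. u n x) \<longlonglongrightarrow> u' x" "AE x in lborel. (\<lambda>n. v n x) \<longlonglongrightarrow> v' x"
    and meas: "u' \<in> borel_measurable borel" "v' \<in> borel_measurable borel"
    and F: "continuous_on UNIV (\<lambda>z. F (fst z) (snd z))" "\<And>x y. 0 \<le> F x y"
    and growth: "\<And>x y. F x y \<le> \<bar>x\<bar> powr \<alpha> + \<bar>y\<bar> powr \<alpha>" and \<alpha>: "0 < \<alpha>" "\<alpha> < crit"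
  shows "(\<lambda>n. LINT x|lborel. F (u n x) (v n x)) \<longlonglongrightarrow> (LINT x|lborel. F (u' x) (v' x))"
proof -
  define H where "H n x = \<bar>u n x\<bar> powr crit + \<bar>v n x\<bar> powr crit" for n x
  define B where "B = (sobolev_K / \<kappa> * C) powr (crit / 2)"
  have bd: "(LINT x|lborel. \<bar>w x\<bar> powr crit) \<le> B" if "w \<in> \<X>" "\<E> w w \<le> C" for w
    unfolding B_def using that(2) sobolev_K_pos \<kappa>_pos crit_gt_2
    by (intro order_trans[OF sobolev(2)[OF X_Hs[OF that(1)]]] powr_mono2 mult_left_mono) auto
  have F_meas: "(\<lambda>x. F (f x) (g x)) \<in> borel_measurable lborel"
    if "f \<in> borel_measurable borel" "g \<in> borel_measurable borel" for f g :: "'a \<Rightarrow> real"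
    using measurable_compose[OF borel_measurable_Pair[OF that] borel_measurable_continuous_onI[OF F(1)]]
    by simp
  show ?thesis
  proof (rule tendsto_integral_of_uniform_tail(3)[where H = H and C = "B + B" and A = \<Omega>])
    show "(\<lambda>x. F (u n x) (v n x)) \<in> borel_measurable lborel" for n
      by (intro F_meas X_measurable u(1) v(1))
    show "(\<lambda>x. F (u' x) (v' x)) \<in> borel_measurable lborel"
      by (intro F_meas meas)
    show "AE x in lborel. (\<lambda>n. F (u n x) (v n x)) \<longlonglongrightarrow> F (u' x) (v' x)"
      using lim
    proof eventually_elim
      case (elim x)
      have "(\<lambda>n. (u n x, v n x)) \<longlonglongrightarrow> (u' x, v' x)" using elim by (rule tendsto_Pair)
      from continuous_on_tendsto_compose[OF F(1) this] show ?case by simp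
    qed
    show "AE x in lborel. x \<notin> \<Omega> \<longrightarrow> F (u n x) (v n x) = 0" for n
      using X_zero_AE[OF u(1)[of n]] X_zero_AE[OF v(1)[of n]]
    proof eventually_elim
      case (elim x)
      then show ?case using growth[of 0 0] F(2)[of 0 0] \<alpha> by auto
    qed
    show "integrable lborel (H n)" for n
      unfolding H_def using sobolev(1)[OF X_Hs[OF u(1)]] sobolev(1)[OF X_Hs[OF v(1)]] by simp
    show "integral\<^sup>L lborel (H n) \<le> B + B" for n
      unfolding H_def using sobolev(1)[OF X_Hs[OF u(1)]] sobolev(1)[OF X_Hs[OF v(1)]]
        add_mono[OF bd[OF u(1)[of n] u(2)[of n]] bd[OF v(1)[of n] v(2)[of n]]] by simp
    show "\<exists>K. \<forall>n x. F (u n x) (v n x) \<le> \<delta> * H n x + K" if \<delta>: "0 < \<delta>" for \<delta>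
    proof -
      obtain K where K: "0 \<le> K" "\<And>t. 0 \<le> t \<Longrightarrow> t powr \<alpha> \<le> \<delta> * t powr crit + K"
        by (rule powr_tail_bound[OF \<alpha> \<delta>]) blast
      have "F (u n x) (v n x) \<le> \<delta> * H n x + (K + K)" for n x
        using growth[of "u n x" "v n x"] K(2)[of "\<bar>u n x\<bar>"] K(2)[of "\<bar>v n x\<bar>"]
        by (simp add: H_def distrib_left)
      then show ?thesis by blast
    qed
  qed (use F emeasure_\<Omega>_finite in \<open>auto simp: H_def\<close>)
qed

end

text \<open>The matrix enters only through its quadratic form; \<open>\<mu>\<close> stands for its
  largest eigenvalue.\<close>

locale frac_system = frac_domain s \<Omega>
  for s :: real and \<Omega> :: "'a::euclidean_space set" +
  fixes p q a b c \<mu> :: real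
  assumes p_gt_1: "1 < p" and q_gt_1: "1 < q" and b_nonneg: "0 \<le> b" and subcritical: "p + q < crit"
    and quadratic_form_le: "\<And>x y. a * x\<^sup>2 + 2 * b * x * y + c * y\<^sup>2 \<le> \<mu> * (x\<^sup>2 + y\<^sup>2)"
    and \<mu>_less: "\<mu> < first_eigenvalue s \<Omega>" and \<Omega>_nonempty: "\<Omega> \<noteq> {}"
begin

definition L :: "('a \<Rightarrow> real) \<Rightarrow> ('a \<Rightarrow> real) \<Rightarrow> ('a \<Rightarrow> real) \<Rightarrow> ('a \<Rightarrow> real) \<Rightarrow> real" where
  "L u v \<phi> \<psi> = (LINT x|lborel. a * (u x * \<phi> x) + b * (u x * \<psi> x) + b * (v x * \<phi> x) + c * (v x * \<psi> x))"

definition Q :: "('a \<Rightarrow> real) \<Rightarrow> ('a \<Rightarrow> real) \<Rightarrow> real" where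
  "Q u v = \<E> u u + \<E> v v - L u v u v"

definition G :: "('a \<Rightarrow> real) \<Rightarrow> ('a \<Rightarrow> real) \<Rightarrow> real" where
  "G u v = (LINT x|lborel. \<bar>u x\<bar> powr p * \<bar>v x\<bar> powr q)"

lemma L_eq:
  assumes "u \<in> \<X>" "v \<in> \<X>" "\<phi> \<in> \<X>" "\<psi> \<in> \<X>"
  shows "L u v \<phi> \<psi> = a * (LINT x|lborel. u x * \<phi> x) + b * (LINT x|lborel. u x * \<psi> x)
    + b * (LINT x|lborel. v x * \<phi> x) + c * (LINT x|lborel. v x * \<psi> x)"
  unfolding L_def by (simp add: X_product_integrable assms)

lemma L_le:
  assumes u: "u \<in> \<X>" and v: "v \<in> \<X>"
  shows "L u v u v \<le> \<mu> * ((LINT x|lborel. (u x)\<^sup>2) + (LINT x|lborel. (v x)\<^sup>2))"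
proof -
  have "L u v u v \<le> (LINT x|lborel. \<mu> * ((u x)\<^sup>2 + (v x)\<^sup>2))"
    unfolding L_def
  proof (rule integral_mono)
    show "a * (u x * u x) + b * (u x * v x) + b * (v x * u x) + c * (v x * v x) \<le> \<mu> * ((u x)\<^sup>2 + (v x)\<^sup>2)" for x
      using quadratic_form_le[of "u x" "v x"] by (simp add: power2_eq_square algebra_simps)
  qed (use u v in \<open>auto simp: X_product_integrable X_square_integrable\<close>)
  also have "\<dots> = \<mu> * ((LINT x|lborel. (u x)\<^sup>2) + (LINT x|lborel. (v x)\<^sup>2))"
    using u v by (simp add: X_square_integrable)
  finally show ?thesis .
qed

text \<open>The sign of \<open>\<mu>\<close> decides: multiplying the Rayleigh inequality by
  \<open>\<mu>\<close> preserves it only for nonnegative \<open>\<mu>\<close>, giving the constant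
  \<open>1 - \<mu> / l1\<close>. For \<open>\<mu> \<le> 0\<close> the zero-order part already helps
  and the constant is 1.\<close>

lemma Q_coercive:
  obtains \<theta> where "0 < \<theta>" "\<And>u v. u \<in> \<X> \<Longrightarrow> v \<in> \<X> \<Longrightarrow> \<theta> * (\<E> u u + \<E> v v) \<le> Q u v"
proof (cases "\<mu> \<le> 0")
  case True
  show ?thesis
  proof (rule that[of 1])
    fix u v assume uv: "u \<in> \<X>" "v \<in> \<X>"
    have "\<mu> * ((LINT x|lborel. (u x)\<^sup>2) + (LINT x|lborel. (v x)\<^sup>2)) \<le> 0"
      using True by (intro mult_nonpos_nonneg add_nonneg_nonneg) auto
    then show "1 * (\<E> u u + \<E> v v) \<le> Q u v" using L_le[OF uv] by (simp add: Q_def)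
  qed simp
next
  case False
  define l1 where "l1 = first_eigenvalue s \<Omega>"
  have l1: "0 < l1" "\<mu> < l1" using False \<mu>_less by (auto simp: l1_def)
  show ?thesis
  proof (rule that[of "1 - \<mu> / l1"])
    show "0 < 1 - \<mu> / l1" using l1 by simp
    fix u v assume uv: "u \<in> \<X>" "v \<in> \<X>"
    have "(LINT x|lborel. (w x)\<^sup>2) \<le> \<E> w w / l1" if "w \<in> \<X>" for w
      using first_eigenvalue_le[OF that] l1(1) by (simp add: l1_def[symmetric] pos_le_divide_eq mult.commute)
    from this[OF uv(1)] this[OF uv(2)]
    have "(LINT x|lborel. (u x)\<^sup>2) + (LINT x|lborel. (v x)\<^sup>2) \<le> (\<E> u u + \<E> v v) / l1"
      by (simp add: add_divide_distrib)
    then have "\<mu> * ((LINT x|lborel. (u x)\<^sup>2) + (LINT x|lborel. (v x)\<^sup>2)) \<le> \<mu> * ((\<E> u u + \<E> v v) / l1)"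
      using False by (intro mult_left_mono) auto
    then show "(1 - \<mu> / l1) * (\<E> u u + \<E> v v) \<le> Q u v"
      using L_le[OF uv] by (simp add: Q_def left_diff_distrib)
  qed
qed

lemma Q_nonneg:
  assumes "u \<in> \<X>" "v \<in> \<X>"
  shows "0 \<le> Q u v"
proof -
  obtain \<theta> where "0 < \<theta>" "\<theta> * (\<E> u u + \<E> v v) \<le> Q u v" using assms Q_coercive by metis
  moreover from this have "0 \<le> \<theta> * (\<E> u u + \<E> v v)" by (intro mult_nonneg_nonneg add_nonneg_nonneg) auto
  ultimately show ?thesis by linarith
qed

lemma Q_abs_le:
  assumes u: "u \<in> \<X>" and v: "v \<in> \<X>"
  shows "Q (\<lambda>x. \<bar>u x\<bar>) (\<lambda>x. \<bar>v x\<bar>) \<le> Q u v"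
proof -
  have E_abs: "\<E> (\<lambda>x. \<bar>w x\<bar>) (\<lambda>x. \<bar>w x\<bar>) \<le> \<E> w w" if "w \<in> \<X>" for w
    by (rule X_inner_self_mono[OF X_Hs[OF that] X_Hs[OF X_abs[OF that]]]) (rule abs_triangle_ineq3)
  have "L u v u v \<le> L (\<lambda>x. \<bar>u x\<bar>) (\<lambda>x. \<bar>v x\<bar>) (\<lambda>x. \<bar>u x\<bar>) (\<lambda>x. \<bar>v x\<bar>)"
    unfolding L_def
  proof (rule integral_mono)
    fix x
    have "b * (u x * v x) \<le> b * (\<bar>u x\<bar> * \<bar>v x\<bar>)" "b * (v x * u x) \<le> b * (\<bar>v x\<bar> * \<bar>u x\<bar>)"
      using b_nonneg by (auto intro!: mult_left_mono simp: abs_mult[symmetric])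
    then show "a * (u x * u x) + b * (u x * v x) + b * (v x * u x) + c * (v x * v x)
        \<le> a * (\<bar>u x\<bar> * \<bar>u x\<bar>) + b * (\<bar>u x\<bar> * \<bar>v x\<bar>) + b * (\<bar>v x\<bar> * \<bar>u x\<bar>) + c * (\<bar>v x\<bar> * \<bar>v x\<bar>)"
      by simp
  qed (use u v X_abs[OF u] X_abs[OF v] in \<open>auto intro!: X_product_integrable Bochner_Integration.integrable_add integrable_mult_right\<close>)
  then show ?thesis using E_abs[OF u] E_abs[OF v] unfolding Q_def by linarith
qed

lemma Q_scale: "Q (\<lambda>x. t * u x) (\<lambda>x. t * v x) = t\<^sup>2 * Q u v"
proof -
  have "\<E> (\<lambda>x. t * w x) (\<lambda>x. t * w x) = t\<^sup>2 * \<E> w w" for w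
  proof -
    have "df (\<lambda>x. t * w x) (\<lambda>x. t * w x) z = t\<^sup>2 * df w w z" for z
      by (simp add: df_self right_diff_distrib[symmetric] power_mult_distrib)
    then show ?thesis by (simp add: X_inner_eq)
  qed
  moreover have "L (\<lambda>x. t * u x) (\<lambda>x. t * v x) (\<lambda>x. t * u x) (\<lambda>x. t * v x) = t\<^sup>2 * L u v u v"
    unfolding L_def integral_mult_right_zero[symmetric]
    by (intro Bochner_Integration.integral_cong) (auto simp: power2_eq_square algebra_simps)
  ultimately show ?thesis by (simp add: Q_def algebra_simps)
qed

lemma G_scale: "0 \<le> t \<Longrightarrow> G (\<lambda>x. t * u x) (\<lambda>x. t * v x) = t powr (p + q) * G u v"
  unfolding G_def integral_mult_right_zero[symmetric]
  by (intro Bochner_Integration.integral_cong) (auto simp: abs_mult powr_mult powr_add mult_ac)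

lemma G_nonneg: "0 \<le> G u v"
  by (simp add: G_def)

text \<open>One element of \<open>\<X>\<close> majorizes every function occurring in the coupling
  and its derivative, so a single power of it dominates all the products.\<close>

lemma X_coupling_integrable:
  assumes u: "u \<in> \<X>" and v: "v \<in> \<X>" and f: "f \<in> \<X>" and g: "g \<in> \<X>"
  shows "integrable lborel (\<lambda>x. (\<bar>u x\<bar> + \<bar>v x\<bar> + \<bar>f x\<bar> + \<bar>g x\<bar>) powr (p + q))"
proof -
  have "(\<lambda>x. \<bar>u x\<bar> + \<bar>v x\<bar> + \<bar>f x\<bar> + \<bar>g x\<bar>) \<in> \<X>" by (intro X_add X_abs assms)
  then have "integrable lborel (\<lambda>x. \<bar>\<bar>u x\<bar> + \<bar>v x\<bar> + \<bar>f x\<bar> + \<bar>g x\<bar>\<bar> powr (p + q))"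
    using p_gt_1 q_gt_1 subcritical by (intro X_powr_integrable) auto
  moreover have "\<bar>\<bar>u x\<bar> + \<bar>v x\<bar> + \<bar>f x\<bar> + \<bar>g x\<bar>\<bar> = \<bar>u x\<bar> + \<bar>v x\<bar> + \<bar>f x\<bar> + \<bar>g x\<bar>" for x by simp
  ultimately show ?thesis by simp
qed

lemma nonlinear_term_integrable:
  assumes u: "u \<in> \<X>" and v: "v \<in> \<X>" and f: "f \<in> \<X>"
  shows "integrable lborel (\<lambda>x. \<bar>u x\<bar> powr (p - 1) * f x * \<bar>v x\<bar> powr q)"
    and "integrable lborel (\<lambda>x. \<bar>v x\<bar> powr (q - 1) * f x * \<bar>u x\<bar> powr p)"
proof -
  have [measurable]: "u \<in> borel_measurable borel" "v \<in> borel_measurable borel" "f \<in> borel_measurable borel"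
    using assms[THEN X_measurable] by auto
  note S = X_coupling_integrable[OF u v f f]
  show "integrable lborel (\<lambda>x. \<bar>u x\<bar> powr (p - 1) * f x * \<bar>v x\<bar> powr q)"
  proof (rule Bochner_Integration.integrable_bound[OF S])
    have "norm (\<bar>u x\<bar> powr (p - 1) * f x * \<bar>v x\<bar> powr q) \<le> norm ((\<bar>u x\<bar> + \<bar>v x\<bar> + \<bar>f x\<bar> + \<bar>f x\<bar>) powr (p + q))" for x
      using powr_product_bound[of p q "u x" "\<bar>u x\<bar> + \<bar>v x\<bar> + \<bar>f x\<bar> + \<bar>f x\<bar>" "v x" "f x"] p_gt_1 q_gt_1
      by (simp add: abs_mult)
    then show "AE x in lborel. norm (\<bar>u x\<bar> powr (p - 1) * f x * \<bar>v x\<bar> powr q) \<le> norm ((\<bar>u x\<bar> + \<bar>v x\<bar> + \<bar>f x\<bar> + \<bar>f x\<bar>) powr (p + q))"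
      by simp
  qed measurable
  show "integrable lborel (\<lambda>x. \<bar>v x\<bar> powr (q - 1) * f x * \<bar>u x\<bar> powr p)"
  proof (rule Bochner_Integration.integrable_bound[OF S])
    have "norm (\<bar>v x\<bar> powr (q - 1) * f x * \<bar>u x\<bar> powr p) \<le> norm ((\<bar>u x\<bar> + \<bar>v x\<bar> + \<bar>f x\<bar> + \<bar>f x\<bar>) powr (p + q))" for x
      using powr_product_bound[of q p "v x" "\<bar>u x\<bar> + \<bar>v x\<bar> + \<bar>f x\<bar> + \<bar>f x\<bar>" "u x" "f x"] p_gt_1 q_gt_1
      by (simp add: abs_mult add.commute[of q p])
    then show "AE x in lborel. norm (\<bar>v x\<bar> powr (q - 1) * f x * \<bar>u x\<bar> powr p) \<le> norm ((\<bar>u x\<bar> + \<bar>v x\<bar> + \<bar>f x\<bar> + \<bar>f x\<bar>) powr (p + q))"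
      by simp
  qed measurable
qed

lemma G_integrable:
  assumes u: "u \<in> \<X>" and v: "v \<in> \<X>"
  shows "integrable lborel (\<lambda>x. \<bar>u x\<bar> powr p * \<bar>v x\<bar> powr q)"
proof -
  have "\<bar>u x\<bar> powr p = \<bar>u x\<bar> powr (p - 1) * \<bar>u x\<bar>" for x
    by (cases "u x = 0") (simp_all add: powr_diff)
  then show ?thesis using nonlinear_term_integrable(1)[OF u v X_abs[OF u]] by simp
qed

section \<open>The constrained minimum\<close>

lemma admissible_pair_exists: "\<exists>u\<in>\<X>. \<exists>v\<in>\<X>. G u v = 1"
proof -
  define g where "g = G cutoff cutoff"
  have "g \<noteq> 0"
  proof
    assume "g = 0"
    then have "AE x in lborel. \<bar>cutoff x\<bar> powr p * \<bar>cutoff x\<bar> powr q = 0"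
      using G_integrable[OF cutoff_in_X cutoff_in_X]
      by (subst (asm) g_def, subst (asm) G_def, subst (asm) integral_nonneg_eq_0_iff_AE) auto
    then have "AE x in lborel. x \<notin> \<Omega>"
      by eventually_elim (use cutoff_pos in force)
    then have "emeasure lborel \<Omega> = 0"
      by (subst (asm) AE_iff_measurable[where N = \<Omega>]) auto
    moreover obtain x e where "0 < e" "ball x e \<subseteq> \<Omega>"
      using \<Omega>_nonempty open_\<Omega> by (metis ex_in_conv open_contains_ball)
    ultimately have "emeasure lborel (ball x e) = 0"
      by (metis \<Omega>_measurable emeasure_mono le_zero_eq sets_lborel)
    then have "measure lborel (ball x e) = 0" by (simp add: measure_def)
    then show False using \<open>0 < e\<close> by simp
  qed
  then have g: "0 < g" using G_nonneg[of cutoff cutoff] by (simp add: g_def)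
  define t where "t = (1 / g) powr (1 / (p + q))"
  have "G (\<lambda>x. t * cutoff x) (\<lambda>x. t * cutoff x) = 1"
    using g p_gt_1 q_gt_1 by (simp add: G_scale t_def g_def[symmetric] powr_powr)
  then show ?thesis using X_scale[OF cutoff_in_X] by blast
qed

text \<open>Gives strict positivity of the minimum: coercivity annihilates the energies, the Sobolev
  inequality then annihilates \<open>u\<close> almost everywhere, and with it the coupling.\<close>

lemma Q_eq_0_imp_G_eq_0:
  assumes u: "u \<in> \<X>" and v: "v \<in> \<X>" and Q0: "Q u v \<le> 0"
  shows "G u v = 0"
proof -
  obtain \<theta> where \<theta>: "0 < \<theta>" "\<theta> * (\<E> u u + \<E> v v) \<le> Q u v" using u v Q_coercive by metis
  then have "\<theta> * (\<E> u u + \<E> v v) \<le> 0" using Q0 by linarith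
  then have "\<E> u u + \<E> v v \<le> 0" using \<theta>(1) by (simp add: mult_le_0_iff)
  moreover have "0 \<le> \<E> u u" "0 \<le> \<E> v v" by simp_all
  ultimately have "\<E> u u = 0" by linarith
  then have "(LINT x|lborel. \<bar>u x\<bar> powr crit) \<le> 0"
    using sobolev(2)[OF X_Hs[OF u]] by simp
  then have "(LINT x|lborel. \<bar>u x\<bar> powr crit) = 0" by (simp add: antisym)
  then have "AE x in lborel. \<bar>u x\<bar> powr crit = 0"
    using sobolev(1)[OF X_Hs[OF u]] by (subst (asm) integral_nonneg_eq_0_iff_AE) auto
  then have "AE x in lborel. \<bar>u x\<bar> powr p * \<bar>v x\<bar> powr q = 0"
    by eventually_elim simp
  then show ?thesis unfolding G_def by (rule integral_eq_zero_AE)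
qed

lemma coupling_continuous: "continuous_on UNIV (\<lambda>z. \<bar>fst z\<bar> powr p * \<bar>snd z\<bar> powr q :: real)"
  using p_gt_1 q_gt_1 by (intro continuous_intros continuous_on_powr') auto

lemma coupling_growth: "\<bar>x\<bar> powr p * \<bar>y\<bar> powr q \<le> \<bar>x\<bar> powr (p + q) + \<bar>y\<bar> powr (p + q)" for x y :: real
proof -
  define m where "m = max \<bar>x\<bar> \<bar>y\<bar>"
  have "\<bar>x\<bar> powr p * \<bar>y\<bar> powr q \<le> m powr p * m powr q"
    using p_gt_1 q_gt_1 by (intro mult_mono powr_mono2) (auto simp: m_def)
  also have "\<dots> = m powr (p + q)" by (simp add: powr_add)
  also have "\<dots> \<le> \<bar>x\<bar> powr (p + q) + \<bar>y\<bar> powr (p + q)" by (auto simp: m_def max_def)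
  finally show ?thesis .
qed

lemma minimizer_exists:
  obtains u v m where "u \<in> \<X>" "v \<in> \<X>" "\<And>x. 0 \<le> u x" "\<And>x. 0 \<le> v x" "G u v = 1" "Q u v = m" "0 < m"
    "\<And>w z. w \<in> \<X> \<Longrightarrow> z \<in> \<X> \<Longrightarrow> G w z = 1 \<Longrightarrow> m \<le> Q w z"
proof -
  define A where "A = {(u, v). u \<in> \<X> \<and> v \<in> \<X> \<and> G u v = 1}"
  define m where "m = (INF (u, v)\<in>A. Q u v)"
  have A_ne: "A \<noteq> {}" using admissible_pair_exists by (auto simp: A_def)
  have bdd: "bdd_below ((\<lambda>(u, v). Q u v) ` A)"
    by (rule bdd_belowI[of _ 0]) (auto simp: A_def Q_nonneg)
  have m_le: "m \<le> Q w z" if "w \<in> \<X>" "z \<in> \<X>" "G w z = 1" for w z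
  proof -
    have "(INF y\<in>A. (\<lambda>(u, v). Q u v) y) \<le> (\<lambda>(u, v). Q u v) (w, z)"
      by (rule cINF_lower[OF bdd]) (use that in \<open>simp add: A_def\<close>)
    then show ?thesis by (simp add: m_def)
  qed
  have "\<exists>w z. w \<in> \<X> \<and> z \<in> \<X> \<and> (\<forall>x. 0 \<le> w x) \<and> (\<forall>x. 0 \<le> z x) \<and> G w z = 1 \<and> Q w z \<le> m + 1 / real (Suc n)" for n
  proof -
    have "(INF y\<in>A. (\<lambda>(u, v). Q u v) y) < m + 1 / real (Suc n)" unfolding m_def[symmetric] by simp
    then obtain w z where wz: "(w, z) \<in> A" "Q w z < m + 1 / real (Suc n)"
      by (subst (asm) cINF_less_iff[OF A_ne bdd]) auto
    then have X: "w \<in> \<X>" "z \<in> \<X>" "G w z = 1" by (auto simp: A_def)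
    have "G (\<lambda>x. \<bar>w x\<bar>) (\<lambda>x. \<bar>z x\<bar>) = 1" using X(3) by (simp add: G_def)
    then show ?thesis
      using X_abs[OF X(1)] X_abs[OF X(2)] Q_abs_le[OF X(1,2)] wz(2)
      by (intro exI[of _ "\<lambda>x. \<bar>w x\<bar>"] exI[of _ "\<lambda>x. \<bar>z x\<bar>"]) auto
  qed
  then obtain U V where UV: "\<And>n. U n \<in> \<X>" "\<And>n. V n \<in> \<X>" "\<And>n x. 0 \<le> U n x" "\<And>n x. 0 \<le> V n x"
      "\<And>n. G (U n) (V n) = 1" "\<And>n. Q (U n) (V n) \<le> m + 1 / real (Suc n)"
    by metis
  obtain \<theta> where \<theta>: "0 < \<theta>" "\<And>u v. u \<in> \<X> \<Longrightarrow> v \<in> \<X> \<Longrightarrow> \<theta> * (\<E> u u + \<E> v v) \<le> Q u v"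
    using Q_coercive by metis
  define C where "C = (m + 1) / \<theta>"
  have EUV: "\<E> (U n) (U n) + \<E> (V n) (V n) \<le> C" for n
  proof -
    have "\<theta> * (\<E> (U n) (U n) + \<E> (V n) (V n)) \<le> m + 1 / real (Suc n)"
      using \<theta>(2)[OF UV(1,2)] UV(6) by (rule order_trans)
    also have "\<dots> \<le> m + 1" by simp
    finally show ?thesis using \<theta>(1) by (simp add: C_def pos_le_divide_eq mult.commute)
  qed
  have EC: "\<E> (U n) (U n) \<le> C" "\<E> (V n) (V n) \<le> C" for n
    using EUV[of n] X_inner_self_nonneg[of "U n"] X_inner_self_nonneg[of "V n"] by linarith+
  obtain \<sigma> u L1 where \<sigma>: "strict_mono \<sigma>" "u \<in> \<X>" "AE x in lborel. (\<lambda>n. U (\<sigma> n) x) \<longlonglongrightarrow> u x"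
      "(\<lambda>n. \<E> (U (\<sigma> n)) (U (\<sigma> n))) \<longlonglongrightarrow> L1" "\<E> u u \<le> L1"
    by (rule compactness[OF UV(1) EC(1)])
  obtain \<tau> v L2 where \<tau>: "strict_mono \<tau>" "v \<in> \<X>" "AE x in lborel. (\<lambda>n. V (\<sigma> (\<tau> n)) x) \<longlonglongrightarrow> v x"
      "(\<lambda>n. \<E> (V (\<sigma> (\<tau> n))) (V (\<sigma> (\<tau> n)))) \<longlonglongrightarrow> L2" "\<E> v v \<le> L2"
    by (rule compactness[OF UV(2)[of "\<sigma> _"] EC(2)[of "\<sigma> _"]])
  define \<rho> where "\<rho> n = \<sigma> (\<tau> n)" for n
  have \<rho>: "strict_mono \<rho>" using \<sigma>(1) \<tau>(1) by (simp add: strict_mono_def \<rho>_def)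
  have u_lim: "AE x in lborel. (\<lambda>n. U (\<rho> n) x) \<longlonglongrightarrow> u x"
    using \<sigma>(3)
  proof eventually_elim
    case (elim x)
    show ?case using LIMSEQ_subseq_LIMSEQ[OF elim \<tau>(1)] by (simp add: o_def \<rho>_def)
  qed
  have v_lim: "AE x in lborel. (\<lambda>n. V (\<rho> n) x) \<longlonglongrightarrow> v x" using \<tau>(3) by (simp add: \<rho>_def)
  have EU: "(\<lambda>n. \<E> (U (\<rho> n)) (U (\<rho> n))) \<longlonglongrightarrow> L1"
    using LIMSEQ_subseq_LIMSEQ[OF \<sigma>(4) \<tau>(1)] by (simp add: o_def \<rho>_def)
  have EV: "(\<lambda>n. \<E> (V (\<rho> n)) (V (\<rho> n))) \<longlonglongrightarrow> L2" using \<tau>(4) by (simp add: \<rho>_def)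
  note comp = tendsto_integral_composition[of "\<lambda>n. U (\<rho> n)" C "\<lambda>n. V (\<rho> n)" u v,
      OF UV(1) EC(1) UV(2) EC(2) u_lim v_lim X_measurable[OF \<sigma>(2)] X_measurable[OF \<tau>(2)]]
  have "(\<lambda>n. G (U (\<rho> n)) (V (\<rho> n))) \<longlonglongrightarrow> G u v"
    unfolding G_def
    by (rule comp[of "\<lambda>x y. \<bar>x\<bar> powr p * \<bar>y\<bar> powr q" "p + q"])
       (use coupling_continuous coupling_growth p_gt_1 q_gt_1 subcritical in auto)
  then have Guv: "G u v = 1" using UV(5) by (simp add: LIMSEQ_const_iff)
  have growth: "x * x \<le> \<bar>x\<bar> powr 2 + \<bar>y\<bar> powr 2" "y * y \<le> \<bar>x\<bar> powr 2 + \<bar>y\<bar> powr 2"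
    "\<bar>x\<bar> * \<bar>y\<bar> \<le> \<bar>x\<bar> powr 2 + \<bar>y\<bar> powr 2" for x y :: real
  proof -
    have sq: "\<bar>x\<bar> powr 2 = x * x" "\<bar>y\<bar> powr 2 = y * y" by (simp_all add: power2_eq_square)
    have "2 * (\<bar>x\<bar> * \<bar>y\<bar>) \<le> x * x + y * y"
      using sum_squares_bound[of "\<bar>x\<bar>" "\<bar>y\<bar>"] by (simp add: mult.assoc power2_eq_square)
    moreover have "0 \<le> \<bar>x\<bar> * \<bar>y\<bar>" "0 \<le> x * x" "0 \<le> y * y" by simp_all
    ultimately show "x * x \<le> \<bar>x\<bar> powr 2 + \<bar>y\<bar> powr 2" "y * y \<le> \<bar>x\<bar> powr 2 + \<bar>y\<bar> powr 2"
      "\<bar>x\<bar> * \<bar>y\<bar> \<le> \<bar>x\<bar> powr 2 + \<bar>y\<bar> powr 2"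
      unfolding sq by linarith+
  qed
  have uu: "(\<lambda>n. LINT x|lborel. U (\<rho> n) x * U (\<rho> n) x) \<longlonglongrightarrow> (LINT x|lborel. u x * u x)"
    by (rule comp[of "\<lambda>x y. x * x" 2, OF _ _ growth(1)]) (use crit_gt_2 in \<open>auto intro!: continuous_intros\<close>)
  have vv: "(\<lambda>n. LINT x|lborel. V (\<rho> n) x * V (\<rho> n) x) \<longlonglongrightarrow> (LINT x|lborel. v x * v x)"
    by (rule comp[of "\<lambda>x y. y * y" 2, OF _ _ growth(2)]) (use crit_gt_2 in \<open>auto intro!: continuous_intros\<close>)
  \<comment> \<open>The limit lemma wants a nonnegative integrand, so the mixed product is treated
    through absolute values. These change nothing, as the sequences are nonnegative everywhere and
    the limits almost everywhere.\<close>
  have "(\<lambda>n. LINT x|lborel. \<bar>U (\<rho> n) x\<bar> * \<bar>V (\<rho> n) x\<bar>) \<longlonglongrightarrow> (LINT x|lborel. \<bar>u x\<bar> * \<bar>v x\<bar>)"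
    by (rule comp[of "\<lambda>x y. \<bar>x\<bar> * \<bar>y\<bar>" 2, OF _ _ growth(3)]) (use crit_gt_2 in \<open>auto intro!: continuous_intros\<close>)
  moreover have "(LINT x|lborel. \<bar>u x\<bar> * \<bar>v x\<bar>) = (LINT x|lborel. u x * v x)"
  proof (rule integral_cong_AE)
    show "AE x in lborel. \<bar>u x\<bar> * \<bar>v x\<bar> = u x * v x"
      using u_lim v_lim
    proof eventually_elim
      case (elim x)
      have "0 \<le> u x" by (rule LIMSEQ_le_const[OF elim(1)]) (use UV(3) in auto)
      moreover have "0 \<le> v x" by (rule LIMSEQ_le_const[OF elim(2)]) (use UV(4) in auto)
      ultimately show ?case by simp
    qed
  qed (use X_measurable[OF \<sigma>(2)] X_measurable[OF \<tau>(2)] in measurable)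
  ultimately have uv: "(\<lambda>n. LINT x|lborel. U (\<rho> n) x * V (\<rho> n) x) \<longlonglongrightarrow> (LINT x|lborel. u x * v x)"
    using UV(3,4) by simp
  then have vu: "(\<lambda>n. LINT x|lborel. V (\<rho> n) x * U (\<rho> n) x) \<longlonglongrightarrow> (LINT x|lborel. v x * u x)"
    by (simp add: mult.commute)
  have "(\<lambda>n. L (U (\<rho> n)) (V (\<rho> n)) (U (\<rho> n)) (V (\<rho> n))) \<longlonglongrightarrow> L u v u v"
    unfolding L_eq[OF UV(1,2,1,2)] L_eq[OF \<sigma>(2) \<tau>(2) \<sigma>(2) \<tau>(2)]
    by (intro tendsto_add tendsto_mult tendsto_const uu vv uv vu)
  \<comment> \<open>\<open>L1\<close> and \<open>L2\<close> are limits of energies and may exceed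
    those of \<open>u\<close> and \<open>v\<close>; this is the right direction for
    \<open>Q u v \<le> m\<close>.\<close>
  then have Q_lim: "(\<lambda>n. Q (U (\<rho> n)) (V (\<rho> n))) \<longlonglongrightarrow> L1 + L2 - L u v u v"
    unfolding Q_def by (intro tendsto_add tendsto_diff EU EV)
  have "(\<lambda>n. m + 1 / real (Suc (\<rho> n))) \<longlonglongrightarrow> m + 0"
    using LIMSEQ_subseq_LIMSEQ[OF LIMSEQ_Suc[OF lim_1_over_n] \<rho>]
    by (intro tendsto_add tendsto_const) (simp add: o_def)
  from LIMSEQ_le[OF Q_lim this] have "L1 + L2 - L u v u v \<le> m" using UV(6) by simp
  then have Q_le: "Q u v \<le> m" using \<sigma>(5) \<tau>(5) by (simp add: Q_def)
  \<comment> \<open>The limits are nonnegative only almost everywhere; absolute values make this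
    hold at every point.\<close>
  define u' v' where "u' x = \<bar>u x\<bar>" and "v' x = \<bar>v x\<bar>" for x
  have X': "u' \<in> \<X>" "v' \<in> \<X>" using X_abs[OF \<sigma>(2)] X_abs[OF \<tau>(2)] by (simp_all add: u'_def[abs_def] v'_def[abs_def])
  have G': "G u' v' = 1" using Guv by (simp add: G_def u'_def v'_def)
  have "Q u' v' \<le> m"
    using Q_abs_le[OF \<sigma>(2) \<tau>(2)] Q_le by (simp add: u'_def[abs_def] v'_def[abs_def])
  then have Q': "Q u' v' = m" using m_le[OF X' G'] by simp
  have "0 < m"
  proof (rule ccontr)
    assume "\<not> 0 < m"
    then show False using Q_eq_0_imp_G_eq_0[OF X'] Q' G' by simp
  qed
  show ?thesis
    by (rule that[OF X' _ _ G' Q' \<open>0 < m\<close> m_le]) (simp_all add: u'_def v'_def)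
qed

text \<open>The function \<open>t \<mapsto> Q (u + t \<phi>) (v + t \<psi>) - m G (u + t \<phi>) (v + t \<psi>) powr (2 / (p + q))\<close> is
  nonnegative by homogeneity and vanishes at \<open>0\<close>.\<close>
lemma euler_lagrange:
  assumes u: "u \<in> \<X>" and v: "v \<in> \<X>" and G1: "G u v = 1" and Qm: "Q u v = m"
    and min: "\<And>w z. w \<in> \<X> \<Longrightarrow> z \<in> \<X> \<Longrightarrow> G w z = 1 \<Longrightarrow> m \<le> Q w z"
    and \<phi>: "\<phi> \<in> \<X>" and \<psi>: "\<psi> \<in> \<X>"
  shows "\<E> u \<phi> + \<E> v \<psi> = L u v \<phi> \<psi> + m / (p + q) *
    (LINT x|lborel. p * (sgn (u x) * \<bar>u x\<bar> powr (p - 1) * \<phi> x * \<bar>v x\<bar> powr q)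
      + q * (sgn (v x) * \<bar>v x\<bar> powr (q - 1) * \<psi> x * \<bar>u x\<bar> powr p))"
proof -
  define r where "r = p + q"
  have r: "0 < r" using p_gt_1 q_gt_1 by (simp add: r_def)
  define D where "D = (LINT x|lborel. p * (sgn (u x) * \<bar>u x\<bar> powr (p - 1) * \<phi> x * \<bar>v x\<bar> powr q)
      + q * (sgn (v x) * \<bar>v x\<bar> powr (q - 1) * \<psi> x * \<bar>u x\<bar> powr p))"
  define ut where "ut t x = u x + t * \<phi> x" for t x
  define vt where "vt t x = v x + t * \<psi> x" for t x
  have X: "ut t \<in> \<X>" "vt t \<in> \<X>" for t
    unfolding ut_def vt_def by (intro X_add_scaled u v \<phi> \<psi>)+
  define B where "B = \<E> u \<phi> + \<E> v \<psi> - L u v \<phi> \<psi>"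
  have Q_exp: "Q (ut t) (vt t) = m + 2 * t * B + t\<^sup>2 * Q \<phi> \<psi>" for t
  proof -
    have "L (ut t) (vt t) (ut t) (vt t) = L u v u v + 2 * t * L u v \<phi> \<psi> + t\<^sup>2 * L \<phi> \<psi> \<phi> \<psi>"
    proof -
      note int = X_product_integrable[OF u u] X_product_integrable[OF u v] X_product_integrable[OF v u]
        X_product_integrable[OF v v] X_product_integrable[OF u \<phi>] X_product_integrable[OF u \<psi>]
        X_product_integrable[OF v \<phi>] X_product_integrable[OF v \<psi>] X_product_integrable[OF \<phi> \<phi>]
        X_product_integrable[OF \<phi> \<psi>] X_product_integrable[OF \<psi> \<phi>] X_product_integrable[OF \<psi> \<psi>]
      have 1: "ut t x * ut t x = u x * u x + 2 * t * (u x * \<phi> x) + t\<^sup>2 * (\<phi> x * \<phi> x)"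
        and 2: "ut t x * vt t x = u x * v x + t * (u x * \<psi> x) + t * (v x * \<phi> x) + t\<^sup>2 * (\<phi> x * \<psi> x)"
        and 3: "vt t x * ut t x = v x * u x + t * (u x * \<psi> x) + t * (v x * \<phi> x) + t\<^sup>2 * (\<psi> x * \<phi> x)"
        and 4: "vt t x * vt t x = v x * v x + 2 * t * (v x * \<psi> x) + t\<^sup>2 * (\<psi> x * \<psi> x)" for x
        by (simp_all add: ut_def vt_def power2_eq_square algebra_simps)
      show ?thesis
        unfolding L_eq[OF X X] L_eq[OF u v u v] L_eq[OF u v \<phi> \<psi>] L_eq[OF \<phi> \<psi> \<phi> \<psi>] 1 2 3 4
        by (simp add: int) (simp add: algebra_simps)
    qed
    then show ?thesis
      using X_inner_add_scaled[OF X_Hs[OF u] X_Hs[OF \<phi>], of t] X_inner_add_scaled[OF X_Hs[OF v] X_Hs[OF \<psi>], of t] Qm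
      by (simp add: Q_def B_def ut_def[abs_def] vt_def[abs_def] algebra_simps)
  qed
  have G_deriv: "((\<lambda>t. G (ut t) (vt t)) has_real_derivative D) (at 0)"
    unfolding G_def ut_def vt_def D_def
    by (rule coupling_integral_derivative[OF p_gt_1 q_gt_1])
       (use X_measurable[OF u] X_measurable[OF v] X_measurable[OF \<phi>] X_measurable[OF \<psi>]
          X_coupling_integrable[OF u v \<phi> \<psi>] in auto)
  have G0: "G (ut 0) (vt 0) = 1" using G1 by (simp add: ut_def[abs_def] vt_def[abs_def])
  \<comment> \<open>Both sides have degree 2, so a pair with nonzero coupling can be scaled to
    \<open>G = 1\<close>. Otherwise the left side is 0 because
    \<open>0 powr (2 / r) = 0\<close>.\<close>
  have ge: "m * G w z powr (2 / r) \<le> Q w z" if wz: "w \<in> \<X>" "z \<in> \<X>" for w z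
  proof (cases "G w z = 0")
    case False
    then have g: "0 < G w z" using G_nonneg[of w z] by simp
    define t where "t = (1 / G w z) powr (1 / r)"
    have t: "0 \<le> t" by (simp add: t_def)
    have "t powr r = 1 / G w z" using g r by (simp add: t_def powr_powr)
    then have "G (\<lambda>x. t * w x) (\<lambda>x. t * z x) = 1" using G_scale[OF t, of w z] g by (simp add: r_def)
    then have "m \<le> Q (\<lambda>x. t * w x) (\<lambda>x. t * z x)" by (intro min X_scale wz)
    then have "m \<le> t\<^sup>2 * Q w z" by (simp add: Q_scale)
    also have "t\<^sup>2 = t powr 2" using t by simp
    also have "t powr 2 = 1 / G w z powr (2 / r)" using g by (simp add: t_def powr_powr powr_divide)
    finally show ?thesis using g by (simp add: pos_le_divide_eq)
  qed (simp add: Q_nonneg[OF wz])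
  define f where "f t = m + 2 * t * B + t\<^sup>2 * Q \<phi> \<psi> - m * G (ut t) (vt t) powr (2 / r)" for t
  have "((\<lambda>t. G (ut t) (vt t) powr (2 / r)) has_real_derivative
      2 / r * G (ut 0) (vt 0) powr (2 / r - of_nat 1) * D) (at 0)"
    by (rule DERIV_fun_powr[OF G_deriv]) (simp add: G0)
  then have Gp: "((\<lambda>t. G (ut t) (vt t) powr (2 / r)) has_real_derivative 2 / r * D) (at 0)"
    by (simp add: G0)
  have "(f has_real_derivative 2 * B - m * (2 / r * D)) (at 0)"
  proof -
    have "((\<lambda>t. m + 2 * t * B + t\<^sup>2 * Q \<phi> \<psi>) has_real_derivative 2 * B) (at 0)"
      by (auto intro!: derivative_eq_intros)
    from DERIV_diff[OF this DERIV_cmult[OF Gp, of m]] show ?thesis by (simp add: f_def[abs_def])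
  qed
  then have "2 * B - m * (2 / r * D) = 0"
  proof (rule DERIV_local_min[where d = 1])
    have "0 \<le> f t" for t using ge[OF X, of t t] by (simp add: f_def Q_exp)
    moreover have "f 0 = 0" by (simp add: f_def G0)
    ultimately show "\<forall>y. \<bar>0 - y\<bar> < 1 \<longrightarrow> f 0 \<le> f y" by simp
  qed simp
  moreover have "m * (2 / r * D) = 2 * (m / r * D)" by simp
  ultimately have "B = m / r * D" by linarith
  then show ?thesis by (simp add: B_def D_def r_def)
qed

end

section \<open>The positive solution\<close>

context frac_system
begin

text \<open>Multiplication by \<open>t\<close> scales the form and the linear terms by
  \<open>t\<close>, the coupling terms by \<open>t powr (p + q - 1)\<close>. The multiplier
  \<open>m / (p + q)\<close> therefore becomes \<open>2 / (p + q)\<close> when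
  \<open>t powr (p + q - 2) = m / 2\<close>. The conclusion \<open>G u v \<noteq> 0\<close> is kept
  to exclude a vanishing component.\<close>

lemma minimizer_gives_solution:
  obtains u v where "u \<in> \<X>" "v \<in> \<X>" "\<And>x. 0 \<le> u x" "\<And>x. 0 \<le> v x" "G u v \<noteq> 0"
    "\<And>\<phi> \<psi>. \<phi> \<in> \<X> \<Longrightarrow> \<psi> \<in> \<X> \<Longrightarrow> \<E> u \<phi> + \<E> v \<psi> = L u v \<phi> \<psi>
      + 2 * p / (p + q) * (LINT x|lborel. u x powr (p - 1) * \<phi> x * v x powr q)
      + 2 * q / (p + q) * (LINT x|lborel. v x powr (q - 1) * \<psi> x * u x powr p)"
proof -
  obtain u v m where uv: "u \<in> \<X>" "v \<in> \<X>" "\<And>x. 0 \<le> u x" "\<And>x. 0 \<le> v x" "G u v = 1" "Q u v = m" "0 < m"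
      "\<And>w z. w \<in> \<X> \<Longrightarrow> z \<in> \<X> \<Longrightarrow> G w z = 1 \<Longrightarrow> m \<le> Q w z"
    by (rule minimizer_exists) blast
  define r where "r = p + q"
  have r: "2 < r" using p_gt_1 q_gt_1 by (simp add: r_def)
  define t where "t = (m / 2) powr (1 / (r - 2))"
  have t: "0 < t" using uv(7) by (simp add: t_def)
  have "t powr (r - 2) = m / 2" using uv(7) r by (simp add: t_def powr_powr)
  then have tr: "t powr (r - 1) = t * (m / 2)"
    using t powr_add[of t "r - 2" 1] by simp
  define U where "U x = t * u x" for x
  define V where "V x = t * v x" for x
  have UV: "U \<in> \<X>" "V \<in> \<X>" unfolding U_def[abs_def] V_def[abs_def] by (intro X_scale uv)+
  show ?thesis
  proof (rule that[OF UV])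
    show "0 \<le> U x" "0 \<le> V x" for x using t uv(3,4) by (simp_all add: U_def V_def)
    show "G U V \<noteq> 0" using t uv(5) by (simp add: U_def[abs_def] V_def[abs_def] G_scale)
    fix \<phi> \<psi> assume \<phi>: "\<phi> \<in> \<X>" and \<psi>: "\<psi> \<in> \<X>"
    define I1 where "I1 = (LINT x|lborel. u x powr (p - 1) * \<phi> x * v x powr q)"
    define I2 where "I2 = (LINT x|lborel. v x powr (q - 1) * \<psi> x * u x powr p)"
    have sgn_powr: "sgn y * y powr \<alpha> = y powr \<alpha>" if "0 \<le> y" for y \<alpha> :: real
      using that by (cases "y = 0") auto
    have "\<E> u \<phi> + \<E> v \<psi> = L u v \<phi> \<psi> + m / r *
        (LINT x|lborel. p * (u x powr (p - 1) * \<phi> x * v x powr q) + q * (v x powr (q - 1) * \<psi> x * u x powr p))"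
      using euler_lagrange[OF uv(1,2,5,6,8) \<phi> \<psi>]
      by (simp only: abs_of_nonneg[OF uv(3)] abs_of_nonneg[OF uv(4)] sgn_powr[OF uv(3)] sgn_powr[OF uv(4)] r_def)
    also have "(LINT x|lborel. p * (u x powr (p - 1) * \<phi> x * v x powr q) + q * (v x powr (q - 1) * \<psi> x * u x powr p))
        = p * I1 + q * I2"
      using nonlinear_term_integrable(1)[OF uv(1,2) \<phi>] nonlinear_term_integrable(2)[OF uv(1,2) \<psi>] uv(3,4)
      by (simp add: I1_def I2_def)
    finally have EL: "\<E> u \<phi> + \<E> v \<psi> = L u v \<phi> \<psi> + m / r * (p * I1 + q * I2)" .
    have "\<E> U \<phi> + \<E> V \<psi> = t * (\<E> u \<phi> + \<E> v \<psi>)"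
      by (simp add: U_def[abs_def] V_def[abs_def] X_inner_scale_left distrib_left)
    also have "\<dots> = t * L u v \<phi> \<psi> + (2 * p / r * (t powr (r - 1) * I1) + 2 * q / r * (t powr (r - 1) * I2))"
      unfolding EL tr by (simp add: algebra_simps add_divide_distrib)
    also have "t * L u v \<phi> \<psi> = L U V \<phi> \<psi>"
      unfolding L_def integral_mult_right_zero[symmetric] U_def V_def
      by (intro Bochner_Integration.integral_cong) (auto simp: algebra_simps)
    also have "t powr (r - 1) * I1 = (LINT x|lborel. U x powr (p - 1) * \<phi> x * V x powr q)"
    proof -
      have e: "r - 1 = (p - 1) + q" by (simp add: r_def)
      show ?thesis
        unfolding I1_def integral_mult_right_zero[symmetric] U_def V_def e powr_add using t uv(3,4)
        by (intro Bochner_Integration.integral_cong) (auto simp: powr_mult mult_ac)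
    qed
    also have "t powr (r - 1) * I2 = (LINT x|lborel. V x powr (q - 1) * \<psi> x * U x powr p)"
    proof -
      have e: "r - 1 = (q - 1) + p" by (simp add: r_def)
      show ?thesis
        unfolding I2_def integral_mult_right_zero[symmetric] U_def V_def e powr_add using t uv(3,4)
        by (intro Bochner_Integration.integral_cong) (auto simp: powr_mult mult_ac)
    qed
    finally show "\<E> U \<phi> + \<E> V \<psi> = L U V \<phi> \<psi>
      + 2 * p / (p + q) * (LINT x|lborel. U x powr (p - 1) * \<phi> x * V x powr q)
      + 2 * q / (p + q) * (LINT x|lborel. V x powr (q - 1) * \<psi> x * U x powr p)"
      by (simp add: r_def)
  qed
qed

theorem positive_weak_solution_exists:
  "\<exists>u v. positive_weak_solution s \<Omega>
    (\<lambda>u v. a * u + b * v + 2 * p / (p + q) * u powr (p - 1) * v powr q)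
    (\<lambda>u v. b * u + c * v + 2 * q / (p + q) * u powr p * v powr (q - 1))
    (u, v)"
proof -
  define k1 where "k1 = 2 * p / (p + q)"
  define k2 where "k2 = 2 * q / (p + q)"
  have k: "0 \<le> k1" "0 \<le> k2" using p_gt_1 q_gt_1 by (auto simp: k1_def k2_def)
  obtain U V where UV: "U \<in> \<X>" "V \<in> \<X>" "\<And>x. 0 \<le> U x" "\<And>x. 0 \<le> V x" "G U V \<noteq> 0"
      "\<And>\<phi> \<psi>. \<phi> \<in> \<X> \<Longrightarrow> \<psi> \<in> \<X> \<Longrightarrow> \<E> U \<phi> + \<E> V \<psi> = L U V \<phi> \<psi>
      + k1 * (LINT x|lborel. U x powr (p - 1) * \<phi> x * V x powr q)
      + k2 * (LINT x|lborel. V x powr (q - 1) * \<psi> x * U x powr p)"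
    unfolding k1_def k2_def by (rule minimizer_gives_solution) blast
  have neg_abs: "- \<bar>d\<bar> * y \<le> d * y" if "0 \<le> y" for d y :: real
    by (rule mult_right_mono) (use that in auto)
  have G_zero: "G U V = 0" if "AE x in lborel. \<bar>U x\<bar> powr p * \<bar>V x\<bar> powr q = 0"
    unfolding G_def by (rule integral_eq_zero_AE[OF that])
  have "\<not> (AE x in lborel. U x = 0)"
  proof
    assume "AE x in lborel. U x = 0"
    then have "AE x in lborel. \<bar>U x\<bar> powr p * \<bar>V x\<bar> powr q = 0" by eventually_elim simp
    then show False using G_zero UV(5) by blast
  qed
  then have U_pos: "AE x in lborel. x \<in> \<Omega> \<longrightarrow> 0 < U x"
  \<comment> \<open>Testing with \<open>\<phi>\<close> in the first slot and 0 in the second, the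
    \<open>b\<close> term and the coupling are nonnegative. The sign of \<open>a\<close> is unknown,
    hence the constant \<open>\<bar>a\<bar>\<close>.\<close>
  proof (rule strong_maximum_principle[OF UV(1,3), where k = "\<bar>a\<bar>"])
    fix \<phi> assume \<phi>: "\<phi> \<in> \<X>" "\<And>x. 0 \<le> \<phi> x"
    have "0 \<le> (LINT x|lborel. U x * \<phi> x)" "0 \<le> (LINT x|lborel. V x * \<phi> x)"
      "0 \<le> (LINT x|lborel. U x powr (p - 1) * \<phi> x * V x powr q)"
      using UV(3,4) \<phi>(2) by simp_all
    then have "- \<bar>a\<bar> * (LINT x|lborel. U x * \<phi> x) \<le> a * (LINT x|lborel. U x * \<phi> x)"
      "0 \<le> b * (LINT x|lborel. V x * \<phi> x)"
      "0 \<le> k1 * (LINT x|lborel. U x powr (p - 1) * \<phi> x * V x powr q)"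
      by (blast intro: neg_abs mult_nonneg_nonneg b_nonneg k)+
    then show "- \<bar>a\<bar> * (LINT x|lborel. U x * \<phi> x) \<le> \<E> U \<phi>"
      using UV(6)[OF \<phi>(1) X_const_zero] by (simp add: L_eq[OF UV(1,2) \<phi>(1) X_const_zero])
  qed simp
  have "\<not> (AE x in lborel. V x = 0)"
  proof
    assume "AE x in lborel. V x = 0"
    then have "AE x in lborel. \<bar>U x\<bar> powr p * \<bar>V x\<bar> powr q = 0" by eventually_elim simp
    then show False using G_zero UV(5) by blast
  qed
  then have V_pos: "AE x in lborel. x \<in> \<Omega> \<longrightarrow> 0 < V x"
  proof (rule strong_maximum_principle[OF UV(2,4), where k = "\<bar>c\<bar>"])
    fix \<phi> assume \<phi>: "\<phi> \<in> \<X>" "\<And>x. 0 \<le> \<phi> x"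
    have "0 \<le> (LINT x|lborel. V x * \<phi> x)" "0 \<le> (LINT x|lborel. U x * \<phi> x)"
      "0 \<le> (LINT x|lborel. V x powr (q - 1) * \<phi> x * U x powr p)"
      using UV(3,4) \<phi>(2) by simp_all
    then have "- \<bar>c\<bar> * (LINT x|lborel. V x * \<phi> x) \<le> c * (LINT x|lborel. V x * \<phi> x)"
      "0 \<le> b * (LINT x|lborel. U x * \<phi> x)"
      "0 \<le> k2 * (LINT x|lborel. V x powr (q - 1) * \<phi> x * U x powr p)"
      by (blast intro: neg_abs mult_nonneg_nonneg b_nonneg k)+
    then show "- \<bar>c\<bar> * (LINT x|lborel. V x * \<phi> x) \<le> \<E> V \<phi>"
      using UV(6)[OF X_const_zero \<phi>(1)] by (simp add: L_eq[OF UV(1,2) X_const_zero \<phi>(1)])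
  qed simp
  \<comment> \<open>Positivity is demanded at every point of \<Omega>, so the value 1 is put on the
    exceptional null set. The value 0 outside lets integrals over \<Omega> be computed over the
    whole space.\<close>
  define rep where "rep w x = (if x \<in> \<Omega> then if 0 < w x then w x else 1 else 0)" for w :: "'a \<Rightarrow> real" and x
  have rep_meas: "rep w \<in> borel_measurable borel" if [measurable]: "w \<in> borel_measurable borel" for w
    unfolding rep_def[abs_def] by measurable
  have rep_AE: "AE x in lborel. w x = rep w x" if "w \<in> \<X>" "AE x in lborel. x \<in> \<Omega> \<longrightarrow> 0 < w x" for w
    using X_zero_AE[OF that(1)] that(2) by eventually_elim (auto simp: rep_def)
  have rep_nonneg: "0 \<le> rep w x" for w x by (simp add: rep_def)
  define u v where "u = rep U" and "v = rep V"
  have meas [measurable]: "u \<in> borel_measurable borel" "v \<in> borel_measurable borel"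
    "U \<in> borel_measurable borel" "V \<in> borel_measurable borel"
    unfolding u_def v_def using UV(1,2) by (auto intro: rep_meas X_measurable)
  have ae: "AE x in lborel. U x = u x" "AE x in lborel. V x = v x"
    unfolding u_def v_def by (rule rep_AE UV(1,2) U_pos V_pos)+
  have uv: "u \<in> \<X>" "v \<in> \<X>"
    using X_cong_AE[OF UV(1) _ ae(1)] X_cong_AE[OF UV(2) _ ae(2)] by auto
  have nonneg: "0 \<le> u x" "0 \<le> v x" for x by (simp_all add: u_def v_def rep_nonneg)
  define f where "f u v = a * u + b * v + 2 * p / (p + q) * u powr (p - 1) * v powr q" for u v :: real
  define g where "g u v = b * u + c * v + 2 * q / (p + q) * u powr p * v powr (q - 1)" for u v :: real
  have off: "u x = 0" "v x = 0" if "x \<notin> \<Omega>" for x using that by (simp_all add: u_def v_def rep_def)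
  \<comment> \<open>Outside \<Omega> both components are 0, and \<open>0 powr (p - 1) = 0\<close>,
    so the right-hand sides vanish there.\<close>
  have f_off: "indicator \<Omega> x *\<^sub>R (f (u x) (v x) * y) = f (u x) (v x) * y"
    and g_off: "indicator \<Omega> x *\<^sub>R (g (u x) (v x) * y) = g (u x) (v x) * y" for x y
    by (cases "x \<in> \<Omega>"; simp add: f_def g_def off)+
  have weak: "set_integrable lborel \<Omega> (\<lambda>x. f (u x) (v x) * \<phi> x) \<and>
      set_integrable lborel \<Omega> (\<lambda>x. g (u x) (v x) * \<psi> x) \<and>
      Y_inner s (u, v) (\<phi>, \<psi>) = (LINT x:\<Omega>|lborel. f (u x) (v x) * \<phi> x) + (LINT x:\<Omega>|lborel. g (u x) (v x) * \<psi> x)"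
    if \<phi>: "\<phi> \<in> \<X>" and \<psi>: "\<psi> \<in> \<X>" for \<phi> \<psi>
  proof -
    have [measurable]: "\<phi> \<in> borel_measurable borel" "\<psi> \<in> borel_measurable borel"
      using \<phi> \<psi> by (auto intro: X_measurable)
    have f_eq: "f (u x) (v x) * \<phi> x = a * (u x * \<phi> x) + b * (v x * \<phi> x) + k1 * (u x powr (p - 1) * \<phi> x * v x powr q)" for x
      by (simp add: f_def k1_def algebra_simps)
    have g_eq: "g (u x) (v x) * \<psi> x = b * (u x * \<psi> x) + c * (v x * \<psi> x) + k2 * (v x powr (q - 1) * \<psi> x * u x powr p)" for x
      by (simp add: g_def k2_def algebra_simps)
    have n1: "integrable lborel (\<lambda>x. u x powr (p - 1) * \<phi> x * v x powr q)"
      using nonlinear_term_integrable(1)[OF uv \<phi>] nonneg by simp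
    have n2: "integrable lborel (\<lambda>x. v x powr (q - 1) * \<psi> x * u x powr p)"
      using nonlinear_term_integrable(2)[OF uv \<psi>] nonneg by simp
    note prods = X_product_integrable[OF uv(1) \<phi>] X_product_integrable[OF uv(1) \<psi>]
      X_product_integrable[OF uv(2) \<phi>] X_product_integrable[OF uv(2) \<psi>]
    have f_int: "integrable lborel (\<lambda>x. f (u x) (v x) * \<phi> x)"
      unfolding f_eq using prods n1 by simp
    have g_int: "integrable lborel (\<lambda>x. g (u x) (v x) * \<psi> x)"
      unfolding g_eq using prods n2 by simp
    have "Y_inner s (u, v) (\<phi>, \<psi>) = \<E> U \<phi> + \<E> V \<psi>"
      using X_inner_cong_AE[OF _ _ _ ae(1), of \<phi>] X_inner_cong_AE[OF _ _ _ ae(2), of \<psi>] by (simp add: Y_inner_def)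
    also have "\<dots> = L U V \<phi> \<psi> + k1 * (LINT x|lborel. U x powr (p - 1) * \<phi> x * V x powr q)
        + k2 * (LINT x|lborel. V x powr (q - 1) * \<psi> x * U x powr p)"
      by (rule UV(6)[OF \<phi> \<psi>])
    also have "L U V \<phi> \<psi> = L u v \<phi> \<psi>"
      unfolding L_def
    proof (rule integral_cong_AE)
      show "AE x in lborel. a * (U x * \<phi> x) + b * (U x * \<psi> x) + b * (V x * \<phi> x) + c * (V x * \<psi> x)
          = a * (u x * \<phi> x) + b * (u x * \<psi> x) + b * (v x * \<phi> x) + c * (v x * \<psi> x)"
        using ae by eventually_elim simp
    qed measurable
    also have "(LINT x|lborel. U x powr (p - 1) * \<phi> x * V x powr q) = (LINT x|lborel. u x powr (p - 1) * \<phi> x * v x powr q)"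
    proof (rule integral_cong_AE)
      show "AE x in lborel. U x powr (p - 1) * \<phi> x * V x powr q = u x powr (p - 1) * \<phi> x * v x powr q"
        using ae by eventually_elim simp
    qed measurable
    also have "(LINT x|lborel. V x powr (q - 1) * \<psi> x * U x powr p) = (LINT x|lborel. v x powr (q - 1) * \<psi> x * u x powr p)"
    proof (rule integral_cong_AE)
      show "AE x in lborel. V x powr (q - 1) * \<psi> x * U x powr p = v x powr (q - 1) * \<psi> x * u x powr p"
        using ae by eventually_elim simp
    qed measurable
    also have "L u v \<phi> \<psi> + k1 * (LINT x|lborel. u x powr (p - 1) * \<phi> x * v x powr q)
        + k2 * (LINT x|lborel. v x powr (q - 1) * \<psi> x * u x powr p)
        = (LINT x|lborel. f (u x) (v x) * \<phi> x) + (LINT x|lborel. g (u x) (v x) * \<psi> x)"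
      unfolding f_eq g_eq L_eq[OF uv \<phi> \<psi>] using prods n1 n2 by simp
    finally show ?thesis
      using f_int g_int unfolding set_integrable_def set_lebesgue_integral_def f_off g_off by blast
  qed
  have "positive_weak_solution s \<Omega> f g (u, v)"
    unfolding positive_weak_solution_def weak_solution_def Y_space_def
    using uv weak by (auto simp: u_def v_def rep_def)
  then show ?thesis unfolding f_def[abs_def] g_def[abs_def] by blast
qed

end

theorem theorem1p1:
  fixes s p q a b c \<mu>\<^sub>1 \<mu>\<^sub>2 :: real and \<Omega> :: "'a::euclidean_space set"
  assumes "0 < s" and "s < 1"
    and "real DIM('a) > 2 * s"
    and "smooth_bounded_domain \<Omega>"
    and "p > 1" and "q > 1"
    and "{\<mu>. eigenvalue (mat_of_rows_list 2 [[a, b], [b, c]]) \<mu>} = {\<mu>\<^sub>1, \<mu>\<^sub>2}"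
    and "\<mu>\<^sub>1 \<le> \<mu>\<^sub>2"
    and "b \<ge> 0"
    and "\<mu>\<^sub>2 < first_eigenvalue s \<Omega>"
    and "p + q < 2 * real DIM('a) / (real DIM('a) - 2 * s)"
  shows "\<exists>u v. positive_weak_solution s \<Omega>
    (\<lambda>u v. a * u + b * v + 2 * p / (p + q) * u powr (p - 1) * v powr q)
    (\<lambda>u v. b * u + c * v + 2 * q / (p + q) * u powr p * v powr (q - 1))
    (u, v)"
proof -
  interpret D: frac_domain s \<Omega>
    using assms(1-4) by unfold_locales (auto simp: smooth_bounded_domain_def)
  interpret frac_system s \<Omega> p q a b c \<mu>\<^sub>2
  proof unfold_locales
    show "p + q < D.crit" using assms(11) by (simp add: D.crit_def)
    show "a * x\<^sup>2 + 2 * b * x * y + c * y\<^sup>2 \<le> \<mu>\<^sub>2 * (x\<^sup>2 + y\<^sup>2)" for x y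
      by (rule quadratic_form_le_max_eigenvalue[OF assms(7,8)])
    show "\<Omega> \<noteq> {}" using assms(4) by (simp add: smooth_bounded_domain_def)
  qed (use assms in auto)
  show ?thesis by (rule positive_weak_solution_exists)
qed

end
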